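(* Let $1/2 \leq c <1$, $\epsilon>0$, and let $k$ be any real number. Suppose that $X$ and $T \to \infty$ with $X = O\big((\log T)^{1/(1-c+\epsilon)}\big)$. Then \[ \frac{1}{T}\int_T^{2T} |P_X(\sigma+ i t)|^{2k}\,dt = a(k,\sigma)\, F_X(k,\sigma)\left(1+ O_k\!\left(\frac{1}{\log X}\right)\right) \] uniformly for $c \leq \sigma\leq 1$, where $P_X(s)=\exp\big(\sum_{n\leq X}\Lambda(n)n^{-s}/\log n\big)$, \[ a(k,\sigma) = \prod_{p}\left\{\left(1-\frac{1}{p^{2\sigma}}\right)^{k^2}\sum_{m=0}^{\infty}\frac{d_k(p^m)^{2}}{p^{2m\sigma}}\right\}, \] and \[ F_X(k,\sigma)=\begin{cases}\zeta(2\sigma)^{k^2}\, e^{-k^2 E_1((2\sigma-1)\log X)} & \text{if } \sigma>1/2,\\ (e^{\gamma}\log X)^{k^2} & \text{if } \sigma=1/2.\end{cases} \]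
   Context: $\Lambda$ is the von Mangoldt function; the product in $a(k,\sigma)$ is over all primes $p$. For real $k$, $d_k(n)$ is the multiplicative function with $\sum_n d_k(n)n^{-s}=\zeta(s)^k$, so $d_k(p^m)=\Gamma(m+k)/(m!\,\Gamma(k))$. $E_1(z)=\int_z^\infty e^{-w}w^{-1}\,dw$ is the exponential integral and $\gamma=0.5772\ldots$ is Euler's constant. *)

theory Defs
  imports "HOL-Analysis.Analysis" "HOL-Number_Theory.Number_Theory"
begin

text \<open>
  The Riemann zeta function is only evaluated at real points \<open>s > 1\<close>, where it is given by its
  Dirichlet series.
\<close>

definition real_zeta :: "real \<Rightarrow> real" where
  "real_zeta s = (\<Sum>n. 1 / real (Suc n) powr s)"

text \<open>
  The multiplicative function \<open>d\<^sub>k\<close> with \<open>d\<^sub>k(p^m) = \<Gamma>(m+k) / (m! \<Gamma>(k))\<close>.  The quotient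
  \<open>\<Gamma>(m+k) / \<Gamma>(k)\<close> has a removable singularity when \<open>k\<close> is a non-positive integer; the
  Pochhammer symbol \<open>k(k+1)\<dots>(k+m-1)\<close> is its value for every real \<open>k\<close>.
\<close>

definition gen_divisor :: "real \<Rightarrow> nat \<Rightarrow> real" where
  "gen_divisor k n =
     (\<Prod>p\<in>prime_factors n. pochhammer k (multiplicity p n) / fact (multiplicity p n))"

lemma gen_divisor_prime_power:
  assumes "prime p"
  shows "gen_divisor k (p ^ m) = pochhammer k m / fact m"
proof (cases "m = 0")
  case False
  then have "prime_factors (p ^ m) = {p}"
    using assms by (simp add: prime_factors_power prime_prime_factors)
  then show ?thesis
    using assms by (simp add: gen_divisor_def)
qed (simp add: gen_divisor_def)

lemma gen_divisor_prime_power_Gamma: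
  assumes "prime p" "k \<notin> \<int>\<^sub>\<le>\<^sub>0"
  shows "gen_divisor k (p ^ m) = Gamma (real m + k) / (fact m * Gamma k)"
  using assms by (simp add: gen_divisor_prime_power pochhammer_Gamma add.commute)

lemma gen_divisor_1: "gen_divisor k 1 = 1"
  by (simp add: gen_divisor_def)

lemma gen_divisor_mult_coprime:
  assumes "coprime m n" "m > 0" "n > 0"
  shows "gen_divisor k (m * n) = gen_divisor k m * gen_divisor k n"
proof -
  let ?g = "\<lambda>n p. pochhammer k (multiplicity p n) / fact (multiplicity p n)"
  have un: "prime_factors (m * n) = prime_factors m \<union> prime_factors n"
    using assms by (simp add: prime_factors_product)
  have disj: "prime_factors m \<inter> prime_factors n = {}"
    using assms(1) by (auto simp: in_prime_factors_iff dest: coprime_common_divisor)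
  have mult: "multiplicity p (m * n) = multiplicity p m + multiplicity p n" if "prime p" for p
    using assms that by (simp add: prime_elem_multiplicity_mult_distrib)
  have m: "?g (m * n) p = ?g m p" if "p \<in> prime_factors m" for p
  proof -
    have p: "prime p" "\<not> p dvd n"
      using that disj assms by (auto simp: in_prime_factors_iff)
    then have "multiplicity p n = 0"
      by (intro not_dvd_imp_multiplicity_0)
    then show ?thesis by (simp add: mult[OF p(1)])
  qed
  have n: "?g (m * n) p = ?g n p" if "p \<in> prime_factors n" for p
  proof -
    have p: "prime p" "\<not> p dvd m"
      using that disj assms by (auto simp: in_prime_factors_iff)
    then have "multiplicity p m = 0"
      by (intro not_dvd_imp_multiplicity_0)
    then show ?thesis by (simp add: mult[OF p(1)])
  qed
  have "(\<Prod>p\<in>prime_factors m \<union> prime_factors n. ?g (m * n) p) =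
      (\<Prod>p\<in>prime_factors m. ?g (m * n) p) * (\<Prod>p\<in>prime_factors n. ?g (m * n) p)"
    using disj by (intro prod.union_disjoint) auto
  also have "\<dots> = (\<Prod>p\<in>prime_factors m. ?g m p) * (\<Prod>p\<in>prime_factors n. ?g n p)"
    using m n by (intro arg_cong2[where f = "(*)"] prod.cong refl)
  finally show ?thesis
    by (simp only: gen_divisor_def un)
qed

text \<open>The local factors of \<open>\<Sum> d\<^sub>k(n) n^{-s}\<close> are those of \<open>\<zeta>(s)^k\<close>.\<close>

lemma gen_divisor_euler_factor:
  assumes "prime p" "\<bar>x\<bar> < 1"
  shows "(\<lambda>m. gen_divisor k (p ^ m) * x ^ m) sums (1 - x) powr (- k)"
proof -
  have "gen_divisor k (p ^ m) * x ^ m = ((- k) gchoose m) * (- x) ^ m" for m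
  proof -
    have "(- 1 :: real) ^ m * (- x) ^ m = x ^ m"
      by (simp flip: power_mult_distrib)
    then show ?thesis
      using assms(1) by (simp add: gen_divisor_prime_power gbinomial_pochhammer)
  qed
  then show ?thesis
    using gen_binomial_real[of "- x" "- k"] assms by simp
qed

definition exp_integral_E1 :: "real \<Rightarrow> real" where
  "exp_integral_E1 z = integral {z..} (\<lambda>w. exp (- w) / w)"

text \<open>The term for \<open>n = 1\<close> is omitted: there \<open>\<Lambda>(1) = 0 = log 1\<close>.\<close>

definition P_X :: "real \<Rightarrow> complex \<Rightarrow> complex" where
  "P_X X s = exp (\<Sum>n | 2 \<le> n \<and> real n \<le> X. mangoldt n * of_nat n powr (- s) / of_real (ln (real n)))"

definition a_const :: "real \<Rightarrow> real \<Rightarrow> real" where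
  "a_const k \<sigma> = (\<Prod>p. if prime p
      then (1 - 1 / real p powr (2 * \<sigma>)) powr (k\<^sup>2) *
           (\<Sum>m. (gen_divisor k (p ^ m))\<^sup>2 / real p powr (2 * real m * \<sigma>))
      else 1)"

definition F_X :: "real \<Rightarrow> real \<Rightarrow> real \<Rightarrow> real" where
  "F_X X k \<sigma> =
     (if \<sigma> > 1/2
      then real_zeta (2 * \<sigma>) powr (k\<^sup>2) * exp (- k\<^sup>2 * exp_integral_E1 ((2 * \<sigma> - 1) * ln X))
      else (exp euler_mascheroni * ln X) powr (k\<^sup>2))"

end

theory Submission
  imports Defs "HOL-Real_Asymp.Real_Asymp"
begin

text \<open>
  The series \<open>P_X(s)\<^sup>k = \<Sum> b(n) n\<^bsup>-s\<^esup>\<close> runs over the integers free of prime factors above \<open>X\<close>, and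
  \<open>\<bar>b(n)\<bar> \<le> d\<^bsub>\<bar>k\<bar>\<^esub>(n)\<close>. For \<open>m \<noteq> n\<close> the mean of \<open>(m/n)\<^bsup>it\<^esup>\<close> over \<open>[T, 2T]\<close> is at most
  \<open>min 1 (2mn/T) \<le> (2mn/T)\<^sup>\<eta>\<close>, so without any truncation of the series the mean square differs from
  \<open>\<Sum> b(n)\<^sup>2 n\<^bsup>-2\<sigma>\<^esup>\<close> by at most \<open>(2/T)\<^sup>\<eta> (\<Sum> \<bar>b(n)\<bar> n\<^bsup>\<eta>-\<sigma>\<^esup>)\<^sup>2\<close>. Since \<open>X\<^bsup>1-c+\<eta>\<^esup>\<close> is a power of \<open>log T\<close>
  with exponent less than \<open>1\<close> for \<open>\<eta> < \<epsilon>\<close>, this is smaller than \<open>1 / log X\<close>.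

  The diagonal is an Euler product over \<open>p \<le> X\<close>. Its local factors agree with those of
  \<open>\<Sum> d\<^sub>k(n)\<^sup>2 n\<^bsup>-2\<sigma>\<^esup>\<close> up to powers \<open>p\<^sup>m > X\<close>, which leaves \<open>a(k,\<sigma>)\<close> times the \<open>k\<^sup>2\<close>-th power of
  \<open>\<Prod>p\<le>X. (1 - p\<^bsup>-2\<sigma>\<^esup>)\<^sup>-\<^sup>1\<close>. The latter is compared with \<open>\<zeta>(2\<sigma>)\<close> by summing \<open>p\<^bsup>-2\<sigma>\<^esup>\<close> over \<open>p > X\<close> by
  parts against Mertens' estimate \<open>\<Sum>p\<le>x. log p / p = log x + O(1)\<close>, which produces \<open>E\<^sub>1\<close>. As this is
  uniform in \<open>\<sigma> > 1/2\<close>, letting \<open>\<sigma> \<rightarrow> 1/2\<close> and using \<open>E\<^sub>1(z) + log z \<rightarrow> -\<gamma>\<close> gives the case \<open>\<sigma> = 1/2\<close>.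
\<close>

section \<open>Mertens' first theorem\<close>

text \<open>The obstacle is uniformity: sigma may approach 1/2 at any rate relative to X, and then
  zeta(2 sigma) and E_1((2 sigma - 1) log X) are both unbounded. The diagonal is therefore treated
  through logarithms, with errors C / log X in which delta = 2 sigma - 1 does not occur. This is
  possible because p^(-1-delta) is log p / p times a decreasing weight that is at most 1 / log p for
  every delta > 0. The implied constant may depend on k alone, although the range of X involves c,
  epsilon and the O-constant. It stems from the diagonal and from the demand that the off-diagonal
  part be at most 1 / log X; the other parameters only decide how large T must be. Inside the
  exponent of P_X each prime p <= X has its own cutoff J = floor(log_p X), so the local factors are
  studied with J as a parameter. Zeta is needed only at real points to the right of 1, where its
  Euler product, an integral comparison and the limit at 1 suffice.\<close>

definition prime_exponent :: "real \<Rightarrow> nat \<Rightarrow> nat" where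
  "prime_exponent X p = nat \<lfloor>log (real p) X\<rfloor>"

lemma le_prime_exponent_iff:
  assumes "p > 1" "X \<ge> 1"
  shows "j \<le> prime_exponent X p \<longleftrightarrow> real (p ^ j) \<le> X"
proof -
  have "j \<le> prime_exponent X p \<longleftrightarrow> real j \<le> log (real p) X"
    using assms by (simp add: prime_exponent_def le_nat_iff le_floor_iff zero_le_log_cancel_iff)
  also have "\<dots> \<longleftrightarrow> real p powr real j \<le> X"
    using assms by (subst le_log_iff) auto
  also have "\<dots> \<longleftrightarrow> real (p ^ j) \<le> X"
    using assms by (simp add: powr_realpow)
  finally show ?thesis .
qed

lemma primepow_le_bij:
  assumes "X \<ge> 1"
  shows "bij_betw (\<lambda>(p, j). p ^ j)
           (SIGMA p:{p. prime p \<and> real p \<le> X}. {1..prime_exponent X p})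
           {n. primepow n \<and> real n \<le> X}"
proof (rule bij_betwI')
  show "(case x of (p, j) \<Rightarrow> p ^ j) = (case y of (p, j) \<Rightarrow> p ^ j) \<longleftrightarrow> x = y"
    if "x \<in> (SIGMA p:{p. prime p \<and> real p \<le> X}. {1..prime_exponent X p})"
       "y \<in> (SIGMA p:{p. prime p \<and> real p \<le> X}. {1..prime_exponent X p})" for x y :: "nat \<times> nat"
    using that by (auto simp: prime_power_inj'')
next
  show "(case x of (p, j) \<Rightarrow> p ^ j) \<in> {n. primepow n \<and> real n \<le> X}"
    if "x \<in> (SIGMA p:{p. prime p \<and> real p \<le> X}. {1..prime_exponent X p})" for x :: "nat \<times> nat"
    using that assms le_prime_exponent_iff[of "fst x" X "snd x"] prime_gt_1_nat
    by (auto simp: case_prod_unfold)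
next
  fix n assume n: "n \<in> {n. primepow n \<and> real n \<le> X}"
  then obtain p k where pk: "prime p" "k > 0" "n = p ^ k"
    by (auto simp: primepow_def)
  have "real p \<le> real (p ^ k)"
    using pk prime_gt_1_nat[of p] by (simp add: self_le_power del: of_nat_power)
  also have "\<dots> \<le> X" using n pk by simp
  finally have "real p \<le> X" .
  with pk n assms have "(p, k) \<in> (SIGMA p:{p. prime p \<and> real p \<le> X}. {1..prime_exponent X p})"
    using le_prime_exponent_iff[of p X k] prime_gt_1_nat[of p] by auto
  with pk show "\<exists>x\<in>(SIGMA p:{p. prime p \<and> real p \<le> X}. {1..prime_exponent X p}).
          n = (case x of (p, j) \<Rightarrow> p ^ j)"
    by (intro bexI[of _ "(p, k)"]) auto
qed

lemma finite_nat_le_real [simp]: "finite {n::nat. P n \<and> real n \<le> X}"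
  by (rule finite_subset[of _ "{..nat \<lfloor>X\<rfloor>}"]) (auto simp: le_nat_floor)

text \<open>Only prime powers carry weight, and each is p^j for exactly one pair. The target type is
  general because the identity serves over the reals for Mertens' estimate and over the complex
  numbers for the exponent of \<open>P_X\<close>.\<close>

lemma sum_mangoldt_eq_sum_primes:
  fixes f :: "nat \<Rightarrow> 'a :: real_algebra_1"
  assumes "X \<ge> 1"
  shows "(\<Sum>n | 2 \<le> n \<and> real n \<le> X. mangoldt n * f n) =
         (\<Sum>p | prime p \<and> real p \<le> X. \<Sum>j=1..prime_exponent X p. of_real (ln (real p)) * f (p ^ j))"
proof -
  have "(\<Sum>n | 2 \<le> n \<and> real n \<le> X. mangoldt n * f n) =
        (\<Sum>n | primepow n \<and> real n \<le> X. mangoldt n * f n)"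
    using primepow_gt_Suc_0
    by (intro sum.mono_neutral_right) (auto simp: mangoldt_def Suc_le_eq numeral_2_eq_2)
  also have "\<dots> = (\<Sum>x\<in>(SIGMA p:{p. prime p \<and> real p \<le> X}. {1..prime_exponent X p}).
                     mangoldt (case x of (p, j) \<Rightarrow> p ^ j) * f (case x of (p, j) \<Rightarrow> p ^ j))"
    by (rule sum.reindex_bij_betw[OF primepow_le_bij[OF assms], symmetric])
  also have "\<dots> = (\<Sum>x\<in>(SIGMA p:{p. prime p \<and> real p \<le> X}. {1..prime_exponent X p}).
                     case x of (p, j) \<Rightarrow> of_real (ln (real p)) * f (p ^ j))"
    by (intro sum.cong) (auto simp: case_prod_unfold)
  finally show ?thesis
    by (simp add: sum.Sigma)
qed

text \<open>Chebyshev's identity: log n is the sum of Lambda over the divisors of n, and after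
  exchanging the sums d is counted once for each of its \<open>N div d\<close> multiples up to
  N.\<close>

lemma sum_ln_eq_mangoldt:
  "(\<Sum>n=1..N. ln (real n)) = (\<Sum>d=1..N. mangoldt d * real (N div d))"
proof -
  have "(\<Sum>n=1..N. ln (real n)) = (\<Sum>n=1..N. \<Sum>d | d dvd n. mangoldt d)"
    using mangoldt_sum[where ?'a = real] by (intro sum.cong) auto
  also have "\<dots> = (\<Sum>n=1..N. \<Sum>d\<in>{d\<in>{1..N}. d dvd n}. mangoldt d)"
    by (intro sum.cong refl) (auto dest: dvd_imp_le intro: Nat.gr0I)
  also have "\<dots> = (\<Sum>d=1..N. \<Sum>n\<in>{n\<in>{1..N}. d dvd n}. mangoldt d)"
    by (rule sum.swap_restrict) auto
  also have "\<dots> = (\<Sum>d=1..N. mangoldt d * real (N div d))"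
  proof (intro sum.cong refl)
    fix d assume d: "d \<in> {1..N}"
    have "{n\<in>{1..N}. d dvd n} = (\<lambda>k. d * k) ` {1..N div d}"
      using d by (auto simp: less_eq_div_iff_mult_less_eq mult_ac elim!: dvdE intro!: image_eqI)
    then have "card {n\<in>{1..N}. d dvd n} = N div d"
      using d by (simp add: card_image inj_on_def)
    then show "(\<Sum>n\<in>{n\<in>{1..N}. d dvd n}. mangoldt d) = mangoldt d * real (N div d)"
      by simp
  qed
  finally show ?thesis .
qed

lemma sum_ln_eq_ln_fact: "(\<Sum>n=1..N. ln (real n)) = ln (fact N)"
  by (induction N) (auto simp: ln_mult)

section \<open>Chebyshev's bound for psi and the sum of Lambda(d) / d\<close>

definition chebyshev_psi :: "nat \<Rightarrow> real" where
  "chebyshev_psi N = (\<Sum>d=1..N. mangoldt d)"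

text \<open>A binomial coefficient is at most 2^N. The factor \<open>N + 1\<close> covers odd N,
  where the two parts have sizes M and M + 1.\<close>

lemma fact_le_halves: "fact N \<le> 2 ^ N * real (N + 1) * (fact (N div 2))\<^sup>2"
proof -
  define M where "M = N div 2"
  have "N - M = M \<or> N - M = Suc M"
    by (auto simp: M_def)
  then have le: "(fact (N - M) :: real) \<le> real (N + 1) * fact M"
    by (auto simp: M_def)
  have "M \<le> N" by (simp add: M_def)
  then have "(fact N :: real) = fact M * fact (N - M) * real (N choose M)"
    by (rule binomial_fact_lemma[THEN arg_cong[of _ _ real], simplified, symmetric])
  also have "\<dots> \<le> fact M * (real (N + 1) * fact M) * 2 ^ N"
  proof (intro mult_mono le)
    have "N choose M \<le> 2 ^ N"
      using binomial_le_pow2[of N M] .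
    then show "real (N choose M) \<le> 2 ^ N"
      by (metis of_nat_le_iff of_nat_numeral of_nat_power)
  qed auto
  finally show ?thesis
    by (simp add: M_def power2_eq_square mult_ac)
qed

text \<open>In log N! - 2 log (N div 2)! the weight of Lambda(d) is the parity of
  \<open>N div d\<close>. It is never negative, and it is 1 throughout the upper half of the
  range.\<close>

lemma chebyshev_psi_diff: "chebyshev_psi N - chebyshev_psi (N div 2) \<le> 2 * real N"
proof (cases "N = 0")
  case False
  define M where "M = N div 2"
  have MN: "M \<le> N" by (simp add: M_def)
  have "chebyshev_psi N - chebyshev_psi M = (\<Sum>d\<in>{M<..N}. mangoldt d)"
  proof -
    have "{1..N} = {1..M} \<union> {M<..N}" using MN by auto
    moreover have "{1..M} \<inter> {M<..N} = {}" by auto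
    ultimately show ?thesis unfolding chebyshev_psi_def by (simp add: sum.union_disjoint)
  qed
  also have "\<dots> = (\<Sum>d=1..N. if M < d then mangoldt d else 0)"
    by (rule sum.mono_neutral_cong_left) auto
  also have "\<dots> \<le> (\<Sum>d=1..N. mangoldt d * (real (N div d) - 2 * real (M div d)))"
  proof (rule sum_mono)
    fix d assume d: "d \<in> {1..N}"
    have eq: "M div d = N div d div 2"
      by (simp add: M_def div_mult2_eq[symmetric] mult.commute)
    have ge: "real (N div d) - 2 * real (M div d) \<ge> 0"
      unfolding eq by linarith
    have "real (N div d) - 2 * real (M div d) = 1" if "M < d"
    proof -
      have "N < 2 * d" using that unfolding M_def by linarith
      moreover have "d \<le> N" using d by simp
      ultimately have "N div d = 1"
        by (intro div_nat_eqI) auto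
      then show ?thesis using that by simp
    qed
    then show "(if M < d then mangoldt d else 0) \<le> mangoldt d * (real (N div d) - 2 * real (M div d))"
      using ge mangoldt_nonneg[of d] by auto
  qed
  also have "\<dots> = (\<Sum>d=1..N. mangoldt d * real (N div d)) - 2 * (\<Sum>d=1..N. mangoldt d * real (M div d))"
    by (simp add: algebra_simps sum_subtractf sum_distrib_left)
  also have "(\<Sum>d=1..N. mangoldt d * real (M div d)) = (\<Sum>d=1..M. mangoldt d * real (M div d))"
    using MN by (intro sum.mono_neutral_right) auto
  also have "(\<Sum>d=1..N. mangoldt d * real (N div d)) - 2 * (\<Sum>d=1..M. mangoldt d * real (M div d)) =
             ln (fact N) - 2 * ln (fact M)"
    by (simp only: sum_ln_eq_mangoldt[symmetric] sum_ln_eq_ln_fact)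
  also have "\<dots> \<le> 2 * real N"
  proof -
    have "ln (fact N) \<le> ln (2 ^ N * real (N + 1) * (fact M)\<^sup>2)"
      using fact_le_halves[of N] by (subst ln_le_cancel_iff) (auto simp: M_def)
    also have "\<dots> = real N * ln 2 + ln (real (N + 1)) + 2 * ln (fact M)"
      by (simp add: ln_mult ln_realpow)
    \<comment> \<open>The power of 2 is paid for by log 2 <= 1, the correction for odd N by log (N +
      1) <= N.\<close>
    also have "\<dots> \<le> real N * 1 + real N + 2 * ln (fact M)"
      using ln_2_less_1 ln_add_one_self_le_self[of "real N"]
      by (intro add_mono mult_left_mono) (auto simp: add.commute)
    finally show ?thesis by simp
  qed
  finally show ?thesis by (simp add: M_def)
qed (simp add: chebyshev_psi_def)

text \<open>The bound reproduces itself under halving, since 4 (N div 2) + 2 N is at most 4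
  N.\<close>

lemma chebyshev_psi_le: "chebyshev_psi N \<le> 4 * real N"
proof (induction N rule: less_induct)
  case (less N)
  show ?case
  proof (cases "N = 0")
    case False
    then have "chebyshev_psi (N div 2) \<le> 4 * real (N div 2)"
      by (intro less) auto
    then show ?thesis
      using chebyshev_psi_diff[of N] by linarith
  qed (simp add: chebyshev_psi_def)
qed

text \<open>N^N / N! is a single term of the exponential series at N, hence at most e^N.\<close>

lemma ln_fact_ge: "ln (fact N) \<ge> real N * ln (real N) - real N"
proof (cases "N = 0")
  case False
  have "exp (real N) \<ge> real N ^ N / fact N"
  proof -
    have "(\<lambda>n. real N ^ n / fact n) sums exp (real N)"
      using exp_converges[of "real N"] by (simp add: divide_inverse mult.commute)
    then have "(\<Sum>n\<in>{N}. real N ^ n / fact n) \<le> exp (real N)"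
      unfolding sums_iff by (metis (no_types, lifting) divide_nonneg_nonneg fact_ge_zero finite.emptyI
          finite.insertI of_nat_0_le_iff sum_le_suminf zero_le_power)
    then show ?thesis by simp
  qed
  then have "ln (real N ^ N / fact N) \<le> ln (exp (real N))"
    using False by (subst ln_le_cancel_iff) auto
  then show ?thesis
    using False by (simp add: ln_div ln_realpow)
qed auto

lemma ln_fact_le: "ln (fact N) \<le> real N * ln (real N)"
proof (cases "N = 0")
  case False
  have "ln (fact N) \<le> ln (real N ^ N)"
    using False fact_le_power[of N, where ?'a = real] by (subst ln_le_cancel_iff) auto
  then show ?thesis
    using False by (simp add: ln_realpow)
qed auto

lemma real_of_nat_divide_le_Suc_div: "real n / real d \<le> real (n div d) + 1"
proof (cases "d = 0")
  case False
  have "real n = real d * real (n div d) + real (n mod d)"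
    by (metis mult_div_mod_eq of_nat_add of_nat_mult)
  moreover have "real (n mod d) \<le> real d"
    using False by (simp add: less_imp_le)
  ultimately show ?thesis
    using False by (simp add: field_simps)
qed auto

text \<open>Replacing \<open>N div d\<close> by N / d in Chebyshev's identity costs at most psi(N)
  <= 4 N, and log N! lies at most N below N log N. Division by N leaves 4 on one side and 1 on the
  other.\<close>

lemma mertens_mangoldt:
  assumes "N \<ge> 1"
  shows "\<bar>(\<Sum>d=1..N. mangoldt d / real d) - ln (real N)\<bar> \<le> 4"
proof -
  have N: "real N > 0" using assms by simp
  have 1: "(\<Sum>d=1..N. mangoldt d * real (N div d)) \<le> real N * (\<Sum>d=1..N. mangoldt d / real d)"
    unfolding sum_distrib_left
  proof (intro sum_mono)
    fix d assume "d \<in> {1..N}"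
    show "mangoldt d * real (N div d) \<le> real N * (mangoldt d / real d)"
      using mult_left_mono[OF of_nat_div_le_of_nat[of N d] mangoldt_nonneg[of d]] by (simp add: mult_ac)
  qed
  have 2: "real N * (\<Sum>d=1..N. mangoldt d / real d) \<le> (\<Sum>d=1..N. mangoldt d * real (N div d)) + chebyshev_psi N"
    unfolding sum_distrib_left chebyshev_psi_def sum.distrib[symmetric]
  proof (intro sum_mono)
    fix d assume "d \<in> {1..N}"
    have "real N / real d \<le> real (N div d) + 1"
      using real_of_nat_divide_le_Suc_div[of N d] by simp
    from mult_left_mono[OF this mangoldt_nonneg[of d]]
    show "real N * (mangoldt d / real d) \<le> mangoldt d * real (N div d) + mangoldt d"
      by (simp add: algebra_simps)
  qed
  have eq: "(\<Sum>d=1..N. mangoldt d * real (N div d)) = ln (fact N)"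
    by (simp only: sum_ln_eq_mangoldt[symmetric] sum_ln_eq_ln_fact)
  have "real N * (ln (real N) - 1) \<le> real N * (\<Sum>d=1..N. mangoldt d / real d)"
    using 1 eq ln_fact_ge[of N] by (simp add: algebra_simps)
  moreover have "real N * (\<Sum>d=1..N. mangoldt d / real d) \<le> real N * (ln (real N) + 4)"
    using 2 eq ln_fact_le[of N] chebyshev_psi_le[of N] by (simp add: algebra_simps)
  ultimately show ?thesis
    using N by (simp only: mult_le_cancel_left_pos abs_le_iff) linarith
qed

section \<open>From prime powers to primes\<close>

lemma summable_powr_three_halves: "summable (\<lambda>n. real n powr (-3/2))"
  by (simp add: summable_real_powr_iff)

text \<open>log n = 2 log (sqrt n) <= 2 sqrt n.\<close>

lemma ln_over_square_le:
  assumes "n \<ge> 1"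
  shows "ln (real n) / real n ^ 2 \<le> 2 * real n powr (-3/2)"
proof -
  have "ln (real n powr (1/2)) \<le> real n powr (1/2)"
    using assms by (intro less_imp_le[OF ln_less_self]) auto
  then have "ln (real n) \<le> 2 * real n powr (1/2)"
    using assms by (simp add: ln_powr)
  then have "ln (real n) / real n ^ 2 \<le> 2 * real n powr (1/2) / real n ^ 2"
    by (rule divide_right_mono) simp
  also have "real n ^ 2 = real n powr 2"
    using assms by (simp add: powr_numeral)
  also have "2 * real n powr (1/2) / real n powr 2 = 2 * real n powr (1/2 - 2)"
    by (simp only: powr_diff times_divide_eq_right)
  finally show ?thesis by simp
qed

lemma sum_power_le_geometric:
  fixes x :: real
  assumes "0 \<le> x" "x < 1"
  shows "(\<Sum>j=m..n. x ^ j) \<le> x ^ m / (1 - x)"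
  using assms by (subst sum_gp) (auto intro!: divide_right_mono)

text \<open>The powers p^j with j >= 2 form a geometric series of size at most 2 log p / p^2, so
  dropping them changes the sum by a bounded amount. In the constant, 4 is inherited from
  \<open>mertens_mangoldt\<close> and 4 K belongs to these powers.\<close>

lemma mertens_primes:
  obtains C where "C > 0"
    "\<And>N. N \<ge> 1 \<Longrightarrow> \<bar>(\<Sum>n=1..N. if prime n then ln (real n) / real n else 0) - ln (real N)\<bar> \<le> C"
proof
  define K where "K = (\<Sum>n. real n powr (-3/2))"
  have K: "K \<ge> 0" unfolding K_def by (intro suminf_nonneg summable_powr_three_halves) auto
  show "4 + 4 * K > 0" using K by simp
  fix N :: nat assume N: "N \<ge> 1"
  define P where "P = {p. prime p \<and> real p \<le> real N}"
  have finP: "finite P" by (simp add: P_def)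
  have "(\<Sum>d=1..N. mangoldt d / real d) = (\<Sum>n | 2 \<le> n \<and> real n \<le> real N. mangoldt n * (1 / real n))"
  proof (rule sum.mono_neutral_cong_right)
    show "\<forall>i\<in>{1..N} - {n. 2 \<le> n \<and> real n \<le> real N}. mangoldt i / real i = 0"
    proof
      fix i assume "i \<in> {1..N} - {n. 2 \<le> n \<and> real n \<le> real N}"
      then have "i = Suc 0" by auto
      then show "mangoldt i / real i = 0" by simp
    qed
  qed auto
  also have "\<dots> = (\<Sum>p\<in>P. \<Sum>j=1..prime_exponent N p. ln (real p) / real p ^ j)"
    using N sum_mangoldt_eq_sum_primes[of "real N" "\<lambda>n. 1 / real n"] by (simp add: P_def)
  also have "\<dots> = (\<Sum>p\<in>P. ln (real p) / real p + (\<Sum>j=2..prime_exponent N p. ln (real p) / real p ^ j))"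
  proof (intro sum.cong refl)
    fix p assume "p \<in> P"
    then have "prime_exponent N p \<ge> 1"
      using N prime_gt_1_nat[of p] by (subst le_prime_exponent_iff) (auto simp: P_def)
    then show "(\<Sum>j=1..prime_exponent N p. ln (real p) / real p ^ j) =
        ln (real p) / real p + (\<Sum>j=2..prime_exponent N p. ln (real p) / real p ^ j)"
      by (subst sum.atLeast_Suc_atMost) (auto simp: numeral_2_eq_2)
  qed
  also have "\<dots> = (\<Sum>p\<in>P. ln (real p) / real p) +
                (\<Sum>p\<in>P. \<Sum>j=2..prime_exponent N p. ln (real p) / real p ^ j)"
    by (rule sum.distrib)
  also have "(\<Sum>p\<in>P. ln (real p) / real p) = (\<Sum>n=1..N. if prime n then ln (real n) / real n else 0)"
    using prime_gt_0_nat by (intro sum.mono_neutral_cong_left) (auto simp: P_def Suc_le_eq)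
  finally have eq: "(\<Sum>d=1..N. mangoldt d / real d) = \<dots> +
      (\<Sum>p\<in>P. \<Sum>j=2..prime_exponent N p. ln (real p) / real p ^ j)" .
  have "(\<Sum>p\<in>P. \<Sum>j=2..prime_exponent N p. ln (real p) / real p ^ j) \<le> (\<Sum>p\<in>P. 4 * real p powr (-3/2))"
  proof (intro sum_mono)
    fix p assume p: "p \<in> P"
    then have p2: "real p \<ge> 2" using prime_ge_2_nat[of p] by (auto simp: P_def)
    have "(\<Sum>j=2..prime_exponent N p. ln (real p) / real p ^ j) =
          ln (real p) * (\<Sum>j=2..prime_exponent N p. (1 / real p) ^ j)"
      by (simp add: sum_distrib_left power_divide)
    also have "(\<Sum>j=2..prime_exponent N p. (1 / real p) ^ j) \<le> (1 / real p) ^ 2 / (1 - 1 / real p)"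
      using p2 by (intro sum_power_le_geometric) auto
    also have "\<dots> \<le> (1 / real p) ^ 2 / (1 / 2)"
      using p2 by (intro divide_left_mono) (auto simp: field_simps)
    also have "ln (real p) * \<dots> = 2 * (ln (real p) / real p ^ 2)"
      by (simp add: power_divide)
    also have "\<dots> \<le> 2 * (2 * real p powr (-3/2))"
      using p2 by (intro mult_left_mono ln_over_square_le) auto
    finally show "(\<Sum>j=2..prime_exponent N p. ln (real p) / real p ^ j) \<le> 4 * real p powr (-3/2)"
      using p2 by (auto simp: mult_left_mono)
  qed
  also have "\<dots> \<le> 4 * K"
    unfolding K_def sum_distrib_left[symmetric] using finP
    by (intro mult_left_mono sum_le_suminf summable_powr_three_halves) auto
  finally have le: "(\<Sum>p\<in>P. \<Sum>j=2..prime_exponent N p. ln (real p) / real p ^ j) \<le> 4 * K" .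
  have ge: "(\<Sum>p\<in>P. \<Sum>j=2..prime_exponent N p. ln (real p) / real p ^ j) \<ge> 0"
    using prime_ge_1_nat by (intro sum_nonneg divide_nonneg_nonneg ln_ge_zero) (auto simp: P_def)
  show "\<bar>(\<Sum>n=1..N. if prime n then ln (real n) / real n else 0) - ln (real N)\<bar> \<le> 4 + 4 * K"
    using mertens_mangoldt[OF N] eq le ge by linarith
qed

section \<open>The exponential integral near zero\<close>

text \<open>\<open>integral\<close> has the default value 0 where no integral exists; domination by
  a decaying exponential shows that \<open>exp_integral_E1\<close> is a genuine integral for
  positive arguments.\<close>

lemma exp_div_integrable_on:
  assumes "z > 0"
  shows "(\<lambda>w::real. exp (- w) / w) integrable_on {z..}"
proof (rule integrable_on_all_intervals_integrable_bound)
  show "(\<lambda>x. if x \<in> {z..} then exp (- x) / x else 0) integrable_on cbox a b" for a b :: real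
  proof -
    have "(\<lambda>w::real. exp (- w) / w) integrable_on {max a z..b}"
      using assms by (intro integrable_continuous_interval continuous_intros) auto
    moreover have "{max a z..b} = {z..} \<inter> cbox a b" by auto
    ultimately show ?thesis
      by (simp only: integrable_restrict_Int)
  qed
  show "norm (exp (- x) / x) \<le> exp (- 1 * x) / z" if "x \<in> {z..}" for x :: real
    using that assms by (auto simp: frac_le)
  show "(\<lambda>x::real. exp (- 1 * x) / z) integrable_on {z..}"
    by (intro integrable_on_divide integrable_on_exp_minus_to_infinity) auto
qed

lemma exp_integral_E1_split:
  assumes "0 < x" "x \<le> y"
  shows "exp_integral_E1 x - exp_integral_E1 y = integral {x..y} (\<lambda>w. exp (- w) / w)"
proof -
  let ?f = "\<lambda>w::real. exp (- w) / w"
  have 1: "(?f has_integral integral {x..y} ?f) {x..y}"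
    using assms by (intro integrable_integral integrable_continuous_interval continuous_intros) auto
  have 2: "(?f has_integral exp_integral_E1 y) {y..}"
    unfolding exp_integral_E1_def
    using assms by (intro integrable_integral exp_div_integrable_on) auto
  have "{x..y} \<inter> {y..} = {y}" "{x..y} \<union> {y..} = {x..}"
    using assms by auto
  then have "(?f has_integral (integral {x..y} ?f + exp_integral_E1 y)) {x..}"
    using has_integral_Un[OF 1 2] by simp
  then show ?thesis
    unfolding exp_integral_E1_def by (simp add: integral_unique)
qed

lemma has_integral_inverse_interval:
  assumes "0 < x" "x \<le> y"
  shows "((\<lambda>w. c * (1 / w)) has_integral c * ln (y / x)) {x..y :: real}"
proof -
  have "((\<lambda>w. c * (1 / w)) has_integral (c * ln y - c * ln x)) {x..y}"
    using assms
    by (intro fundamental_theorem_of_calculus)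
       (auto intro!: derivative_eq_intros simp flip: has_real_derivative_iff_has_vector_derivative)
  then show ?thesis
    using assms by (simp add: ln_div algebra_simps)
qed

text \<open>On the interval the exponential lies between its end values, and what is left to
  integrate is 1 / w. These two bounds carry both the appearance of Euler's constant and the
  comparison with sums over primes.\<close>

lemma exp_integral_E1_diff_bounds:
  assumes "0 < x" "x \<le> y"
  shows "exp (- y) * ln (y / x) \<le> exp_integral_E1 x - exp_integral_E1 y"
    and "exp_integral_E1 x - exp_integral_E1 y \<le> exp (- x) * ln (y / x)"
proof -
  have 1: "((\<lambda>w. exp (- w) / w) has_integral (exp_integral_E1 x - exp_integral_E1 y)) {x..y}"
    unfolding exp_integral_E1_split[OF assms]
    using assms by (intro integrable_integral integrable_continuous_interval continuous_intros) auto
  show "exp (- y) * ln (y / x) \<le> exp_integral_E1 x - exp_integral_E1 y"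
    using has_integral_inverse_interval[OF assms, of "exp (- y)"] 1
    by (rule has_integral_le) (use assms in \<open>auto simp: divide_right_mono\<close>)
  show "exp_integral_E1 x - exp_integral_E1 y \<le> exp (- x) * ln (y / x)"
    using 1 has_integral_inverse_interval[OF assms, of "exp (- x)"]
    by (rule has_integral_le) (use assms in \<open>auto simp: divide_right_mono\<close>)
qed

lemma exp_integral_E1_nonneg: "z > 0 \<Longrightarrow> exp_integral_E1 z \<ge> 0"
  unfolding exp_integral_E1_def by (intro integral_nonneg exp_div_integrable_on) auto

lemma exp_integral_E1_le:
  assumes "z \<ge> 1"
  shows "exp_integral_E1 z \<le> exp (- z)"
proof -
  have 1: "((\<lambda>w. exp (- 1 * w)) has_integral exp (- 1 * z) / 1) {z..}"
    by (rule has_integral_exp_minus_to_infinity) auto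
  have 2: "((\<lambda>w. exp (- w) / w) has_integral exp_integral_E1 z) {z..}"
    unfolding exp_integral_E1_def
    using assms by (intro integrable_integral exp_div_integrable_on) auto
  have "exp_integral_E1 z \<le> exp (- 1 * z) / 1"
    by (rule has_integral_le[OF 2 1]) (use assms in \<open>auto simp: divide_le_eq\<close>)
  then show ?thesis by simp
qed

lemma exp_integral_E1_tendsto_0: "(exp_integral_E1 \<longlongrightarrow> 0) at_top"
proof (rule tendsto_sandwich[of "\<lambda>_. 0" _ _ "\<lambda>z. exp (- z)"])
  show "\<forall>\<^sub>F z in at_top. 0 \<le> exp_integral_E1 z"
    using eventually_gt_at_top[of 0] by eventually_elim (rule exp_integral_E1_nonneg)
  show "\<forall>\<^sub>F z in at_top. exp_integral_E1 z \<le> exp (- z)"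
    using eventually_ge_at_top[of 1] by eventually_elim (rule exp_integral_E1_le)
  show "((\<lambda>z::real. exp (- z)) \<longlongrightarrow> 0) at_top"
    by real_asymp
qed simp

lemma ln_one_minus_sums:
  fixes x :: real
  assumes "0 \<le> x" "x < 1"
  shows "(\<lambda>n. x ^ Suc n / real (Suc n)) sums (- ln (1 - x))"
proof -
  have "(\<lambda>n. x ^ n / real n) sums (- ln (1 - x))"
    using sums_minus[OF ln_series'[of "- x"]] assms by simp
  then show ?thesis
    by (subst sums_Suc_iff) simp
qed

text \<open>Euler's constant enters by comparing \<open>E\<^sub>1(z)\<close> with \<open>\<Sum> e\<^bsup>-nz\<^esup> log ((n+1)/n)\<close> and the latter with
  \<open>\<Sum> e\<^bsup>-nz\<^esup> / n = - log (1 - e\<^bsup>-z\<^esup>)\<close>.\<close>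

lemma exp_integral_E1_plus_ln_bounds:
  assumes "z > 0"
  defines "r \<equiv> exp (- z)"
  defines "c \<equiv> (\<lambda>n. 1 / real (n + 1) - ln (real (n + 2) / real (n + 1)))"
  shows "\<bar>exp_integral_E1 z + ln (1 - r) + (\<Sum>n. c n * r ^ Suc n)\<bar> \<le> (1 - r) * (- ln (1 - r))"
proof -
  have r: "0 < r" "r < 1" using assms by auto
  define D where "D = (\<lambda>n. exp_integral_E1 (z * real (n + 1)) - exp_integral_E1 (z * real (n + 2)))"
  have D: "D sums exp_integral_E1 z"
  proof -
    have "(\<lambda>n. exp_integral_E1 (z * real (n + 1))) \<longlonglongrightarrow> 0"
      using \<open>z > 0\<close> by (intro filterlim_compose[OF exp_integral_E1_tendsto_0]) real_asymp
    from telescope_sums'[OF this] show ?thesis by (simp add: D_def add_ac)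
  qed
  define l where "l = (\<lambda>n. ln (real (n + 2) / real (n + 1)))"
  have l: "0 \<le> l n" "l n \<le> 1 / real (n + 1)" for n
  proof -
    show "0 \<le> l n" by (auto simp: l_def)
    have "l n = ln (1 + 1 / real (n + 1))" by (simp add: l_def field_simps)
    also have "\<dots> \<le> 1 / real (n + 1)" by (rule ln_add_one_self_le_self) auto
    finally show "l n \<le> 1 / real (n + 1)" .
  qed
  have exp_r: "exp (- (z * real n)) = r ^ n" for n
    by (simp add: r_def exp_of_nat_mult[symmetric] mult_ac)
  have Dl: "r ^ Suc (Suc n) * l n \<le> D n" "D n \<le> r ^ Suc n * l n" for n
  proof -
    have "z * real (n + 2) / (z * real (n + 1)) = real (n + 2) / real (n + 1)"
      using \<open>z > 0\<close> by (simp del: of_nat_add)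
    then show "r ^ Suc (Suc n) * l n \<le> D n" "D n \<le> r ^ Suc n * l n"
      using exp_integral_E1_diff_bounds[of "z * real (n + 1)" "z * real (n + 2)"] \<open>z > 0\<close>
      unfolding D_def l_def exp_r by (simp_all del: of_nat_add of_nat_Suc)
  qed
  have L: "(\<lambda>n. r ^ Suc n / real (Suc n)) sums (- ln (1 - r))"
    using r by (intro ln_one_minus_sums) auto
  have lsum: "summable (\<lambda>n. l n * r ^ Suc n)"
  proof (rule summable_comparison_test'[OF sums_summable[OF L], of 0])
    show "norm (l n * r ^ Suc n) \<le> r ^ Suc n / real (Suc n)" for n
      using mult_right_mono[OF l(2)[of n], of "r ^ Suc n"] l(1)[of n] r by (simp add: abs_mult)
  qed
  have c_eq: "c n * r ^ Suc n = r ^ Suc n / real (Suc n) - l n * r ^ Suc n" for n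
    by (simp add: c_def l_def algebra_simps)
  have csum: "(\<lambda>n. c n * r ^ Suc n) sums (- ln (1 - r) - (\<Sum>n. l n * r ^ Suc n))"
    unfolding c_eq by (intro sums_diff L summable_sums lsum)
  have "(\<lambda>n. l n * r ^ Suc n - D n) sums ((\<Sum>n. l n * r ^ Suc n) - exp_integral_E1 z)"
    by (intro sums_diff D summable_sums lsum)
  also have "(\<Sum>n. l n * r ^ Suc n) - exp_integral_E1 z =
      - (exp_integral_E1 z + ln (1 - r) + (\<Sum>n. c n * r ^ Suc n))"
    using csum by (simp add: sums_iff)
  finally have E: "(\<lambda>n. l n * r ^ Suc n - D n) sums \<dots>" .
  \<comment> \<open>The two bounds for \<open>D n\<close> differ by the factor r = e^(-z). The total
    loss is therefore 1 - r times the logarithmic series, which vanishes as z tends to 0.\<close>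
  have le: "l n * r ^ Suc n - D n \<le> (1 - r) * (r ^ Suc n / real (Suc n))" for n
  proof -
    have "l n * r ^ Suc n - D n \<le> l n * ((1 - r) * r ^ Suc n)"
      using Dl(1)[of n] by (simp add: algebra_simps)
    also have "\<dots> \<le> 1 / real (n + 1) * ((1 - r) * r ^ Suc n)"
      using r by (intro mult_right_mono l) auto
    finally show ?thesis by (simp add: mult_ac)
  qed
  have "- (exp_integral_E1 z + ln (1 - r) + (\<Sum>n. c n * r ^ Suc n)) \<le> (1 - r) * (- ln (1 - r))"
    by (rule sums_le[OF le E sums_mult[OF L]])
  moreover have "0 \<le> - (exp_integral_E1 z + ln (1 - r) + (\<Sum>n. c n * r ^ Suc n))"
    by (rule sums_le[OF _ sums_zero E]) (use Dl(2) in \<open>auto simp: mult_ac\<close>)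
  ultimately show ?thesis by linarith
qed

lemma exp_integral_E1_plus_ln_tendsto:
  "((\<lambda>z. exp_integral_E1 z + ln z) \<longlongrightarrow> - euler_mascheroni) (at_right 0)"
proof -
  define c where "c = (\<lambda>n. 1 / real (n + 1) - ln (real (n + 2) / real (n + 1)))"
  have c_sums: "c sums euler_mascheroni"
    using euler_mascheroni_sum_real by (simp add: c_def ln_div inverse_eq_divide algebra_simps)
  have c_nonneg: "c n \<ge> 0" for n
  proof -
    have "ln (1 + 1 / real (n + 1)) \<le> 1 / real (n + 1)" by (rule ln_add_one_self_le_self) auto
    moreover have "1 + 1 / real (n + 1) = real (n + 2) / real (n + 1)" by (simp add: field_simps)
    ultimately show ?thesis by (simp add: c_def)
  qed
  \<comment> \<open>The terms of \<open>c\<close> are nonnegative with sum gamma, so they dominate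
    their own damped versions and z may tend to 0 term by term.\<close>
  have lim: "((\<lambda>z. \<Sum>n. c n * exp (- z) ^ Suc n) \<longlongrightarrow> (\<Sum>n. c n)) (at_right (0::real))"
  proof (rule tannerys_theorem[THEN conjunct2, THEN conjunct2])
    show "((\<lambda>z::real. c n * exp (- z) ^ Suc n) \<longlongrightarrow> c n) (at_right 0)" for n
      by (rule tendsto_eq_intros refl | simp)+
    have "\<forall>\<^sub>F z::real in at_right 0. z > 0"
      by (rule eventually_at_right_less)
    then have "\<forall>\<^sub>F (n, z) in at_top \<times>\<^sub>F at_right (0::real). z > 0"
      by (auto simp: case_prod_unfold intro: eventually_compose_filterlim filterlim_snd)
    then show "\<forall>\<^sub>F (n, z) in at_top \<times>\<^sub>F at_right (0::real). norm (c n * exp (- z) ^ Suc n) \<le> c n"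
    proof eventually_elim
      case (elim x)
      then show ?case
        using c_nonneg[of "fst x"]
        by (auto simp: case_prod_unfold abs_mult intro!: mult_left_le power_le_one simp del: power_Suc)
    qed
    show "summable c" using c_sums by (simp add: sums_iff)
  qed auto
  then have lim: "((\<lambda>z. \<Sum>n. c n * exp (- z) ^ Suc n) \<longlongrightarrow> euler_mascheroni) (at_right (0::real))"
    using c_sums by (simp add: sums_iff)
  have "((\<lambda>z. exp_integral_E1 z + ln (1 - exp (- z)) + (\<Sum>n. c n * exp (- z) ^ Suc n)) \<longlongrightarrow> 0) (at_right 0)"
  proof (rule Lim_null_comparison)
    show "\<forall>\<^sub>F z in at_right 0. norm (exp_integral_E1 z + ln (1 - exp (- z)) + (\<Sum>n. c n * exp (- z) ^ Suc n))
            \<le> (1 - exp (- z)) * (- ln (1 - exp (- z)))"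
      using eventually_at_right_less[of "0::real"]
      by eventually_elim (unfold real_norm_def c_def, rule exp_integral_E1_plus_ln_bounds)
    show "((\<lambda>z::real. (1 - exp (- z)) * (- ln (1 - exp (- z)))) \<longlongrightarrow> 0) (at_right 0)"
      by real_asymp
  qed
  moreover have "((\<lambda>z::real. ln z - ln (1 - exp (- z))) \<longlongrightarrow> 0) (at_right 0)"
    by real_asymp
  ultimately have "((\<lambda>z. (exp_integral_E1 z + ln (1 - exp (- z)) + (\<Sum>n. c n * exp (- z) ^ Suc n))
      + (ln z - ln (1 - exp (- z))) - (\<Sum>n. c n * exp (- z) ^ Suc n)) \<longlongrightarrow> 0 + 0 - euler_mascheroni) (at_right 0)"
    by (intro tendsto_intros lim)
  then show ?thesis by (simp add: algebra_simps)
qed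

section \<open>Euler products and the zeta function\<close>

text \<open>Dirichlet series supported on the integers composed of the primes in \<open>P\<close> are indexed by
  exponent vectors, so that Euler products become products of sums over \<open>PiE\<close>.\<close>

definition exponent_vectors :: "nat set \<Rightarrow> (nat \<Rightarrow> nat) set" where
  "exponent_vectors P = PiE P (\<lambda>_. UNIV)"

definition vector_value :: "nat set \<Rightarrow> (nat \<Rightarrow> nat) \<Rightarrow> nat" where
  "vector_value P g = (\<Prod>p\<in>P. p ^ g p)"

lemma vector_value_pos:
  assumes "\<And>p. p \<in> P \<Longrightarrow> prime p"
  shows "vector_value P g > 0"
  using assms prime_gt_0_nat unfolding vector_value_def by (intro prod_pos) auto

lemma vector_value_powr:
  "real (vector_value P g) powr x = (\<Prod>p\<in>P. (real p powr x) ^ g p)"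
proof -
  have "(real p ^ m) powr x = (real p powr x) ^ m" for p m
    by (induction m) (auto simp: powr_mult)
  then show ?thesis
    by (induction P rule: infinite_finite_induct) (auto simp: vector_value_def powr_mult prod_nonneg)
qed

lemma inj_on_vector_value:
  assumes "finite P" "\<And>p. p \<in> P \<Longrightarrow> prime p"
  shows "inj_on (vector_value P) (exponent_vectors P)"
proof (rule inj_onI)
  fix g h assume gh: "g \<in> exponent_vectors P" "h \<in> exponent_vectors P" "vector_value P g = vector_value P h"
  have "g p = h p" if "p \<in> P" for p
    using multiplicity_prod_prime_powers[OF assms, of p g] multiplicity_prod_prime_powers[OF assms, of p h]
      gh(3) that assms(2)[OF that] by (simp add: vector_value_def)
  then show "g = h"
    using gh(1,2) unfolding exponent_vectors_def by (intro PiE_ext) auto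
qed

lemma smooth_in_vector_value_image:
  assumes "finite P" "n > 0" "prime_factors n \<subseteq> P" "\<And>p. p \<in> P \<Longrightarrow> prime p"
  shows "n \<in> vector_value P ` exponent_vectors P"
proof
  let ?g = "restrict (\<lambda>p. multiplicity p n) P"
  show "?g \<in> exponent_vectors P" by (simp add: exponent_vectors_def)
  have "n = (\<Prod>p\<in>prime_factors n. p ^ multiplicity p n)"
    using assms by (intro prime_factorization_nat) auto
  also have "\<dots> = (\<Prod>p\<in>P. p ^ multiplicity p n)"
    using assms by (intro prod.mono_neutral_left) (auto simp: prime_factors_multiplicity)
  finally show "n = vector_value P ?g" by (simp add: vector_value_def)
qed

lemma abs_summable_on_exponent_vectors:
  fixes f :: "nat \<Rightarrow> nat \<Rightarrow> 'a :: {real_normed_field,banach,second_countable_topology}"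
  assumes "finite P" "\<And>p. p \<in> P \<Longrightarrow> (\<lambda>m. norm (f p m)) summable_on UNIV"
  shows "(\<lambda>g. norm (\<Prod>p\<in>P. f p (g p))) summable_on exponent_vectors P"
  unfolding exponent_vectors_def abs_summable_equivalent
  using assms by (intro abs_summable_on_prod_PiE) (auto simp flip: abs_summable_equivalent)

lemma infsum_exponent_vectors:
  fixes f :: "nat \<Rightarrow> nat \<Rightarrow> 'a :: {real_normed_field,banach}"
  assumes "finite P" "\<And>p. p \<in> P \<Longrightarrow> (\<lambda>m. norm (f p m)) summable_on UNIV"
  shows "(\<Sum>\<^sub>\<infinity>g\<in>exponent_vectors P. \<Prod>p\<in>P. f p (g p)) = (\<Prod>p\<in>P. \<Sum>\<^sub>\<infinity>m. f p m)"
  unfolding exponent_vectors_def by (rule infsum_prod_PiE_abs[OF assms])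

lemma has_sum_geometric_real:
  fixes x :: real
  assumes "0 \<le> x" "x < 1"
  shows "((\<lambda>m. x ^ m) has_sum (1 / (1 - x))) UNIV"
  using assms by (intro norm_summable_imp_has_sum geometric_sums) (auto simp: summable_geometric)

section \<open>Zeta at real points to the right of 1\<close>

lemma real_zeta_summable: "s > 1 \<Longrightarrow> summable (\<lambda>n. real n powr (- s))"
  by (simp add: summable_real_powr_iff)

text \<open>Indexing from 0 is harmless: \<open>0 powr (- s)\<close> is 0, so the series may run
  over the integers themselves.\<close>

lemma real_zeta_sums:
  assumes "s > 1"
  shows "(\<lambda>n. real n powr (- s)) sums real_zeta s"
proof -
  have "(\<lambda>n. real (Suc n) powr (- s)) sums real_zeta s"
    using real_zeta_summable[OF assms] unfolding real_zeta_def
    by (subst (asm) summable_Suc_iff[symmetric]) (simp add: powr_minus_divide summable_sums)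
  then show ?thesis
    by (subst (asm) sums_Suc_iff) simp
qed

lemma prime_powr_less_1:
  assumes "prime p" "s > 0"
  shows "real p powr (- s) < 1"
  using assms prime_gt_1_nat[of p] by (intro powr_less_one) auto

lemma finite_primes_le [simp]: "finite {p. prime p \<and> p \<le> (N::nat)}"
  by (rule finite_subset[of _ "{..N}"]) auto

text \<open>Expanding the geometric series turns the finite product into the sum of n^(-s) over the
  n whose prime factors are all at most N. This set contains 1, ..., N and consists of positive
  integers, whence both bounds.\<close>

lemma euler_product_bounds:
  assumes "s > 1"
  defines "E \<equiv> (\<lambda>N. \<Prod>p | prime p \<and> p \<le> N. 1 / (1 - real p powr (- s)))"
  shows "(\<Sum>n<Suc N. real n powr (- s)) \<le> E N" and "E N \<le> real_zeta s"
proof -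
  define P where "P = {p. prime p \<and> p \<le> N}"
  have P: "finite P" "\<And>p. p \<in> P \<Longrightarrow> prime p" by (auto simp: P_def)
  have zeta: "((\<lambda>n. real n powr (- s)) has_sum real_zeta s) UNIV"
    using real_zeta_sums[OF assms(1)] real_zeta_summable[OF assms(1)]
    by (intro norm_summable_imp_has_sum) auto
  have g: "((\<lambda>m. (real p powr (- s)) ^ m) has_sum (1 / (1 - real p powr (- s)))) UNIV" if "p \<in> P" for p
    using P(2)[OF that] assms(1) by (intro has_sum_geometric_real prime_powr_less_1) auto
  have "E N = (\<Prod>p\<in>P. \<Sum>\<^sub>\<infinity>m. (real p powr (- s)) ^ m)"
    unfolding E_def P_def[symmetric] by (intro prod.cong refl infsumI[symmetric] g)
  also have "\<dots> = (\<Sum>\<^sub>\<infinity>g\<in>exponent_vectors P. \<Prod>p\<in>P. (real p powr (- s)) ^ g p)"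
  proof (intro infsum_exponent_vectors[symmetric] P)
    show "(\<lambda>m. norm ((real p powr (- s)) ^ m)) summable_on UNIV" if "p \<in> P" for p
      using has_sum_imp_summable[OF g[OF that]] by simp
  qed
  also have "\<dots> = (\<Sum>\<^sub>\<infinity>g\<in>exponent_vectors P. real (vector_value P g) powr (- s))"
    by (simp only: vector_value_powr)
  also have "\<dots> = (\<Sum>\<^sub>\<infinity>n\<in>vector_value P ` exponent_vectors P. real n powr (- s))"
    by (subst infsum_reindex[OF inj_on_vector_value[OF P]]) (simp_all add: o_def)
  finally have E: "E N = \<dots>" .
  have sub: "(\<lambda>n. real n powr (- s)) summable_on A" for A :: "nat set"
    using has_sum_imp_summable[OF zeta] by (rule summable_on_subset) auto
  show "E N \<le> real_zeta s"
    unfolding E infsumI[OF zeta, symmetric] by (intro infsum_mono2 sub) auto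
  have "(\<Sum>n<Suc N. real n powr (- s)) = (\<Sum>n=1..N. real n powr (- s))"
    by (rule sum.mono_neutral_right) (auto simp: Suc_le_eq)
  also have "\<dots> = (\<Sum>\<^sub>\<infinity>n\<in>{1..N}. real n powr (- s))" by simp
  also have "\<dots> \<le> E N"
    unfolding E
  proof (intro infsum_mono2 sub)
    show "{1..N} \<subseteq> vector_value P ` exponent_vectors P"
    proof
      fix n assume n: "n \<in> {1..N}"
      have "prime_factors n \<subseteq> P"
      proof
        fix p assume "p \<in> prime_factors n"
        then have "prime p" "p dvd n" by auto
        with n show "p \<in> P"
          using dvd_imp_le[of p n] by (auto simp: P_def)
      qed
      then show "n \<in> vector_value P ` exponent_vectors P"
        using n P by (intro smooth_in_vector_value_image) auto
    qed
  qed auto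
  finally show "(\<Sum>n<Suc N. real n powr (- s)) \<le> E N" .
qed

text \<open>Integral comparison: by the mean value theorem the terms delta n^(-1-delta) interlace
  with differences of x^(-delta), which telescope to 1. This is the simple pole at 1 with a bounded
  error.\<close>

lemma real_zeta_bounds:
  assumes "\<delta> > 0"
  shows "1 / \<delta> \<le> real_zeta (1 + \<delta>)" "real_zeta (1 + \<delta>) \<le> 1 / \<delta> + 1"
proof -
  let ?f = "\<lambda>x::real. x powr (- \<delta>)"
  have lim: "(\<lambda>n. ?f (real (n + 1))) \<longlonglongrightarrow> 0" using assms by real_asymp
  have tele: "(\<lambda>n. ?f (real (n + 1)) - ?f (real (n + 2))) sums 1"
    using telescope_sums'[OF lim] by (simp add: add_ac)
  have zeta: "(\<lambda>n. real (n + 1) powr (- (1 + \<delta>))) sums real_zeta (1 + \<delta>)"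
    using real_zeta_sums[of "1 + \<delta>"] assms
      sums_Suc_iff[of "\<lambda>n. real n powr (- (1 + \<delta>))" "real_zeta (1 + \<delta>)"] by simp
  have zeta': "(\<lambda>n. real (n + 2) powr (- (1 + \<delta>))) sums (real_zeta (1 + \<delta>) - 1)"
    using zeta sums_Suc_iff[of "\<lambda>n. real (n + 1) powr (- (1 + \<delta>))" "real_zeta (1 + \<delta>) - 1"]
    by (simp add: add_ac)
  have mvt: "\<delta> * real (n + 2) powr (- (1 + \<delta>)) \<le> ?f (real (n + 1)) - ?f (real (n + 2))"
            "?f (real (n + 1)) - ?f (real (n + 2)) \<le> \<delta> * real (n + 1) powr (- (1 + \<delta>))" for n
  proof -
    have "\<exists>x. real (n + 1) < x \<and> x < real (n + 2) \<and>
        ?f (real (n + 2)) - ?f (real (n + 1)) = (real (n + 2) - real (n + 1)) * ((- \<delta>) * x powr (- \<delta> - 1))"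
      by (rule MVT2) (auto intro!: derivative_eq_intros simp: powr_diff)
    then obtain x where x: "real (n + 1) < x" "x < real (n + 2)"
      "?f (real (n + 2)) - ?f (real (n + 1)) = (real (n + 2) - real (n + 1)) * ((- \<delta>) * x powr (- \<delta> - 1))"
      by blast
    have eqs: "real (n + 2) - real (n + 1) = 1" "- \<delta> - 1 = - (1 + \<delta>)" by simp_all
    have eq: "?f (real (n + 1)) - ?f (real (n + 2)) = \<delta> * x powr (- (1 + \<delta>))"
      using x(3) unfolding eqs by simp
    have "real (n + 2) powr (- (1 + \<delta>)) \<le> x powr (- (1 + \<delta>))"
      using x(1,2) assms by (intro powr_mono2') auto
    then show "\<delta> * real (n + 2) powr (- (1 + \<delta>)) \<le> ?f (real (n + 1)) - ?f (real (n + 2))"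
      unfolding eq using assms by (intro mult_left_mono) auto
    have "x powr (- (1 + \<delta>)) \<le> real (n + 1) powr (- (1 + \<delta>))"
      using x(1,2) assms by (intro powr_mono2') auto
    then show "?f (real (n + 1)) - ?f (real (n + 2)) \<le> \<delta> * real (n + 1) powr (- (1 + \<delta>))"
      unfolding eq using assms by (intro mult_left_mono) auto
  qed
  have "1 \<le> \<delta> * real_zeta (1 + \<delta>)"
    by (rule sums_le[OF mvt(2) tele sums_mult[OF zeta]])
  then show "1 / \<delta> \<le> real_zeta (1 + \<delta>)" using assms by (simp add: field_simps)
  have "\<delta> * (real_zeta (1 + \<delta>) - 1) \<le> 1"
    by (rule sums_le[OF mvt(1) sums_mult[OF zeta'] tele])
  then show "real_zeta (1 + \<delta>) \<le> 1 / \<delta> + 1" using assms by (simp add: field_simps)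
qed

lemma real_zeta_pos: "s > 1 \<Longrightarrow> real_zeta s > 0"
  using real_zeta_bounds(1)[of "s - 1"] by (smt (verit) zero_less_divide_iff)

lemma ln_zeta_tendsto:
  assumes "s > 1"
  shows "(\<lambda>N. \<Sum>p | prime p \<and> p \<le> N. - ln (1 - real p powr (- s))) \<longlonglongrightarrow> ln (real_zeta s)"
proof -
  let ?E = "\<lambda>N. \<Prod>p | prime p \<and> p \<le> N. 1 / (1 - real p powr (- s))"
  have "?E \<longlonglongrightarrow> real_zeta s"
  proof (rule tendsto_sandwich[of "\<lambda>N. \<Sum>n<Suc N. real n powr (- s)" _ _ "\<lambda>_. real_zeta s"])
    show "(\<lambda>N. \<Sum>n<Suc N. real n powr (- s)) \<longlonglongrightarrow> real_zeta s"
      using real_zeta_sums[OF assms] unfolding sums_def by (rule LIMSEQ_Suc)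
  qed (use euler_product_bounds[OF assms] in auto)
  then have "(\<lambda>N. ln (?E N)) \<longlonglongrightarrow> ln (real_zeta s)"
    using real_zeta_pos[OF assms] by (intro tendsto_ln) auto
  moreover have "ln (?E N) = (\<Sum>p | prime p \<and> p \<le> N. - ln (1 - real p powr (- s)))" for N
  proof -
    have less: "real p powr (- s) < 1" if "prime p" for p
      using prime_powr_less_1[OF that, of s] assms by simp
    have "ln (?E N) = (\<Sum>p | prime p \<and> p \<le> N. ln (1 / (1 - real p powr (- s))))"
    proof (rule ln_prod)
      fix p assume "p \<in> {p. prime p \<and> p \<le> N}"
      then show "1 / (1 - real p powr (- s)) \<noteq> 0"
        using less[of p] by simp
    qed simp
    also have "\<dots> = (\<Sum>p | prime p \<and> p \<le> N. - ln (1 - real p powr (- s)))"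
    proof (intro sum.cong refl)
      fix p assume "p \<in> {p. prime p \<and> p \<le> N}"
      then show "ln (1 / (1 - real p powr (- s))) = - ln (1 - real p powr (- s))"
        using less[of p] by (simp add: ln_div)
    qed
    finally show ?thesis .
  qed
  ultimately show ?thesis by simp
qed

text \<open>The pole contributes -log delta, the same singularity as that of E_1 at 0; the two
  cancel when sigma tends to 1/2.\<close>

lemma ln_zeta_plus_ln_tendsto:
  "((\<lambda>\<delta>. ln (real_zeta (1 + \<delta>)) + ln \<delta>) \<longlongrightarrow> 0) (at_right 0)"
proof (rule tendsto_sandwich)
  show "\<forall>\<^sub>F \<delta> in at_right 0. (0::real) \<le> ln (real_zeta (1 + \<delta>)) + ln \<delta>"
    using eventually_at_right_less[of "0::real"]
  proof eventually_elim
    case (elim \<delta>)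
    have "ln (1 / \<delta>) \<le> ln (real_zeta (1 + \<delta>))"
      using real_zeta_bounds(1)[OF elim] real_zeta_pos[of "1 + \<delta>"] elim by (subst ln_le_cancel_iff) auto
    then show ?case using elim by (simp add: ln_div)
  qed
  show "\<forall>\<^sub>F \<delta> in at_right 0. ln (real_zeta (1 + \<delta>)) + ln \<delta> \<le> ln (1 / \<delta> + 1) + ln \<delta>"
    using eventually_at_right_less[of "0::real"]
  proof eventually_elim
    case (elim \<delta>)
    have "1 / \<delta> + 1 > 0" using elim by (simp add: add_pos_pos)
    then have "ln (real_zeta (1 + \<delta>)) \<le> ln (1 / \<delta> + 1)"
      using real_zeta_bounds(2)[OF elim] real_zeta_pos[of "1 + \<delta>"] elim by (subst ln_le_cancel_iff) auto
    then show ?case by simp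
  qed
  show "((\<lambda>\<delta>::real. ln (1 / \<delta> + 1) + ln \<delta>) \<longlongrightarrow> 0) (at_right 0)"
    by real_asymp
qed simp

section \<open>Partial Euler products of the zeta function\<close>

lemma abel_summation_bound:
  fixes a g :: "nat \<Rightarrow> real"
  assumes "\<And>N. N \<ge> M \<Longrightarrow> \<bar>\<Sum>n\<in>{M<..N}. a n\<bar> \<le> B"
    and "\<And>n. n > M \<Longrightarrow> g (Suc n) \<le> g n" and "\<And>n. g n \<ge> 0" and "N \<ge> M"
  shows "\<bar>\<Sum>n\<in>{M<..N}. a n * g n\<bar> \<le> B * g (Suc M)"
proof -
  define A where "A = (\<lambda>N. \<Sum>n\<in>{M<..N}. a n)"
  have A: "\<bar>A N\<bar> \<le> B" if "N \<ge> M" for N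
    using assms(1)[OF that] by (simp add: A_def)
  \<comment> \<open>Summation by parts as an invariant: with the boundary term kept on the left,
    each step adds only B times the drop of g. The boundary term is restored at the end.\<close>
  have "\<bar>(\<Sum>n\<in>{M<..N}. a n * g n) - A N * g (Suc N)\<bar> \<le> B * (g (Suc M) - g (Suc N))"
    using \<open>N \<ge> M\<close>
  proof (induction N rule: dec_induct)
    case base
    then show ?case by (simp add: A_def)
  next
    case (step n)
    have eq: "{M<..Suc n} = insert (Suc n) {M<..n}" using step by auto
    have "(\<Sum>i\<in>{M<..Suc n}. a i * g i) - A (Suc n) * g (Suc (Suc n)) =
       ((\<Sum>i\<in>{M<..n}. a i * g i) - A n * g (Suc n)) + A (Suc n) * (g (Suc n) - g (Suc (Suc n)))"
      unfolding A_def eq by (simp add: algebra_simps)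
    also have "\<bar>\<dots>\<bar> \<le> B * (g (Suc M) - g (Suc n)) + B * (g (Suc n) - g (Suc (Suc n)))"
    proof (intro order_trans[OF abs_triangle_ineq] add_mono step)
      have "g (Suc (Suc n)) \<le> g (Suc n)" using step by (intro assms) auto
      then show "\<bar>A (Suc n) * (g (Suc n) - g (Suc (Suc n)))\<bar> \<le> B * (g (Suc n) - g (Suc (Suc n)))"
        using A[of "Suc n"] step by (simp add: abs_mult mult_right_mono)
    qed
    finally show ?case by (simp add: algebra_simps)
  qed
  moreover have "\<bar>A N * g (Suc N)\<bar> \<le> B * g (Suc N)"
    using A[OF \<open>N \<ge> M\<close>] assms(3)[of "Suc N"] by (simp add: abs_mult mult_right_mono)
  ultimately show ?thesis by (simp add: algebra_simps)
qed

lemma sum_telescope_greaterThanAtMost: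
  fixes f :: "nat \<Rightarrow> real"
  assumes "M \<le> N"
  shows "(\<Sum>n\<in>{M<..N}. f (n - 1) - f n) = f M - f N"
  using assms
proof (induction N rule: dec_induct)
  case (step n)
  have "{M<..Suc n} = insert (Suc n) {M<..n}" using step by auto
  then show ?case using step by simp
qed simp

text \<open>Under w = delta log x the measure e^(-w) dw / w becomes g(x) d(log x). As g decreases,
  one unit step of E_1 lies between the increment of log times the two end values of g. The same g
  is what remains of n^(-1-delta) when log n / n is split off.\<close>

lemma exp_integral_E1_step:
  assumes "\<delta> > 0" "n \<ge> 2"
  defines "g \<equiv> \<lambda>n::nat. real n powr (- \<delta>) / ln (real n)"
  defines "\<Delta> \<equiv> ln (real (Suc n)) - ln (real n)"
  shows "\<Delta> * g (Suc n) \<le> exp_integral_E1 (\<delta> * ln (real n)) - exp_integral_E1 (\<delta> * ln (real (Suc n)))"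
    and "exp_integral_E1 (\<delta> * ln (real n)) - exp_integral_E1 (\<delta> * ln (real (Suc n))) \<le> \<Delta> * g n"
    and "0 \<le> \<Delta>" "\<Delta> \<le> 1" "g (Suc n) \<le> g n"
proof -
  let ?u = "ln (real n)" and ?v = "ln (real (Suc n))"
  have u: "?u > 0" and uv: "?u \<le> ?v" using assms by auto
  have v: "?v > 0" using u uv by linarith
  have e: "exp (- (\<delta> * ln (real m))) = real m powr (- \<delta>)" if "m > 0" for m :: nat
    using that by (simp add: powr_def)
  have ratio: "\<delta> * ?v / (\<delta> * ?u) = ?v / ?u" using assms by simp
  note b = exp_integral_E1_diff_bounds[of "\<delta> * ?u" "\<delta> * ?v", unfolded ratio]
  have pos: "0 < \<delta> * ?u" "\<delta> * ?u \<le> \<delta> * ?v" using assms u uv by auto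
  have ln1: "ln (?v / ?u) \<le> \<Delta> / ?u"
    using ln_le_minus_one[of "?v / ?u"] u v by (simp add: \<Delta>_def diff_divide_distrib)
  have ln2: "ln (?v / ?u) \<ge> \<Delta> / ?v"
    using ln_le_minus_one[of "?u / ?v"] u v by (simp add: \<Delta>_def diff_divide_distrib ln_div)
  have "\<Delta> * g (Suc n) = real (Suc n) powr (- \<delta>) * (\<Delta> / ?v)"
    by (simp add: g_def)
  also have "\<dots> \<le> real (Suc n) powr (- \<delta>) * ln (?v / ?u)"
    using ln2 by (intro mult_left_mono) auto
  also have "\<dots> \<le> exp_integral_E1 (\<delta> * ?u) - exp_integral_E1 (\<delta> * ?v)"
    using b(1)[OF pos] e[of "Suc n"] by simp
  finally show "\<Delta> * g (Suc n) \<le> exp_integral_E1 (\<delta> * ?u) - exp_integral_E1 (\<delta> * ?v)" .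
  have "exp_integral_E1 (\<delta> * ?u) - exp_integral_E1 (\<delta> * ?v) \<le> real n powr (- \<delta>) * ln (?v / ?u)"
    using b(2)[OF pos] e[of n] assms by simp
  also have "\<dots> \<le> real n powr (- \<delta>) * (\<Delta> / ?u)"
    using ln1 by (intro mult_left_mono) auto
  also have "\<dots> = \<Delta> * g n" by (simp add: g_def)
  finally show "exp_integral_E1 (\<delta> * ?u) - exp_integral_E1 (\<delta> * ?v) \<le> \<Delta> * g n" .
  show "0 \<le> \<Delta>" using uv by (simp add: \<Delta>_def)
  have "ln (real (Suc n) / real n) \<le> real (Suc n) / real n - 1"
    using assms by (intro ln_le_minus_one) auto
  also have "\<dots> \<le> 1" using assms by (simp add: field_simps)
  finally show "\<Delta> \<le> 1" using assms by (simp add: \<Delta>_def ln_div)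
  show "g (Suc n) \<le> g n"
    unfolding g_def using assms u uv by (intro frac_le powr_mono2') auto
qed

text \<open>By Mertens' estimate, log p / p over primes has the same partial sums as the increments
  of log n up to O(1). Weighting both by g and summing by parts turns the prime sum into a
  difference of E_1, and the error is O(g(M)) with g(M) <= 1 / log M for every delta.\<close>

lemma prime_sum_exp_integral:
  obtains C where "C > 0"
    "\<And>\<delta> M N. \<delta> > 0 \<Longrightarrow> 2 \<le> M \<Longrightarrow> M \<le> N \<Longrightarrow>
       \<bar>(\<Sum>n\<in>{M<..N}. if prime n then real n powr (- (1 + \<delta>)) else 0) -
        (exp_integral_E1 (\<delta> * ln (real M)) - exp_integral_E1 (\<delta> * ln (real N)))\<bar> \<le> C / ln (real M)"
proof -
  obtain C where C: "C > 0"
    "\<And>N. N \<ge> 1 \<Longrightarrow> \<bar>(\<Sum>n=1..N. if prime n then ln (real n) / real n else 0) - ln (real N)\<bar> \<le> C"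
    using mertens_primes by blast
  \<comment> \<open>Here 2 C bounds the partial sums of \<open>a\<close>, with Mertens' error
    incurred at both ends of the range. The 1 pays for replacing steps of E_1 by g times increments
    of log, an error that telescopes because these increments are at most 1.\<close>
  show ?thesis
  proof (rule that[of "2 * C + 1"])
    show "2 * C + 1 > 0" using C by simp
    fix \<delta> :: real and M N :: nat
    assume asm: "\<delta> > 0" "2 \<le> M" "M \<le> N"
    define a where "a = (\<lambda>n. (if prime n then ln (real n) / real n else 0) - (ln (real n) - ln (real (n - 1))))"
    define g where "g = (\<lambda>n::nat. real n powr (- \<delta>) / ln (real n))"
    define D where "D = (\<lambda>n. exp_integral_E1 (\<delta> * ln (real (n - 1))) - exp_integral_E1 (\<delta> * ln (real n)))"
    have A: "\<bar>\<Sum>n\<in>{M<..K}. a n\<bar> \<le> 2 * C" if "K \<ge> M" for K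
    proof -
      have "(\<Sum>n\<in>{M<..K}. ln (real (n - 1)) - ln (real n)) = ln (real M) - ln (real K)"
        by (rule sum_telescope_greaterThanAtMost[OF that])
      moreover have "(\<Sum>n=1..K. if prime n then ln (real n) / real n else 0) =
         (\<Sum>n=1..M. if prime n then ln (real n) / real n else 0) +
         (\<Sum>n\<in>{M<..K}. if prime n then ln (real n) / real n else 0)"
      proof -
        have "{1..K} = {1..M} \<union> {M<..K}" using that asm by auto
        moreover have "{1..M} \<inter> {M<..K} = {}" by auto
        ultimately show ?thesis by (simp add: sum.union_disjoint)
      qed
      moreover have "(\<Sum>n\<in>{M<..K}. a n) = (\<Sum>n\<in>{M<..K}. if prime n then ln (real n) / real n else 0) +
         (\<Sum>n\<in>{M<..K}. ln (real (n - 1)) - ln (real n))"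
        unfolding a_def sum.distrib[symmetric] by (intro sum.cong) auto
      ultimately show ?thesis
        using C(2)[of M] C(2)[of K] that asm by linarith
    qed
    have step: "(ln (real n) - ln (real (n - 1))) * g n \<le> D n"
               "D n \<le> (ln (real n) - ln (real (n - 1))) * g n + (g (n - 1) - g n)" if "n > M" for n
    proof -
      define m where "m = n - 1"
      have m: "n = Suc m" "m \<ge> 2" using that asm(2) by (auto simp: m_def)
      note st = exp_integral_E1_step[OF asm(1) m(2), folded g_def]
      show "(ln (real n) - ln (real (n - 1))) * g n \<le> D n"
        using st(1) by (simp add: D_def m(1) g_def)
      have "D n \<le> (ln (real (Suc m)) - ln (real m)) * g m"
        using st(2) by (simp add: D_def m(1) g_def)
      also have "\<dots> \<le> (ln (real (Suc m)) - ln (real m)) * g (Suc m) + 1 * (g m - g (Suc m))"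
      proof -
        have "(ln (real (Suc m)) - ln (real m)) * (g m - g (Suc m)) \<le> 1 * (g m - g (Suc m))"
          using st(4,5) by (intro mult_right_mono) (auto simp: g_def)
        then show ?thesis by (simp add: algebra_simps)
      qed
      finally show "D n \<le> (ln (real n) - ln (real (n - 1))) * g n + (g (n - 1) - g n)"
        by (simp add: m(1))
    qed
    have gpos: "g n \<ge> 0" for n by (cases "n = 0") (auto simp: g_def)
    have gdec: "g (Suc n) \<le> g n" if "n \<ge> 2" for n
      using exp_integral_E1_step(5)[OF asm(1) that] by (simp add: g_def)
    have 1: "\<bar>\<Sum>n\<in>{M<..N}. a n * g n\<bar> \<le> 2 * C * g (Suc M)"
      by (rule abel_summation_bound[OF A]) (use gpos gdec asm in auto)
    have "(\<Sum>n\<in>{M<..N}. D n - (ln (real n) - ln (real (n - 1))) * g n) \<le> (\<Sum>n\<in>{M<..N}. g (n - 1) - g n)"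
      by (rule sum_mono) (use step in \<open>auto simp: algebra_simps\<close>)
    also have "\<dots> = g M - g N" by (rule sum_telescope_greaterThanAtMost[OF asm(3)])
    finally have 2: "(\<Sum>n\<in>{M<..N}. D n - (ln (real n) - ln (real (n - 1))) * g n) \<le> g M"
      using gpos[of N] by linarith
    have 3: "(\<Sum>n\<in>{M<..N}. D n - (ln (real n) - ln (real (n - 1))) * g n) \<ge> 0"
      by (rule sum_nonneg) (use step in auto)
    have 4: "(\<Sum>n\<in>{M<..N}. D n) = exp_integral_E1 (\<delta> * ln (real M)) - exp_integral_E1 (\<delta> * ln (real N))"
      unfolding D_def by (rule sum_telescope_greaterThanAtMost[OF asm(3)])
    have 5: "(\<Sum>n\<in>{M<..N}. if prime n then real n powr (- (1 + \<delta>)) else 0) - (\<Sum>n\<in>{M<..N}. D n) =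
        (\<Sum>n\<in>{M<..N}. a n * g n) - (\<Sum>n\<in>{M<..N}. D n - (ln (real n) - ln (real (n - 1))) * g n)"
      unfolding sum_subtractf[symmetric]
    proof (intro sum.cong refl)
      fix n assume n: "n \<in> {M<..N}"
      then have "ln (real n) > 0" using asm by auto
      then have "real n powr (- (1 + \<delta>)) = ln (real n) / real n * g n"
        using n powr_add[of "real n" "-1" "-\<delta>"] by (simp add: g_def powr_minus_divide)
      then show "(if prime n then real n powr (- (1 + \<delta>)) else 0) - D n =
          a n * g n - (D n - (ln (real n) - ln (real (n - 1))) * g n)"
        by (simp add: a_def algebra_simps)
    qed
    have "g (Suc M) \<le> g M" using asm by (intro gdec)
    then have "2 * C * g (Suc M) \<le> 2 * C * g M" using C(1) by (intro mult_left_mono) auto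
    then have "\<bar>(\<Sum>n\<in>{M<..N}. if prime n then real n powr (- (1 + \<delta>)) else 0) - (\<Sum>n\<in>{M<..N}. D n)\<bar>
        \<le> (2 * C + 1) * g M"
      unfolding 5 using 1 2 3 by (simp add: algebra_simps abs_le_iff)
    also have "\<dots> \<le> (2 * C + 1) * (1 / ln (real M))"
    proof (intro mult_left_mono)
      have "real M powr (- \<delta>) \<le> real M powr 0" using asm by (intro powr_mono) auto
      then show "g M \<le> 1 / ln (real M)"
        unfolding g_def using asm by (intro divide_right_mono) auto
    qed (use C in auto)
    finally show "\<bar>(\<Sum>n\<in>{M<..N}. if prime n then real n powr (- (1 + \<delta>)) else 0) -
        (exp_integral_E1 (\<delta> * ln (real M)) - exp_integral_E1 (\<delta> * ln (real N)))\<bar> \<le> (2 * C + 1) / ln (real M)"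
      unfolding 4 by simp
  qed
qed

section \<open>Logarithms of partial Euler products\<close>

lemma minus_ln_one_minus_bounds:
  fixes x :: real
  assumes "0 \<le> x" "x \<le> 1/2"
  shows "x \<le> - ln (1 - x)" "- ln (1 - x) \<le> x + 2 * x\<^sup>2"
  using ln_one_minus_pos_upper_bound[of x] ln_one_minus_pos_lower_bound[of x] assms by auto

lemma sum_inverse_squares_le:
  assumes "1 \<le> M" "M \<le> N"
  shows "(\<Sum>n\<in>{M<..N}. 1 / (real n)\<^sup>2) \<le> 1 / real M"
proof -
  have "(\<Sum>n\<in>{M<..N}. 1 / (real n)\<^sup>2) \<le> (\<Sum>n\<in>{M<..N}. 1 / real (n - 1) - 1 / real n)"
  proof (rule sum_mono)
    fix n assume n: "n \<in> {M<..N}"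
    define m where "m = n - 1"
    have m: "n = Suc m" "m \<ge> 1" using n assms by (auto simp: m_def)
    have "1 / (real n)\<^sup>2 \<le> 1 / (real m * real n)"
      using m by (intro divide_left_mono) (auto simp: power2_eq_square)
    also have "\<dots> = 1 / real (n - 1) - 1 / real n"
      using m by (simp add: field_simps)
    finally show "1 / (real n)\<^sup>2 \<le> 1 / real (n - 1) - 1 / real n" .
  qed
  also have "\<dots> = 1 / real M - 1 / real N"
    by (rule sum_telescope_greaterThanAtMost[OF assms(2)])
  also have "\<dots> \<le> 1 / real M" by simp
  finally show ?thesis .
qed

definition prime_log_sum :: "real \<Rightarrow> real \<Rightarrow> real" where
  "prime_log_sum X s = (\<Sum>p | prime p \<and> real p \<le> X. - ln (1 - real p powr (- s)))"

text \<open>For s >= 1 each x = p^(-s) is at most 1/p, so -log (1 - x) exceeds x by at most 2 / p^2,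
  and these excesses beyond M add up to at most 2 / M.\<close>

lemma prime_log_sum_diff:
  assumes "s \<ge> 1" "1 \<le> M" "M \<le> N"
  shows "\<bar>prime_log_sum (real N) s - prime_log_sum (real M) s -
           (\<Sum>n\<in>{M<..N}. if prime n then real n powr (- s) else 0)\<bar> \<le> 2 / real M"
proof -
  let ?l = "\<lambda>n. - ln (1 - real n powr (- s))"
  have set: "{p. prime p \<and> real p \<le> real N} = {p. prime p \<and> real p \<le> real M} \<union> {p\<in>{M<..N}. prime p}"
    using assms by auto
  have "prime_log_sum (real N) s = prime_log_sum (real M) s + (\<Sum>p\<in>{p\<in>{M<..N}. prime p}. ?l p)"
    unfolding prime_log_sum_def set by (rule sum.union_disjoint) auto
  also have "(\<Sum>p\<in>{p\<in>{M<..N}. prime p}. ?l p) = (\<Sum>n\<in>{M<..N}. if prime n then ?l n else 0)"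
    by (rule sum.inter_filter) auto
  finally have "prime_log_sum (real N) s - prime_log_sum (real M) s -
      (\<Sum>n\<in>{M<..N}. if prime n then real n powr (- s) else 0) =
      (\<Sum>n\<in>{M<..N}. (if prime n then ?l n else 0) - (if prime n then real n powr (- s) else 0))"
    by (simp add: sum_subtractf)
  also have "\<bar>\<dots>\<bar> \<le> (\<Sum>n\<in>{M<..N}. 2 * (1 / (real n)\<^sup>2))"
  proof (intro order_trans[OF sum_abs] sum_mono)
    fix n assume n: "n \<in> {M<..N}"
    define x where "x = real n powr (- s)"
    have n2: "real n \<ge> 2" using n assms by auto
    have "x \<le> real n powr (-1)" unfolding x_def using n2 assms by (intro powr_mono) auto
    then have x: "0 \<le> x" "x \<le> 1 / real n" using n2 by (auto simp: x_def powr_minus_divide)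
    have "x \<le> 1 / 2" using x n2 by (meson divide_left_mono order_trans mult_pos_pos zero_less_numeral zero_le_one less_le_trans)
    have "x\<^sup>2 \<le> (1 / real n)\<^sup>2" using x by (intro power_mono)
    then show "\<bar>(if prime n then ?l n else 0) - (if prime n then real n powr (- s) else 0)\<bar> \<le> 2 * (1 / (real n)\<^sup>2)"
      using minus_ln_one_minus_bounds[OF x(1) \<open>x \<le> 1/2\<close>] unfolding x_def[symmetric]
      by (simp add: power_divide)
  qed
  also have "\<dots> \<le> 2 * (1 / real M)"
    unfolding sum_distrib_left[symmetric] using assms by (intro mult_left_mono sum_inverse_squares_le) auto
  finally show ?thesis by simp
qed

text \<open>Summing the primes between M and N and letting N tend to infinity, the Euler product
  reaches zeta and E_1(delta log N) vanishes. The tail beyond M is thus E_1(delta log M) up to O(1 /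
  log M).\<close>

lemma prime_log_sum_zeta:
  obtains C where "C > 0"
    "\<And>\<delta> X. \<delta> > 0 \<Longrightarrow> X \<ge> 2 \<Longrightarrow>
      \<bar>prime_log_sum X (1 + \<delta>) - (ln (real_zeta (1 + \<delta>)) - exp_integral_E1 (\<delta> * ln X))\<bar> \<le> C / ln X"
proof -
  obtain C where C: "C > 0"
    "\<And>\<delta> M N. \<delta> > 0 \<Longrightarrow> 2 \<le> M \<Longrightarrow> M \<le> N \<Longrightarrow>
       \<bar>(\<Sum>n\<in>{M<..N}. if prime n then real n powr (- (1 + \<delta>)) else 0) -
        (exp_integral_E1 (\<delta> * ln (real M)) - exp_integral_E1 (\<delta> * ln (real N)))\<bar> \<le> C / ln (real M)"
    using prime_sum_exp_integral by blast
  \<comment> \<open>C is the error of the prime sum, 2 that of the squares in the logarithms, 1 the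
    cost of passing from M = floor X to X. The doubling comes from log X <= 2 log M.\<close>
  show ?thesis
  proof (rule that[of "2 * (C + 3)"])
    show "2 * (C + 3) > 0" using C by simp
    fix \<delta> X :: real assume asm: "\<delta> > 0" "X \<ge> 2"
    let ?E = exp_integral_E1
    define s where "s = 1 + \<delta>"
    define M where "M = nat \<lfloor>X\<rfloor>"
    have M: "M \<ge> 2" "real M \<le> X" "X \<le> real M + 1"
      using asm by (auto simp: M_def le_nat_iff le_floor_iff of_nat_floor)
    have lnM: "ln (real M) > 0" using M by simp
    have "ln X \<le> ln (real M * real M)"
    proof -
      have "real M + 1 \<le> real M * 2" using M(1) by linarith
      also have "\<dots> \<le> real M * real M" using M(1) by (intro mult_left_mono) auto
      finally show ?thesis using M asm by (subst ln_le_cancel_iff) auto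
    qed
    then have lnX: "ln X \<le> 2 * ln (real M)" using M by (simp add: ln_mult)
    have "prime_log_sum X s = prime_log_sum (real M) s"
    proof -
      have "real p \<le> X \<longleftrightarrow> real p \<le> real M" for p :: nat
        unfolding M_def using asm le_nat_floor[of p X] M(2)[unfolded M_def] by linarith
      then show ?thesis by (simp add: prime_log_sum_def)
    qed
    moreover have "\<bar>ln (real_zeta s) - prime_log_sum (real M) s - (?E (\<delta> * ln (real M)) - 0)\<bar> \<le> C / ln (real M) + 2 / real M"
    proof (rule LIMSEQ_le_const2)
      have "(\<lambda>N. prime_log_sum (real N) s) \<longlonglongrightarrow> ln (real_zeta s)"
        using ln_zeta_tendsto[of s] asm by (simp add: s_def prime_log_sum_def)
      moreover have "(\<lambda>N. ?E (\<delta> * ln (real N))) \<longlonglongrightarrow> 0"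
        using asm by (intro filterlim_compose[OF exp_integral_E1_tendsto_0]) real_asymp
      ultimately show "(\<lambda>N. \<bar>prime_log_sum (real N) s - prime_log_sum (real M) s - (?E (\<delta> * ln (real M)) - ?E (\<delta> * ln (real N)))\<bar>)
           \<longlonglongrightarrow> \<bar>ln (real_zeta s) - prime_log_sum (real M) s - (?E (\<delta> * ln (real M)) - 0)\<bar>"
        by (intro tendsto_intros)
      show "\<exists>N0. \<forall>N\<ge>N0. \<bar>prime_log_sum (real N) s - prime_log_sum (real M) s - (?E (\<delta> * ln (real M)) - ?E (\<delta> * ln (real N)))\<bar>
              \<le> C / ln (real M) + 2 / real M"
      proof (intro exI[of _ M] allI impI)
        fix N assume N: "N \<ge> M"
        show "\<bar>prime_log_sum (real N) s - prime_log_sum (real M) s - (?E (\<delta> * ln (real M)) - ?E (\<delta> * ln (real N)))\<bar>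
              \<le> C / ln (real M) + 2 / real M"
          using prime_log_sum_diff[of s M N] C(2)[OF asm(1) M(1) N] asm M(1) N unfolding s_def by linarith
      qed
    qed
    \<comment> \<open>The exponential damping is bounded by 1, so only log (log X / log M) <= (log X
      - log M) / log M remains and delta drops out; X <= M + 1 bounds the numerator by 1.\<close>
    moreover have "\<bar>?E (\<delta> * ln (real M)) - ?E (\<delta> * ln X)\<bar> \<le> 1 / ln (real M)"
    proof -
      have le: "0 < \<delta> * ln (real M)" "\<delta> * ln (real M) \<le> \<delta> * ln X" using asm M lnM by auto
      have ratio: "\<delta> * ln X / (\<delta> * ln (real M)) = ln X / ln (real M)" using asm by simp
      have ge1: "ln X / ln (real M) \<ge> 1" using M lnM by simp
      have "?E (\<delta> * ln (real M)) - ?E (\<delta> * ln X) \<le> exp (- (\<delta> * ln (real M))) * ln (ln X / ln (real M))"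
        using exp_integral_E1_diff_bounds(2)[OF le] unfolding ratio .
      also have "\<dots> \<le> 1 * (ln X / ln (real M) - 1)"
        using ge1 le(1) by (intro mult_mono ln_le_minus_one) auto
      also have "\<dots> = (ln X - ln (real M)) / ln (real M)" using lnM by (simp add: diff_divide_distrib)
      also have "\<dots> \<le> 1 / ln (real M)"
      proof (intro divide_right_mono)
        have "ln X - ln (real M) = ln (X / real M)" using M asm by (simp add: ln_div)
        also have "\<dots> \<le> X / real M - 1" using M asm by (intro ln_le_minus_one) auto
        also have "\<dots> \<le> 1" using M by (simp add: field_simps)
        finally show "ln X - ln (real M) \<le> 1" .
      qed (use lnM in auto)
      finally have "?E (\<delta> * ln (real M)) - ?E (\<delta> * ln X) \<le> 1 / ln (real M)" .
      moreover have "0 \<le> exp (- (\<delta> * ln X)) * ln (ln X / ln (real M))" using ge1 by simp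
      then have "0 \<le> ?E (\<delta> * ln (real M)) - ?E (\<delta> * ln X)"
        using exp_integral_E1_diff_bounds(1)[OF le] unfolding ratio by linarith
      ultimately show ?thesis by simp
    qed
    moreover have "2 / real M \<le> 2 / ln (real M)"
      using M lnM ln_le_minus_one[of "real M"] by (intro divide_left_mono) auto
    ultimately have "\<bar>prime_log_sum X s - (ln (real_zeta s) - ?E (\<delta> * ln X))\<bar> \<le> C / ln (real M) + 2 / ln (real M) + 1 / ln (real M)"
      by linarith
    also have "\<dots> = (C + 3) / ln (real M)" by (simp add: add_divide_distrib)
    also have "\<dots> \<le> 2 * (C + 3) / ln X"
    proof -
      have "(C + 3) * ln X \<le> (C + 3) * (2 * ln (real M))" using lnX C by (intro mult_left_mono) auto
      then show ?thesis using lnM asm by (simp add: field_simps)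
    qed
    finally show "\<bar>prime_log_sum X (1 + \<delta>) - (ln (real_zeta (1 + \<delta>)) - ?E (\<delta> * ln X))\<bar> \<le> 2 * (C + 3) / ln X"
      by (simp add: s_def)
  qed
qed

text \<open>The case \<open>s = 1\<close> (Mertens' third theorem) is the limit \<open>s \<rightarrow> 1\<close> of the previous estimate.\<close>

lemma prime_log_sum_at_1:
  assumes C: "\<And>\<delta> X. \<delta> > 0 \<Longrightarrow> X \<ge> 2 \<Longrightarrow>
      \<bar>prime_log_sum X (1 + \<delta>) - (ln (real_zeta (1 + \<delta>)) - exp_integral_E1 (\<delta> * ln X))\<bar> \<le> C / ln X"
    and "X \<ge> 2"
  shows "\<bar>prime_log_sum X 1 - (euler_mascheroni + ln (ln X))\<bar> \<le> C / ln X"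
proof -
  have L: "ln X > 0" using assms by simp
  have "((\<lambda>\<delta>. prime_log_sum X (1 + \<delta>)) \<longlongrightarrow> prime_log_sum X (1 + 0)) (at_right 0)"
    unfolding prime_log_sum_def
  proof (intro tendsto_sum tendsto_minus tendsto_ln tendsto_diff tendsto_powr tendsto_add tendsto_const tendsto_ident_at)
    show "1 - real p powr - (1 + 0) \<noteq> 0" if "p \<in> {p. prime p \<and> real p \<le> X}" for p
      using that prime_gt_1_nat[of p] by (auto simp: powr_minus_divide)
  qed (use prime_gt_0_nat in auto)
  moreover have "((\<lambda>\<delta>. exp_integral_E1 (\<delta> * ln X) + ln (\<delta> * ln X)) \<longlongrightarrow> - euler_mascheroni) (at_right 0)"
    using L by (intro filterlim_compose[OF exp_integral_E1_plus_ln_tendsto]) real_asymp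
  \<comment> \<open>log delta is added and subtracted so that each bracket has a finite limit; log
    (delta log X) leaves log log X behind.\<close>
  ultimately have "((\<lambda>\<delta>. \<bar>prime_log_sum X (1 + \<delta>) - ((ln (real_zeta (1 + \<delta>)) + ln \<delta>) -
      (exp_integral_E1 (\<delta> * ln X) + ln (\<delta> * ln X)) + ln (ln X))\<bar>) \<longlongrightarrow>
      \<bar>prime_log_sum X (1 + 0) - (0 - (- euler_mascheroni) + ln (ln X))\<bar>) (at_right 0)"
    by (intro tendsto_intros ln_zeta_plus_ln_tendsto)
  then have "\<bar>prime_log_sum X (1 + 0) - (0 - (- euler_mascheroni) + ln (ln X))\<bar> \<le> C / ln X"
  proof (rule tendsto_upperbound)
    show "\<forall>\<^sub>F \<delta> in at_right 0. \<bar>prime_log_sum X (1 + \<delta>) - ((ln (real_zeta (1 + \<delta>)) + ln \<delta>) -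
        (exp_integral_E1 (\<delta> * ln X) + ln (\<delta> * ln X)) + ln (ln X))\<bar> \<le> C / ln X"
      using eventually_at_right_less[of "0::real"]
    proof eventually_elim
      case (elim \<delta>)
      then show ?case using C[OF elim \<open>X \<ge> 2\<close>] L by (simp add: ln_mult algebra_simps)
    qed
  qed simp
  then show ?thesis by simp
qed

text \<open>The case distinction at sigma = 1/2 ends here: both branches are k^2-th powers, and
  afterwards only their common logarithm \<open>\<Phi>\<close> and its error matter.\<close>

lemma F_X_asymp:
  obtains C where "C > 0"
    "\<And>\<sigma> X. \<sigma> \<ge> 1/2 \<Longrightarrow> X \<ge> 2 \<Longrightarrow>
       \<exists>\<Phi>. F_X X k \<sigma> = exp (k\<^sup>2 * \<Phi>) \<and> \<bar>prime_log_sum X (2 * \<sigma>) - \<Phi>\<bar> \<le> C / ln X"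
proof -
  obtain C where C: "C > 0" "\<And>\<delta> X. \<delta> > 0 \<Longrightarrow> X \<ge> 2 \<Longrightarrow>
      \<bar>prime_log_sum X (1 + \<delta>) - (ln (real_zeta (1 + \<delta>)) - exp_integral_E1 (\<delta> * ln X))\<bar> \<le> C / ln X"
    using prime_log_sum_zeta by blast
  show ?thesis
  proof (rule that[OF C(1)])
    fix \<sigma> X :: real assume asm: "\<sigma> \<ge> 1/2" "X \<ge> 2"
    show "\<exists>\<Phi>. F_X X k \<sigma> = exp (k\<^sup>2 * \<Phi>) \<and> \<bar>prime_log_sum X (2 * \<sigma>) - \<Phi>\<bar> \<le> C / ln X"
    proof (cases "\<sigma> > 1/2")
      case True
      have "F_X X k \<sigma> = exp (k\<^sup>2 * (ln (real_zeta (2 * \<sigma>)) - exp_integral_E1 ((2 * \<sigma> - 1) * ln X)))"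
        using True real_zeta_pos[of "2 * \<sigma>"] by (simp add: F_X_def powr_def algebra_simps flip: exp_add)
      then show ?thesis using C(2)[of "2 * \<sigma> - 1" X] True asm by auto
    next
      case False
      then have "\<sigma> = 1/2" using asm by simp
      have "F_X X k \<sigma> = exp (k\<^sup>2 * (euler_mascheroni + ln (ln X)))"
        using False asm by (simp add: F_X_def powr_def ln_mult)
      then show ?thesis using prime_log_sum_at_1[OF C(2) asm(2)]
        by (intro exI[of _ "euler_mascheroni + ln (ln X)"]) (simp add: \<open>\<sigma> = 1/2\<close>)
    qed
  qed
qed

section \<open>Coefficients of the local factors\<close>

text \<open>\<open>exp_coeff k J m\<close> is the coefficient of \<open>x\<^sup>m\<close> in \<open>exp (k \<Sum>j=1..J. x\<^sup>j / j)\<close>, the local factor of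
  \<open>P_X\<^sup>k\<close> at a prime; the recursion is the one forced by \<open>f' = k (1 + x + \<dots> + x\<^bsup>J - 1\<^esup>) f\<close>.\<close>

fun exp_coeff :: "real \<Rightarrow> nat \<Rightarrow> nat \<Rightarrow> real" where
  "exp_coeff k J 0 = 1"
| "exp_coeff k J (Suc m) = k / real (Suc m) * (\<Sum>j\<in>{..m}. if j < J then exp_coeff k J (m - j) else 0)"

declare exp_coeff.simps(2) [simp del]

abbreviation binom_coeff :: "real \<Rightarrow> nat \<Rightarrow> real" where
  "binom_coeff k m \<equiv> pochhammer k m / fact m"

text \<open>Coefficientwise form of (1 - x)^(-k) / (1 - x) = (1 - x)^(-(k + 1)).\<close>

lemma sum_binom_coeff: "(\<Sum>i\<le>m. binom_coeff k i) = binom_coeff (k + 1) m"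
proof (induction m)
  case (Suc m)
  have "(\<Sum>i\<le>Suc m. binom_coeff k i) = binom_coeff (k + 1) m + binom_coeff k (Suc m)"
    using Suc by simp
  also have "\<dots> = (pochhammer (k + 1) m * real (Suc m) + k * pochhammer (k + 1) m) / fact (Suc m)"
    by (simp add: pochhammer_rec divide_simps)
  also have "\<dots> = binom_coeff (k + 1) (Suc m)"
    by (simp add: pochhammer_Suc algebra_simps)
  finally show ?case .
qed auto

text \<open>The derivative of (1 - x)^(-k) is k / (1 - x) times the function itself; this is the
  recursion of \<open>exp_coeff\<close> with the cutoff removed.\<close>

lemma binom_coeff_Suc:
  "binom_coeff k (Suc m) = k / real (Suc m) * (\<Sum>j\<le>m. binom_coeff k (m - j))"
proof -
  have "(\<Sum>j\<le>m. binom_coeff k (m - j)) = (\<Sum>i\<le>m. binom_coeff k i)"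
    by (rule sum.nat_diff_reindex[of _ "Suc m", simplified lessThan_Suc_atMost, simplified])
  also have "\<dots> = binom_coeff (k + 1) m"
    by (rule sum_binom_coeff)
  finally show ?thesis
    by (simp add: pochhammer_rec divide_simps)
qed

text \<open>The cutoff \<open>j < J\<close> first takes effect in the step that produces index J +
  1.\<close>

lemma exp_coeff_eq_binom_coeff: "m \<le> J \<Longrightarrow> exp_coeff k J m = binom_coeff k m"
proof (induction m rule: less_induct)
  case (less m)
  show ?case
  proof (cases m)
    case (Suc n)
    have "(\<Sum>j\<in>{..n}. if j < J then exp_coeff k J (n - j) else 0) = (\<Sum>j\<le>n. binom_coeff k (n - j))"
      using less Suc by (intro sum.cong) auto
    then show ?thesis
      unfolding Suc binom_coeff_Suc by (simp add: exp_coeff.simps(2))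
  qed auto
qed

lemma binom_coeff_nonneg: "k \<ge> 0 \<Longrightarrow> binom_coeff k m \<ge> 0"
  by (simp add: pochhammer_prod prod_nonneg)

text \<open>Triangle inequality in the recursion. Filling in the terms lost to the cutoff can only
  enlarge the bound, since the coefficients for |k| are nonnegative.\<close>

lemma abs_exp_coeff_le: "\<bar>exp_coeff k J m\<bar> \<le> binom_coeff \<bar>k\<bar> m"
proof (induction m rule: less_induct)
  case (less m)
  show ?case
  proof (cases m)
    case (Suc n)
    have "\<bar>exp_coeff k J m\<bar> = \<bar>k\<bar> / real (Suc n) * \<bar>\<Sum>j\<in>{..n}. if j < J then exp_coeff k J (n - j) else 0\<bar>"
      unfolding Suc by (simp add: exp_coeff.simps(2) abs_mult)
    also have "\<dots> \<le> \<bar>k\<bar> / real (Suc n) * (\<Sum>j\<le>n. binom_coeff \<bar>k\<bar> (n - j))"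
      using less Suc by (intro mult_left_mono order_trans[OF sum_abs] sum_mono)
        (auto intro!: binom_coeff_nonneg)
    finally show ?thesis
      unfolding Suc binom_coeff_Suc .
  qed auto
qed

lemma binom_coeff_sums:
  assumes "\<bar>x\<bar> < 1"
  shows "(\<lambda>m. binom_coeff k m * x ^ m) sums (1 - x) powr (- k)"
  using gen_divisor_euler_factor[OF two_is_prime_nat assms, of k]
  by (simp add: gen_divisor_prime_power)

lemma exp_coeff_norm_summable:
  fixes x :: complex
  assumes "norm x < 1"
  shows "summable (\<lambda>m. norm (of_real (exp_coeff k J m) * x ^ m))"
proof (rule summable_comparison_test')
  show "summable (\<lambda>m. binom_coeff \<bar>k\<bar> m * norm x ^ m)"
    using binom_coeff_sums[of "norm x" "\<bar>k\<bar>"] assms by (simp add: sums_iff)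
  show "norm (norm (of_real (exp_coeff k J m) * x ^ m)) \<le> binom_coeff \<bar>k\<bar> m * norm x ^ m" if "m \<ge> 0" for m
    using mult_right_mono[OF abs_exp_coeff_le[of k J m], of "norm x ^ m"]
    by (simp add: norm_mult norm_power)
qed

text \<open>Multiplied by m + 1, the recursion exhibits the differentiated series as a Cauchy
  product with a finite geometric sum.\<close>

lemma exp_coeff_deriv:
  fixes x :: complex
  assumes "norm x < 1"
  shows "(\<Sum>m. diffs (\<lambda>m. of_real (exp_coeff k J m)) m * x ^ m) =
         of_real k * (\<Sum>j<J. x ^ j) * (\<Sum>m. of_real (exp_coeff k J m) * x ^ m)"
proof -
  let ?c = "\<lambda>m. of_real (exp_coeff k J m) :: complex"
  have "(\<Sum>j. (if j < J then x ^ j else 0)) * (\<Sum>m. ?c m * x ^ m) =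
        (\<Sum>m. \<Sum>j\<le>m. (if j < J then x ^ j else 0) * (?c (m - j) * x ^ (m - j)))"
  proof (rule Cauchy_product)
    show "summable (\<lambda>j. norm (if j < J then x ^ j else 0))"
      by (rule summable_finite[of "{..<J}"]) auto
    show "summable (\<lambda>m. norm (?c m * x ^ m))"
      by (rule exp_coeff_norm_summable[OF assms])
  qed
  also have "(\<Sum>j. (if j < J then x ^ j else 0)) = (\<Sum>j<J. x ^ j)"
    by (subst suminf_finite[of "{..<J}"]) auto
  finally have eq: "(\<Sum>j<J. x ^ j) * (\<Sum>m. ?c m * x ^ m) =
      (\<Sum>m. \<Sum>j\<le>m. (if j < J then x ^ j else 0) * (?c (m - j) * x ^ (m - j)))" .
  have summ: "summable (\<lambda>m. \<Sum>j\<le>m. (if j < J then x ^ j else 0) * (?c (m - j) * x ^ (m - j)))"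
  proof (rule summable_Cauchy_product)
    show "summable (\<lambda>j. norm (if j < J then x ^ j else 0))"
      by (rule summable_finite[of "{..<J}"]) auto
    show "summable (\<lambda>m. norm (?c m * x ^ m))"
      by (rule exp_coeff_norm_summable[OF assms])
  qed
  have "diffs ?c m * x ^ m =
      of_real k * (\<Sum>j\<le>m. (if j < J then x ^ j else 0) * (?c (m - j) * x ^ (m - j)))" for m
  proof -
    have "diffs ?c m = of_real k * of_real (\<Sum>j\<in>{..m}. if j < J then exp_coeff k J (m - j) else 0)"
      by (simp add: diffs_def exp_coeff.simps(2) del: of_nat_Suc)
    also have "\<dots> * x ^ m = of_real k * (\<Sum>j\<le>m. (if j < J then ?c (m - j) else 0) * x ^ m)"
      by (simp add: sum_distrib_right if_distrib mult.assoc cong: if_cong)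
    also have "(\<Sum>j\<le>m. (if j < J then ?c (m - j) else 0) * x ^ m) =
        (\<Sum>j\<le>m. (if j < J then x ^ j else 0) * (?c (m - j) * x ^ (m - j)))"
    proof (intro sum.cong refl)
      fix j assume "j \<in> {..m}"
      then have "x ^ m = x ^ j * x ^ (m - j)"
        by (simp flip: power_add)
      then show "(if j < J then ?c (m - j) else 0) * x ^ m =
          (if j < J then x ^ j else 0) * (?c (m - j) * x ^ (m - j))" by simp
    qed
    finally show ?thesis .
  qed
  then show ?thesis
    using suminf_mult[OF summ, of "of_real k"] by (simp add: eq mult.assoc)
qed

text \<open>Both sides solve the same linear differential equation: f e^(-q) has derivative 0 on the
  unit disc and the value 1 at its centre.\<close>

lemma exp_coeff_sum:
  fixes x :: complex
  assumes "norm x < 1"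
  shows "(\<Sum>m. of_real (exp_coeff k J m) * x ^ m) = exp (of_real k * (\<Sum>j=1..J. x ^ j / of_nat j))"
proof -
  let ?c = "\<lambda>m. of_real (exp_coeff k J m) :: complex"
  define f where "f = (\<lambda>x. \<Sum>m. ?c m * x ^ m)"
  define q where "q = (\<lambda>x::complex. of_real k * (\<Sum>j=1..J. x ^ j / of_nat j))"
  have f: "(f has_field_derivative (of_real k * (\<Sum>j<J. z ^ j) * f z)) (at z)" if "norm z < 1" for z
    unfolding f_def exp_coeff_deriv[OF that, symmetric]
    using that summable_norm_cancel[OF exp_coeff_norm_summable]
    by (intro termdiffs_strong'[of 1]) auto
  have q: "(q has_field_derivative (of_real k * (\<Sum>j<J. z ^ j))) (at z)" for z
  proof -
    have "(q has_field_derivative (of_real k * (\<Sum>j=1..J. of_nat j * z ^ (j - 1) / of_nat j))) (at z)"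
      unfolding q_def by (auto intro!: derivative_eq_intros sum.cong)
    also have "(\<Sum>j=1..J. of_nat j * z ^ (j - 1) / of_nat j) = (\<Sum>j=1..J. z ^ (j - 1))"
      by (intro sum.cong) auto
    also have "\<dots> = (\<Sum>j<J. z ^ j)"
      by (rule sum.reindex_bij_witness[of _ Suc "\<lambda>j. j - 1"]) auto
    finally show ?thesis .
  qed
  have "(\<lambda>z. f z * exp (- q z)) constant_on ball 0 1"
  proof (rule has_field_derivative_0_imp_constant_on)
    fix z :: complex assume "z \<in> ball 0 1"
    then have z: "norm z < 1" by simp
    show "((\<lambda>z. f z * exp (- q z)) has_field_derivative 0) (at z)"
      by (rule derivative_eq_intros f[OF z] q refl | simp)+
  qed auto
  then have "f x * exp (- q x) = f 0 * exp (- q 0)"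
    using assms unfolding constant_on_def by force
  also have "f 0 = 1" unfolding f_def by (subst powser_zero) simp
  also have "q 0 = 0" by (auto simp: q_def intro!: sum.neutral)
  finally have "f x = exp (q x)"
    by (simp add: exp_minus field_simps)
  then show ?thesis by (simp add: f_def q_def)
qed

section \<open>Comparison of the local factors\<close>

lemma abs_binom_coeff_le: "\<bar>binom_coeff k m\<bar> \<le> binom_coeff \<bar>k\<bar> m"
  using abs_exp_coeff_le[of k m m] exp_coeff_eq_binom_coeff[of m m k] by simp

lemma binom_coeff_square_le: "(binom_coeff k m)\<^sup>2 \<le> (binom_coeff \<bar>k\<bar> m)\<^sup>2"
  using power_mono[OF abs_binom_coeff_le[of k m], of 2] by (simp only: power2_abs abs_ge_zero)

lemma exp_coeff_square_le: "(exp_coeff k J m)\<^sup>2 \<le> (binom_coeff \<bar>k\<bar> m)\<^sup>2"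
  using power_mono[OF abs_exp_coeff_le[of k J m], of 2] by (simp only: power2_abs abs_ge_zero)

text \<open>With y = sqrt x the terms are squares of the terms of the binomial series at y, which
  are nonnegative and bounded by their own sum.\<close>

lemma binom_coeff_square_summable:
  assumes "0 \<le> x" "x < 1"
  shows "summable (\<lambda>m. (binom_coeff \<bar>k\<bar> m)\<^sup>2 * x ^ m)"
proof -
  define y where "y = sqrt x"
  have y: "0 \<le> y" "y < 1" "x = y\<^sup>2" using assms by (auto simp: y_def)
  define a where "a = (\<lambda>m. binom_coeff \<bar>k\<bar> m * y ^ m)"
  have a: "summable a" using binom_coeff_sums[of y "\<bar>k\<bar>"] y by (simp add: a_def sums_iff)
  have a0: "a m \<ge> 0" for m unfolding a_def using y binom_coeff_nonneg[of "\<bar>k\<bar>" m] by (intro mult_nonneg_nonneg) auto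
  have "a m \<le> suminf a" for m
    using sum_le_suminf[OF a, of "{m}"] a0 by simp
  then have "norm ((a m)\<^sup>2) \<le> suminf a * a m" for m
    using a0 by (auto simp: power2_eq_square intro: mult_right_mono)
  then have "summable (\<lambda>m. (a m)\<^sup>2)"
    by (intro summable_comparison_test'[OF summable_mult[OF a, of "suminf a"]])
  moreover have "(a m)\<^sup>2 = (binom_coeff \<bar>k\<bar> m)\<^sup>2 * x ^ m" for m
    by (simp add: a_def y(3) power_mult_distrib power_divide flip: power_mult) (simp add: mult.commute)
  ultimately show ?thesis by simp
qed

text \<open>In p^(-m), a quarter of the exponent pays for p^m > X and 3/2 for summability over p.
  This leaves p^(-3/4) for each power beyond the second, and p = 2 is the worst case.\<close>

definition tail_ratio :: real where "tail_ratio = 2 powr (-3/4)"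

definition square_tail_const :: "real \<Rightarrow> real" where
  "square_tail_const k = (\<Sum>m. (binom_coeff \<bar>k\<bar> m)\<^sup>2 * tail_ratio ^ m) / tail_ratio\<^sup>2"

lemma tail_ratio: "0 < tail_ratio" "tail_ratio < 1" "1/2 \<le> tail_ratio"
proof -
  show "0 < tail_ratio" by (simp add: tail_ratio_def)
  show "tail_ratio < 1" unfolding tail_ratio_def by (rule powr_less_one) auto
  have "(2::real) powr (-1) \<le> tail_ratio" unfolding tail_ratio_def by (rule powr_mono) auto
  then show "1/2 \<le> tail_ratio" by (simp add: powr_minus_divide)
qed

lemma square_tail_const_pos: "square_tail_const k > 0"
proof -
  have "0 < (\<Sum>m. (binom_coeff \<bar>k\<bar> m)\<^sup>2 * tail_ratio ^ m)"
    using tail_ratio by (intro suminf_pos2[of _ 0] binom_coeff_square_summable) auto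
  then show ?thesis using tail_ratio by (simp add: square_tail_const_def)
qed

text \<open>Applied to the difference of two local factors, whose coefficients agree for \<open>m < 2\<close>.\<close>

lemma square_tail_le:
  assumes "\<And>m. \<bar>d m\<bar> \<le> (binom_coeff \<bar>k\<bar> m)\<^sup>2" "d 0 = 0" "d 1 = 0"
    and "\<And>m. m \<ge> 2 \<Longrightarrow> d m \<noteq> 0 \<Longrightarrow> x ^ m \<le> K * tail_ratio ^ (m - 2)" "K \<ge> 0" "0 \<le> x" "x < 1"
  shows "summable (\<lambda>m. d m * x ^ m)" "\<bar>\<Sum>m. d m * x ^ m\<bar> \<le> K * square_tail_const k"
proof -
  have le: "norm (d m * x ^ m) \<le> K / tail_ratio\<^sup>2 * ((binom_coeff \<bar>k\<bar> m)\<^sup>2 * tail_ratio ^ m)" for m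
  proof (cases "d m = 0")
    case False
    then have "m \<noteq> 0" "m \<noteq> 1" using assms(2,3) by metis+
    then have m: "m \<ge> 2" by simp
    have "norm (d m * x ^ m) = \<bar>d m\<bar> * x ^ m" using assms by (simp add: abs_mult)
    also have "\<dots> \<le> (binom_coeff \<bar>k\<bar> m)\<^sup>2 * (K * tail_ratio ^ (m - 2))"
      using assms False m by (intro mult_mono) auto
    also have "tail_ratio ^ (m - 2) = tail_ratio ^ m / tail_ratio\<^sup>2"
      using tail_ratio m by (simp add: power_diff)
    finally show ?thesis by (simp add: mult_ac)
  qed (use assms tail_ratio in auto)
  have s: "summable (\<lambda>m. K / tail_ratio\<^sup>2 * ((binom_coeff \<bar>k\<bar> m)\<^sup>2 * tail_ratio ^ m))"
    using tail_ratio by (intro summable_mult binom_coeff_square_summable) auto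
  show "summable (\<lambda>m. d m * x ^ m)"
    by (rule summable_comparison_test'[OF s le])
  have sn: "summable (\<lambda>m. norm (d m * x ^ m))"
    by (rule summable_comparison_test'[OF s]) (use le in auto)
  have "norm (\<Sum>m. d m * x ^ m) \<le> (\<Sum>m. norm (d m * x ^ m))"
    by (rule summable_norm[OF sn])
  also have "\<dots> \<le> (\<Sum>m. K / tail_ratio\<^sup>2 * ((binom_coeff \<bar>k\<bar> m)\<^sup>2 * tail_ratio ^ m))"
    by (rule suminf_le[OF le sn s])
  also have "\<dots> = K * square_tail_const k"
    using tail_ratio by (subst suminf_mult) (auto intro!: binom_coeff_square_summable simp: square_tail_const_def)
  finally show "\<bar>\<Sum>m. d m * x ^ m\<bar> \<le> K * square_tail_const k" by simp
qed

text \<open>At x = p^(-2 sigma) this is the local factor of the series of d_k(n)^2 n^(-2 sigma);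
  \<open>exp_factor\<close> is its counterpart for the coefficients of P_X^k.\<close>

definition divisor_factor :: "real \<Rightarrow> real \<Rightarrow> real" where
  "divisor_factor k x = (\<Sum>m. (binom_coeff k m)\<^sup>2 * x ^ m)"

definition exp_factor :: "real \<Rightarrow> nat \<Rightarrow> real \<Rightarrow> real" where
  "exp_factor k J x = (\<Sum>m. (exp_coeff k J m)\<^sup>2 * x ^ m)"

lemma divisor_factor_summable:
  assumes "0 \<le> x" "x < 1"
  shows "summable (\<lambda>m. (binom_coeff k m)\<^sup>2 * x ^ m)"
proof (rule summable_comparison_test'[OF binom_coeff_square_summable[OF assms, of k]])
  show "norm ((binom_coeff k m)\<^sup>2 * x ^ m) \<le> (binom_coeff \<bar>k\<bar> m)\<^sup>2 * x ^ m" for m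
    using assms mult_right_mono[OF binom_coeff_square_le[of k m], of "x ^ m"] by simp
qed

lemma exp_factor_summable:
  assumes "0 \<le> x" "x < 1"
  shows "summable (\<lambda>m. (exp_coeff k J m)\<^sup>2 * x ^ m)"
proof (rule summable_comparison_test'[OF binom_coeff_square_summable[OF assms, of k]])
  show "norm ((exp_coeff k J m)\<^sup>2 * x ^ m) \<le> (binom_coeff \<bar>k\<bar> m)\<^sup>2 * x ^ m" for m
    using assms mult_right_mono[OF exp_coeff_square_le[of k J m], of "x ^ m"] by simp
qed

lemma divisor_factor_ge_1:
  assumes "0 \<le> x" "x < 1"
  shows "divisor_factor k x \<ge> 1"
  using sum_le_suminf[OF divisor_factor_summable[OF assms, of k], of "{0}"] assms
  by (simp add: divisor_factor_def)

lemma exp_factor_ge_1: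
  assumes "0 \<le> x" "x < 1"
  shows "exp_factor k J x \<ge> 1"
  using sum_le_suminf[OF exp_factor_summable[OF assms, of k J], of "{0}"] assms
  by (simp add: exp_factor_def)

text \<open>The coefficient of x is d_k(p)^2 = k^2, exactly what the factor (1 - x)^(k^2)
  cancels.\<close>

lemma divisor_factor_expansion:
  assumes "0 \<le> x" "x \<le> 1/2"
  shows "\<bar>divisor_factor k x - (1 + k\<^sup>2 * x)\<bar> \<le> square_tail_const k * x\<^sup>2"
proof -
  define d where "d = (\<lambda>m. if m < 2 then 0 else (binom_coeff k m)\<^sup>2)"
  have "\<bar>\<Sum>m. d m * x ^ m\<bar> \<le> x\<^sup>2 * square_tail_const k"
  proof (rule square_tail_le)
    show "\<bar>d m\<bar> \<le> (binom_coeff \<bar>k\<bar> m)\<^sup>2" for m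
      using binom_coeff_square_le[of k m] by (simp add: d_def)
    show "x ^ m \<le> x\<^sup>2 * tail_ratio ^ (m - 2)" if "m \<ge> 2" for m
    proof -
      have "x ^ m = x\<^sup>2 * x ^ (m - 2)" using that by (metis le_add_diff_inverse power_add)
      also have "\<dots> \<le> x\<^sup>2 * tail_ratio ^ (m - 2)"
        using assms tail_ratio by (intro mult_left_mono power_mono) auto
      finally show ?thesis .
    qed
  qed (use assms in \<open>auto simp: d_def\<close>)
  moreover have "divisor_factor k x = 1 + k\<^sup>2 * x + (\<Sum>m. d m * x ^ m)"
  proof -
    let ?f = "\<lambda>m. (binom_coeff k m)\<^sup>2 * x ^ m"
    have s: "summable ?f" using assms by (intro divisor_factor_summable) auto
    have "(\<lambda>m. if m \<in> {..<2} then ?f m else 0) sums (\<Sum>m<2. ?f m)"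
      by (rule sums_If_finite_set) auto
    from sums_diff[OF summable_sums[OF s] this]
    have "(\<lambda>m. d m * x ^ m) sums (divisor_factor k x - (\<Sum>m<2. ?f m))"
      unfolding divisor_factor_def by (rule sums_cong[THEN iffD1, rotated]) (auto simp: d_def)
    then show ?thesis by (simp add: sums_iff numeral_2_eq_2)
  qed
  ultimately show ?thesis by (simp add: mult.commute)
qed

lemma power_le_tail_ratio:
  assumes "p \<ge> 2" "0 \<le> x" "x \<le> 1 / real p" "X < real (p ^ m)" "m \<ge> 2" "X > 0"
  shows "x ^ m \<le> X powr (-1/4) * real p powr (-3/2) * tail_ratio ^ (m - 2)"
proof -
  have p: "real p > 0" using assms by simp
  have "x ^ m \<le> (1 / real p) ^ m" using assms by (intro power_mono)
  also have "\<dots> = real p powr (- real m)"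
    using p by (simp add: powr_minus_divide powr_realpow power_divide)
  also have "- real m = (real m * (-1/4)) + ((-3/2) + (-3/4) * real (m - 2))"
    using assms by (simp add: of_nat_diff field_simps)
  also have "real p powr \<dots> = (real p powr real m) powr (-1/4) * (real p powr (-3/2) * (real p powr (-3/4)) powr real (m - 2))"
    by (simp only: powr_add powr_powr)
  also have "\<dots> = (real (p ^ m)) powr (-1/4) * (real p powr (-3/2) * (real p powr (-3/4)) ^ (m - 2))"
    using p by (simp add: powr_realpow)
  also have "\<dots> \<le> X powr (-1/4) * (real p powr (-3/2) * tail_ratio ^ (m - 2))"
  proof (intro mult_mono power_mono)
    show "real (p ^ m) powr (-1/4) \<le> X powr (-1/4)" using assms by (intro powr_mono2') auto
    show "real p powr (-3/4) \<le> tail_ratio" unfolding tail_ratio_def using assms by (intro powr_mono2') auto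
  qed (use tail_ratio in auto)
  finally show ?thesis by (simp add: mult_ac)
qed

lemma abs_ln_diff_le:
  fixes a b :: real
  assumes "a \<ge> 1" "b \<ge> 1"
  shows "\<bar>ln a - ln b\<bar> \<le> \<bar>a - b\<bar>"
proof -
  have *: "ln a - ln b \<le> \<bar>a - b\<bar>" if "a \<ge> 1" "b \<ge> 1" for a b :: real
  proof -
    have "ln a - ln b = ln (a / b)" using that by (simp add: ln_div)
    also have "\<dots> \<le> a / b - 1" using that by (intro ln_le_minus_one) auto
    also have "\<dots> = (a - b) / b" using that by (simp add: diff_divide_distrib)
    also have "\<dots> \<le> \<bar>a - b\<bar> / 1" using that by (intro frac_le) auto
    finally show ?thesis by simp
  qed
  show ?thesis using *[of a b] *[of b a] assms by linarith
qed

text \<open>The coefficients agree up to index J, and beyond it p^m exceeds X. Both factors are at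
  least 1, so their logarithms differ by no more than they do themselves.\<close>

lemma ln_exp_factor_diff_le:
  assumes "p \<ge> 2" "0 \<le> x" "x \<le> 1 / real p" "X > 0" "J \<ge> 1" "X < real (p ^ Suc J)"
  shows "\<bar>ln (exp_factor k J x) - ln (divisor_factor k x)\<bar> \<le> square_tail_const k * X powr (-1/4) * real p powr (-3/2)"
proof -
  have "1 / real p < 1" using assms by simp
  then have x1: "x < 1" using assms by linarith
  define d where "d = (\<lambda>m. (exp_coeff k J m)\<^sup>2 - (binom_coeff k m)\<^sup>2)"
  have d0: "d m = 0" if "m \<le> J" for m
    using that by (simp add: d_def exp_coeff_eq_binom_coeff)
  have "\<bar>\<Sum>m. d m * x ^ m\<bar> \<le> (X powr (-1/4) * real p powr (-3/2)) * square_tail_const k"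
  proof (rule square_tail_le)
    show "\<bar>d m\<bar> \<le> (binom_coeff \<bar>k\<bar> m)\<^sup>2" for m
    proof -
      have "(binom_coeff k m)\<^sup>2 \<le> (binom_coeff \<bar>k\<bar> m)\<^sup>2"
        by (rule binom_coeff_square_le)
      moreover have "(exp_coeff k J m)\<^sup>2 \<le> (binom_coeff \<bar>k\<bar> m)\<^sup>2"
        by (rule exp_coeff_square_le)
      moreover have "(binom_coeff k m)\<^sup>2 \<ge> 0" "(exp_coeff k J m)\<^sup>2 \<ge> 0" by simp_all
      ultimately show ?thesis unfolding d_def by linarith
    qed
    show "x ^ m \<le> X powr (-1/4) * real p powr (-3/2) * tail_ratio ^ (m - 2)" if "m \<ge> 2" "d m \<noteq> 0" for m
    proof (rule power_le_tail_ratio)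
      have "Suc J \<le> m" using d0[of m] that by (metis not_less_eq_eq)
      then have "real (p ^ Suc J) \<le> real (p ^ m)"
        using assms(1) by (simp only: of_nat_le_iff) (rule power_increasing, auto)
      then show "X < real (p ^ m)" using assms by linarith
    qed (use assms that in auto)
  qed (use d0 assms x1 in auto)
  moreover have "exp_factor k J x - divisor_factor k x = (\<Sum>m. d m * x ^ m)"
    unfolding exp_factor_def divisor_factor_def d_def left_diff_distrib
    using assms x1 by (intro suminf_diff exp_factor_summable divisor_factor_summable)
  moreover have "\<bar>ln (exp_factor k J x) - ln (divisor_factor k x)\<bar> \<le> \<bar>exp_factor k J x - divisor_factor k x\<bar>"
    using assms x1 by (intro abs_ln_diff_le exp_factor_ge_1 divisor_factor_ge_1)
  ultimately show ?thesis by (simp add: mult_ac)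
qed

text \<open>The summands account for the tail of \<open>divisor_factor\<close>, for -log (1 - x) <=
  x + 2 x^2 taken k^2 times, and for the square lost in log (1 + y) >= y - y^2.\<close>

definition ln_factor_const :: "real \<Rightarrow> real" where
  "ln_factor_const k = square_tail_const k + 2 * k\<^sup>2 + (k\<^sup>2 + square_tail_const k)\<^sup>2"

lemma ln_factor_const_pos: "ln_factor_const k > 0"
  using square_tail_const_pos[of k] by (auto simp: ln_factor_const_def intro!: add_pos_nonneg)

text \<open>The linear terms cancel and O(x^2) remains, so the product over primes converges even at
  sigma = 1/2, where x = 1/p.\<close>

lemma ln_euler_factor_le:
  assumes "0 \<le> x" "x \<le> 1/2"
  shows "\<bar>k\<^sup>2 * ln (1 - x) + ln (divisor_factor k x)\<bar> \<le> ln_factor_const k * x\<^sup>2"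
proof -
  define K where "K = square_tail_const k"
  define y where "y = divisor_factor k x - 1"
  have K: "K > 0" unfolding K_def by (rule square_tail_const_pos)
  have y: "\<bar>y - k\<^sup>2 * x\<bar> \<le> K * x\<^sup>2"
    using divisor_factor_expansion[OF assms, of k] by (simp add: y_def K_def algebra_simps)
  have y0: "y \<ge> 0" unfolding y_def using divisor_factor_ge_1[of x k] assms by simp
  have xx: "x\<^sup>2 \<le> x" using assms by (simp add: power2_eq_square mult_left_le)
  have yle: "y \<le> (k\<^sup>2 + K) * x"
  proof -
    have "K * x\<^sup>2 \<le> K * x" using xx K by (intro mult_left_mono) auto
    then have "y \<le> k\<^sup>2 * x + K * x" using y by linarith
    then show ?thesis by (simp add: distrib_right)
  qed
  have "y\<^sup>2 \<le> ((k\<^sup>2 + K) * x)\<^sup>2" using y0 yle by (intro power_mono)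
  then have y2: "y\<^sup>2 \<le> (k\<^sup>2 + K)\<^sup>2 * x\<^sup>2" by (simp add: power_mult_distrib)
  have ln1: "ln (1 + y) \<le> y" using y0 by (rule ln_add_one_self_le_self)
  have ln2: "ln (1 + y) \<ge> y - y\<^sup>2"
  proof -
    have "ln (1 / (1 + y)) \<le> 1 / (1 + y) - 1" using y0 by (intro ln_le_minus_one) auto
    then have "ln (1 + y) \<ge> 1 - 1 / (1 + y)" using y0 by (simp add: ln_div)
    moreover have "y - y\<^sup>2 \<le> 1 - 1 / (1 + y)"
      using y0 by (simp add: field_simps power2_eq_square)
    ultimately show ?thesis by linarith
  qed
  note l = minus_ln_one_minus_bounds[OF assms]
  have l1: "k\<^sup>2 * ln (1 - x) \<le> - (k\<^sup>2 * x)" "k\<^sup>2 * ln (1 - x) \<ge> - (k\<^sup>2 * x) - 2 * k\<^sup>2 * x\<^sup>2"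
    using mult_left_mono[OF l(1), of "k\<^sup>2"] mult_left_mono[OF l(2), of "k\<^sup>2"] by (simp_all add: algebra_simps)
  have ff: "divisor_factor k x = 1 + y" by (simp add: y_def)
  have nn: "0 \<le> k\<^sup>2 * x\<^sup>2" "0 \<le> (k\<^sup>2 + K)\<^sup>2 * x\<^sup>2" "0 \<le> K * x\<^sup>2" using K by simp_all
  have e: "ln_factor_const k * x\<^sup>2 = K * x\<^sup>2 + 2 * k\<^sup>2 * x\<^sup>2 + (k\<^sup>2 + K)\<^sup>2 * x\<^sup>2"
    by (simp add: ln_factor_const_def K_def algebra_simps)
  show ?thesis
    unfolding ff e abs_le_iff using y y2 ln1 ln2 l1 nn by (simp add: abs_le_iff)
qed

section \<open>The product a(k, sigma) over all primes\<close>

lemma gen_divisor_term: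
  assumes "prime p"
  shows "(gen_divisor k (p ^ m))\<^sup>2 / real p powr (2 * real m * \<sigma>) =
         (binom_coeff k m)\<^sup>2 * (real p powr (- (2 * \<sigma>))) ^ m"
proof -
  have "real p powr (2 * real m * \<sigma>) = (real p powr (2 * \<sigma>)) powr real m"
    by (simp add: powr_powr mult_ac)
  also have "\<dots> = (real p powr (2 * \<sigma>)) ^ m"
    using prime_gt_0_nat[OF assms] by (intro powr_realpow) auto
  finally show ?thesis
    by (simp add: gen_divisor_prime_power[OF assms] powr_minus_divide power_divide)
qed

definition ln_euler_factor :: "real \<Rightarrow> real \<Rightarrow> nat \<Rightarrow> real" where
  "ln_euler_factor k \<sigma> p = (if prime p
     then k\<^sup>2 * ln (1 - real p powr (- (2 * \<sigma>))) + ln (divisor_factor k (real p powr (- (2 * \<sigma>)))) else 0)"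

lemma prime_powr_bounds:
  assumes "prime p" "\<sigma> \<ge> 1/2"
  defines "x \<equiv> real p powr (- (2 * \<sigma>))"
  shows "0 < x" "x \<le> 1 / real p" "x \<le> 1/2"
proof -
  have p: "real p \<ge> 2" using prime_ge_2_nat[OF assms(1)] by simp
  then show "0 < x" by (simp add: x_def)
  have "x \<le> real p powr (-1)" unfolding x_def using p assms(2) by (intro powr_mono) auto
  then show "x \<le> 1 / real p" using p by (simp add: powr_minus_divide)
  also have "\<dots> \<le> 1 / 2" using p by (intro divide_left_mono) auto
  finally show "x \<le> 1/2" .
qed

lemma inverse_square_le:
  assumes "0 < X" "X \<le> real n"
  shows "1 / (real n)\<^sup>2 \<le> X powr (-1/2) * real n powr (-3/2)"
proof -
  have "1 / (real n)\<^sup>2 = real n powr (-2)"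
    using assms by (simp add: powr_minus_divide powr_numeral)
  also have "\<dots> = real n powr (-1/2) * real n powr (-3/2)"
    by (simp flip: powr_add)
  also have "\<dots> \<le> X powr (-1/2) * real n powr (-3/2)"
    using assms by (intro mult_right_mono powr_mono2') auto
  finally show ?thesis .
qed

text \<open>Half a power of p is traded for X while p^(-3/2) remains summable. X = 1 yields
  convergence of the product, a general X the size of its tail.\<close>

lemma ln_euler_factor_bound:
  assumes "\<sigma> \<ge> 1/2" "X > 0" "prime p \<Longrightarrow> X \<le> real p"
  shows "\<bar>ln_euler_factor k \<sigma> p\<bar> \<le> ln_factor_const k * X powr (-1/2) * real p powr (-3/2)"
proof (cases "prime p")
  case True
  define x where "x = real p powr (- (2 * \<sigma>))"
  note x = prime_powr_bounds[OF True assms(1), folded x_def]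
  have "\<bar>ln_euler_factor k \<sigma> p\<bar> \<le> ln_factor_const k * x\<^sup>2"
    using ln_euler_factor_le[of x k] x True by (simp add: ln_euler_factor_def x_def)
  also have "\<dots> \<le> ln_factor_const k * (1 / real p)\<^sup>2"
    using x ln_factor_const_pos[of k] by (intro mult_left_mono power_mono) auto
  also have "\<dots> \<le> ln_factor_const k * (X powr (-1/2) * real p powr (-3/2))"
    using inverse_square_le[OF assms(2) assms(3)[OF True]] ln_factor_const_pos[of k]
    by (intro mult_left_mono) (auto simp: power_divide)
  finally show ?thesis by simp
qed (use ln_factor_const_pos[of k] in \<open>auto simp: ln_euler_factor_def\<close>)

lemma ln_euler_factor_summable:
  assumes "\<sigma> \<ge> 1/2"
  shows "summable (ln_euler_factor k \<sigma>)"
proof (rule summable_comparison_test'[OF summable_mult[OF summable_powr_three_halves]])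
  show "norm (ln_euler_factor k \<sigma> p) \<le> ln_factor_const k * real p powr (-3/2)" for p
    using ln_euler_factor_bound[OF assms, of 1 p k] prime_ge_1_nat[of p] by simp
qed

text \<open>Exponentials never vanish and neither does the limit, so the index from which factors
  are counted can be 0.\<close>

lemma has_prod_exp_suminf:
  fixes h :: "nat \<Rightarrow> real"
  assumes "summable h"
  shows "(\<lambda>n. exp (h n)) has_prod exp (suminf h)"
proof -
  have "(\<lambda>n. exp (\<Sum>i\<le>n. h i)) \<longlonglongrightarrow> exp (suminf h)"
    using summable_LIMSEQ'[OF assms] by (rule tendsto_exp)
  then have "raw_has_prod (\<lambda>n. exp (h n)) 0 (exp (suminf h))"
    by (simp add: raw_has_prod_def exp_sum)
  then show ?thesis by (simp add: has_prod_def)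
qed

text \<open>\<open>prodinf\<close> is a definite description; convergence of the logarithms
  identifies it with the actual value of the product.\<close>

lemma a_const_eq:
  assumes "\<sigma> \<ge> 1/2"
  shows "a_const k \<sigma> = exp (suminf (ln_euler_factor k \<sigma>))"
proof -
  have "(if prime p
      then (1 - 1 / real p powr (2 * \<sigma>)) powr (k\<^sup>2) *
           (\<Sum>m. (gen_divisor k (p ^ m))\<^sup>2 / real p powr (2 * real m * \<sigma>))
      else 1) = exp (ln_euler_factor k \<sigma> p)" for p :: nat
  proof (cases "prime p")
    case True
    define x where "x = real p powr (- (2 * \<sigma>))"
    note x = prime_powr_bounds[OF True assms, folded x_def]
    have "(\<Sum>m. (gen_divisor k (p ^ m))\<^sup>2 / real p powr (2 * real m * \<sigma>)) = divisor_factor k x"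
      unfolding divisor_factor_def x_def by (simp add: gen_divisor_term[OF True])
    moreover have "1 / real p powr (2 * \<sigma>) = x" by (simp add: x_def powr_minus_divide)
    moreover have "divisor_factor k x \<ge> 1" using x by (intro divisor_factor_ge_1) auto
    moreover have "(1 - x) powr k\<^sup>2 = exp (k\<^sup>2 * ln (1 - x))" using x by (simp add: powr_def)
    moreover have "ln_euler_factor k \<sigma> p = k\<^sup>2 * ln (1 - x) + ln (divisor_factor k x)"
      using True by (simp add: ln_euler_factor_def x_def)
    ultimately show ?thesis
      using True by (simp add: exp_add)
  qed (simp add: ln_euler_factor_def)
  then have "a_const k \<sigma> = prodinf (\<lambda>p. exp (ln_euler_factor k \<sigma> p))"
    unfolding a_const_def by simp
  also have "\<dots> = exp (suminf (ln_euler_factor k \<sigma>))"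
    using has_prod_unique[OF has_prod_exp_suminf[OF ln_euler_factor_summable[OF assms]]] by simp
  finally show ?thesis .
qed

definition three_halves_sum :: real where
  "three_halves_sum = (\<Sum>n. real n powr (-3/2))"

lemma sum_three_halves_le: "finite A \<Longrightarrow> (\<Sum>n\<in>A. real n powr (-3/2)) \<le> three_halves_sum"
  unfolding three_halves_sum_def by (intro sum_le_suminf summable_powr_three_halves) auto

lemma three_halves_sum_nonneg: "three_halves_sum \<ge> 0"
  using sum_three_halves_le[of "{}"] by simp

lemma euler_factors_partial:
  assumes "\<sigma> \<ge> 1/2" "X > 0"
  shows "\<bar>(\<Sum>p | prime p \<and> real p \<le> X. ln_euler_factor k \<sigma> p) - suminf (ln_euler_factor k \<sigma>)\<bar>
           \<le> ln_factor_const k * three_halves_sum * X powr (-1/2)"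
proof -
  let ?h = "ln_euler_factor k \<sigma>"
  define P where "P = {p::nat. prime p \<and> real p \<le> X}"
  have "(\<lambda>p. if p \<in> P then ?h p else 0) sums (\<Sum>p\<in>P. ?h p)"
    by (rule sums_If_finite_set) (simp add: P_def)
  from sums_diff[OF summable_sums[OF ln_euler_factor_summable[OF assms(1), of k]] this]
  have s: "(\<lambda>p. ?h p - (if p \<in> P then ?h p else 0)) sums (suminf ?h - (\<Sum>p\<in>P. ?h p))" .
  let ?b = "\<lambda>p. ln_factor_const k * X powr (-1/2) * real p powr (-3/2)"
  have b: "?b sums (ln_factor_const k * X powr (-1/2) * three_halves_sum)"
    unfolding three_halves_sum_def by (intro sums_mult summable_sums summable_powr_three_halves)
  have le: "\<bar>?h p - (if p \<in> P then ?h p else 0)\<bar> \<le> ?b p" for p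
  proof (cases "prime p \<and> real p > X")
    case True
    then show ?thesis using ln_euler_factor_bound[OF assms(1,2), of p k] by (simp add: P_def)
  next
    case False
    then have "?h p - (if p \<in> P then ?h p else 0) = 0"
      by (auto simp: P_def ln_euler_factor_def)
    then show ?thesis using ln_factor_const_pos[of k] by simp
  qed
  have "suminf ?h - (\<Sum>p\<in>P. ?h p) \<le> ln_factor_const k * X powr (-1/2) * three_halves_sum"
    by (rule sums_le[OF _ s b]) (use le in \<open>auto simp: abs_le_iff\<close>)
  moreover have "- (suminf ?h - (\<Sum>p\<in>P. ?h p)) \<le> ln_factor_const k * X powr (-1/2) * three_halves_sum"
    by (rule sums_le[OF _ sums_minus[OF s] b]) (use le in \<open>auto simp: abs_le_iff\<close>)
  ultimately show ?thesis by (simp add: P_def abs_le_iff mult_ac)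
qed

section \<open>Assembly of the diagonal term\<close>

lemma ln_le_powr_quarter:
  assumes "X \<ge> (1::real)"
  shows "ln X \<le> 4 * X powr (1/4)"
proof -
  have "ln (X powr (1/4)) \<le> X powr (1/4)"
    using assms by (intro less_imp_le[OF ln_less_self]) auto
  then show ?thesis using assms by (simp add: ln_powr)
qed

lemma prime_exponent_bounds:
  assumes "prime p" "real p \<le> X"
  shows "prime_exponent X p \<ge> 1" "X < real (p ^ Suc (prime_exponent X p))"
proof -
  have "X \<ge> 1" "p > 1" using assms prime_gt_1_nat[of p] by auto
  then show "prime_exponent X p \<ge> 1" using assms by (subst le_prime_exponent_iff) auto
  show "X < real (p ^ Suc (prime_exponent X p))"
    using le_prime_exponent_iff[OF \<open>p > 1\<close> \<open>X \<ge> 1\<close>, of "Suc (prime_exponent X p)"] by simp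
qed

text \<open>After taking logarithms the product splits into a partial sum for a(k, sigma) and k^2
  times \<open>prime_log_sum\<close>. Leaving the error in the exponent makes it relative to the
  main term, whatever the size of that term.\<close>

lemma exp_factor_product_asymp:
  obtains C where "C > 0"
    "\<And>\<sigma> X. \<sigma> \<ge> 1/2 \<Longrightarrow> X \<ge> 2 \<Longrightarrow>
       \<exists>\<theta>. \<bar>\<theta>\<bar> \<le> C / ln X \<and>
         (\<Prod>p | prime p \<and> real p \<le> X. exp_factor k (prime_exponent X p) (real p powr (- (2 * \<sigma>)))) =
         a_const k \<sigma> * F_X X k \<sigma> * exp \<theta>"
proof -
  obtain C where C: "C > 0"
    "\<And>\<sigma> X. \<sigma> \<ge> 1/2 \<Longrightarrow> X \<ge> 2 \<Longrightarrow>
       \<exists>\<Phi>. F_X X k \<sigma> = exp (k\<^sup>2 * \<Phi>) \<and> \<bar>prime_log_sum X (2 * \<sigma>) - \<Phi>\<bar> \<le> C / ln X"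
    using F_X_asymp[of k] by blast
  define K where "K = (square_tail_const k + ln_factor_const k) * three_halves_sum"
  have K: "K \<ge> 0" unfolding K_def
    using square_tail_const_pos[of k] ln_factor_const_pos[of k] three_halves_sum_nonneg by simp
  \<comment> \<open>4 K comes from X^(-1/4) <= 4 / log X and k^2 C from the comparison with
    \<open>F_X\<close>; the 1 secures strict positivity for every k.\<close>
  show ?thesis
  proof (rule that[of "4 * K + k\<^sup>2 * C + 1"])
    show "4 * K + k\<^sup>2 * C + 1 > 0" using K C by (simp add: add_nonneg_pos)
    fix \<sigma> X :: real assume asm: "\<sigma> \<ge> 1/2" "X \<ge> 2"
    obtain \<Phi> where \<Phi>: "F_X X k \<sigma> = exp (k\<^sup>2 * \<Phi>)" "\<bar>prime_log_sum X (2 * \<sigma>) - \<Phi>\<bar> \<le> C / ln X"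
      using C(2)[OF asm] by blast
    define P where "P = {p::nat. prime p \<and> real p \<le> X}"
    have finP: "finite P" by (simp add: P_def)
    define x where "x = (\<lambda>p::nat. real p powr (- (2 * \<sigma>)))"
    have x: "0 < x p" "x p \<le> 1 / real p" "x p \<le> 1/2" if "p \<in> P" for p
      using prime_powr_bounds[of p \<sigma>] that asm unfolding x_def P_def by blast+
    let ?B = "\<lambda>p. exp_factor k (prime_exponent X p) (x p)"
    let ?A = "\<lambda>p. divisor_factor k (x p)"
    have Bpos: "?B p \<ge> 1" if "p \<in> P" for p
      using x[OF that] by (intro exp_factor_ge_1) auto
    define L where "L = (\<Sum>p\<in>P. ln (?B p))"
    have "(\<Prod>p\<in>P. ?B p) = exp L"
      unfolding L_def exp_sum[OF finP] using Bpos by (intro prod.cong) (auto simp: less_le_trans[OF zero_less_one])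
    have 1: "\<bar>L - (\<Sum>p\<in>P. ln (?A p))\<bar> \<le> square_tail_const k * three_halves_sum * X powr (-1/4)"
    proof -
      have "\<bar>L - (\<Sum>p\<in>P. ln (?A p))\<bar> \<le> (\<Sum>p\<in>P. \<bar>ln (?B p) - ln (?A p)\<bar>)"
        unfolding L_def sum_subtractf[symmetric] by (rule sum_abs)
      also have "\<dots> \<le> (\<Sum>p\<in>P. square_tail_const k * X powr (-1/4) * real p powr (-3/2))"
      proof (rule sum_mono)
        fix p assume p: "p \<in> P"
        then have "prime p" "real p \<le> X" by (auto simp: P_def)
        then show "\<bar>ln (?B p) - ln (?A p)\<bar> \<le> square_tail_const k * X powr (-1/4) * real p powr (-3/2)"
          using x[OF p] asm prime_ge_2_nat[of p] by (intro ln_exp_factor_diff_le prime_exponent_bounds) auto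
      qed
      also have "\<dots> \<le> square_tail_const k * X powr (-1/4) * three_halves_sum"
        unfolding sum_distrib_left[symmetric] using square_tail_const_pos[of k] finP
        by (intro mult_left_mono sum_three_halves_le) auto
      finally show ?thesis by (simp add: mult_ac)
    qed
    have 2: "(\<Sum>p\<in>P. ln (?A p)) = (\<Sum>p\<in>P. ln_euler_factor k \<sigma> p) + k\<^sup>2 * prime_log_sum X (2 * \<sigma>)"
      unfolding prime_log_sum_def P_def[symmetric] sum_distrib_left sum.distrib[symmetric]
      by (intro sum.cong) (auto simp: ln_euler_factor_def P_def x_def)
    have 3: "\<bar>(\<Sum>p\<in>P. ln_euler_factor k \<sigma> p) - suminf (ln_euler_factor k \<sigma>)\<bar> \<le> ln_factor_const k * three_halves_sum * X powr (-1/4)"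
    proof -
      have "X powr (-1/2) \<le> X powr (-1/4)" using asm by (intro powr_mono) auto
      then have "ln_factor_const k * three_halves_sum * X powr (-1/2) \<le> ln_factor_const k * three_halves_sum * X powr (-1/4)"
        using ln_factor_const_pos[of k] three_halves_sum_nonneg by (intro mult_left_mono) auto
      then show ?thesis using euler_factors_partial[OF asm(1), of X k] asm by (simp add: P_def)
    qed
    define \<theta> where "\<theta> = L - (suminf (ln_euler_factor k \<sigma>) + k\<^sup>2 * \<Phi>)"
    have "\<bar>k\<^sup>2 * prime_log_sum X (2 * \<sigma>) - k\<^sup>2 * \<Phi>\<bar> = k\<^sup>2 * \<bar>prime_log_sum X (2 * \<sigma>) - \<Phi>\<bar>"
      by (simp add: abs_mult flip: right_diff_distrib)
    also have "\<dots> \<le> k\<^sup>2 * (C / ln X)" using \<Phi>(2) by (intro mult_left_mono) auto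
    finally have 4: "\<bar>k\<^sup>2 * prime_log_sum X (2 * \<sigma>) - k\<^sup>2 * \<Phi>\<bar> \<le> k\<^sup>2 * (C / ln X)" .
    have "\<bar>\<theta>\<bar> \<le> square_tail_const k * three_halves_sum * X powr (-1/4) + ln_factor_const k * three_halves_sum * X powr (-1/4) + k\<^sup>2 * (C / ln X)"
      unfolding \<theta>_def using 1 2 3 4 by linarith
    also have "\<dots> = K * X powr (-1/4) + k\<^sup>2 * C / ln X" by (simp add: K_def algebra_simps)
    also have "\<dots> \<le> K * (4 / ln X) + k\<^sup>2 * C / ln X"
    proof (intro add_right_mono mult_left_mono K)
      have "X powr (-1/4) = 1 / X powr (1/4)" by (simp add: powr_minus_divide)
      also have "\<dots> \<le> 4 / ln X"
        using ln_le_powr_quarter[of X] asm by (simp add: field_simps)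
      finally show "X powr (-1/4) \<le> 4 / ln X" .
    qed
    also have "\<dots> \<le> (4 * K + k\<^sup>2 * C + 1) / ln X"
      using asm by (simp add: add_divide_distrib mult.commute)
    finally have "\<bar>\<theta>\<bar> \<le> (4 * K + k\<^sup>2 * C + 1) / ln X" .
    moreover have "(\<Prod>p\<in>P. ?B p) = a_const k \<sigma> * F_X X k \<sigma> * exp \<theta>"
      unfolding \<open>(\<Prod>p\<in>P. ?B p) = exp L\<close> \<Phi>(1) a_const_eq[OF asm(1)] exp_add[symmetric]
      by (simp add: \<theta>_def)
    ultimately show "\<exists>\<theta>. \<bar>\<theta>\<bar> \<le> (4 * K + k\<^sup>2 * C + 1) / ln X \<and>
         (\<Prod>p | prime p \<and> real p \<le> X. exp_factor k (prime_exponent X p) (real p powr (- (2 * \<sigma>)))) =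
         a_const k \<sigma> * F_X X k \<sigma> * exp \<theta>"
      by (auto simp: P_def x_def)
  qed
qed

section \<open>Mean squares of Dirichlet series\<close>

lemma norm_integral_cis_le:
  fixes T l :: real
  assumes "T > 0" "l \<noteq> 0"
  shows "norm (integral {T..2 * T} (\<lambda>t. cis (l * t))) \<le> 2 / \<bar>l\<bar>"
    and "norm (integral {T..2 * T} (\<lambda>t. cis (l * t))) \<le> T"
proof -
  have "((\<lambda>t. cis (l * t)) has_integral (cis (l * (2 * T)) / (\<i> * l) - cis (l * T) / (\<i> * l))) {T..2 * T}"
    using assms by (intro fundamental_theorem_of_calculus)
      (auto simp: cis_conv_exp field_simps intro!: derivative_eq_intros has_vector_derivative_real_field)
  then have "norm (integral {T..2 * T} (\<lambda>t. cis (l * t))) = norm (cis (l * (2 * T)) / (\<i> * l) - cis (l * T) / (\<i> * l))"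
    by (simp add: integral_unique)
  also have "\<dots> \<le> norm (cis (l * (2 * T)) / (\<i> * l)) + norm (cis (l * T) / (\<i> * l))"
    by (rule norm_triangle_ineq4)
  also have "\<dots> = 2 / \<bar>l\<bar>"
    by (simp add: norm_divide norm_mult)
  finally show "norm (integral {T..2 * T} (\<lambda>t. cis (l * t))) \<le> 2 / \<bar>l\<bar>" .
  have "norm (integral {T..2 * T} (\<lambda>t. cis (l * t))) \<le> 1 * (2 * T - T)"
    using assms by (intro integral_bound continuous_intros) auto
  then show "norm (integral {T..2 * T} (\<lambda>t. cis (l * t))) \<le> T" by simp
qed

text \<open>Distinct integers differ by at least 1. The bound is stated with the product mn because
  it then factors over the two indices.\<close>

lemma abs_ln_diff_ge:
  assumes "m > 0" "n > 0" "m \<noteq> (n::nat)"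
  shows "\<bar>ln (real m) - ln (real n)\<bar> \<ge> 1 / (real m * real n)"
proof -
  have *: "ln (real m) - ln (real n) \<ge> 1 / (real m * real n)" if "n < m" "n > 0" for m n :: nat
  proof -
    have "real n \<ge> 1" "real m \<ge> real n + 1" using that by linarith+
    have "1 / (real m * real n) \<le> 1 / real m"
      using that \<open>real n \<ge> 1\<close> by (intro divide_left_mono) auto
    also have "\<dots> \<le> (real m - real n) / real m"
      using \<open>real m \<ge> real n + 1\<close> by (intro divide_right_mono) auto
    also have "\<dots> = 1 - real n / real m"
      using that by (simp add: diff_divide_distrib)
    also have "\<dots> \<le> - ln (real n / real m)"
      using ln_le_minus_one[of "real n / real m"] that by simp
    also have "\<dots> = ln (real m) - ln (real n)"
      using that by (simp add: ln_div)
    finally show ?thesis .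
  qed
  show ?thesis
    using *[of n m] *[of m n] assms by (cases "n < m") (auto simp: mult.commute)
qed

text \<open>Interpolates between the trivial bound and the bound from oscillation; the power is
  multiplicative, which later turns a double sum into a square.\<close>

lemma min_one_le_powr:
  fixes y \<eta> :: real
  assumes "y > 0" "0 < \<eta>" "\<eta> \<le> 1"
  shows "min 1 y \<le> y powr \<eta>"
proof (cases "y \<le> 1")
  case True
  then have "y powr 1 \<le> y powr \<eta>" using assms by (intro powr_mono') auto
  then show ?thesis using assms True by simp
next
  case False
  then show ?thesis using assms by (simp add: ge_one_powr_ge_zero)
qed

lemma norm_mean_cis_le:
  assumes "T > 0" "m > 0" "n > 0" "m \<noteq> (n::nat)" "0 < \<eta>" "\<eta> \<le> 1"
  shows "norm (complex_of_real (1 / T) * integral {T..2 * T} (\<lambda>t. cis ((ln (real m) - ln (real n)) * t)))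
           \<le> (2 / T) powr \<eta> * (real m powr \<eta> * real n powr \<eta>)"
proof -
  let ?l = "ln (real m) - ln (real n)"
  let ?I = "norm (integral {T..2 * T} (\<lambda>t. cis (?l * t)))"
  have l: "\<bar>?l\<bar> \<ge> 1 / (real m * real n)" using assms by (intro abs_ln_diff_ge)
  have pos: "real m * real n > 0" using assms by simp
  then have l0: "?l \<noteq> 0" using l by (metis abs_zero divide_pos_pos not_le zero_less_one)
  have "?I \<le> 2 / \<bar>?l\<bar>" using assms l0 by (intro norm_integral_cis_le)
  also have "\<dots> \<le> 2 / (1 / (real m * real n))"
    using l pos l0 by (intro divide_left_mono) (auto simp: zero_less_mult_iff)
  finally have "?I / T \<le> 2 / T * (real m * real n)"
    using assms by (simp add: field_simps)
  moreover have "?I / T \<le> 1"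
    using norm_integral_cis_le(2)[OF assms(1) l0] assms by simp
  ultimately have "?I / T \<le> min 1 (2 / T * (real m * real n))" by simp
  also have "\<dots> \<le> (2 / T * (real m * real n)) powr \<eta>"
    using assms pos by (intro min_one_le_powr) auto
  also have "\<dots> = (2 / T) powr \<eta> * (real m powr \<eta> * real n powr \<eta>)"
    using assms by (simp add: powr_mult del: times_divide_eq_left times_divide_eq_right)
  finally show ?thesis using assms by (simp add: norm_mult norm_divide)
qed

text \<open>In the expanded square equal indices have mean exactly 1, and injectivity of
  \<open>\<nu>\<close> makes every other pair oscillate.\<close>

lemma mean_square_finite:
  fixes c :: "'a \<Rightarrow> real" and \<nu> :: "'a \<Rightarrow> nat"
  assumes "finite F" "inj_on \<nu> F" "\<And>g. g \<in> F \<Longrightarrow> \<nu> g > 0" "T > 0" "0 < \<eta>" "\<eta> \<le> 1"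
  shows "\<bar>1 / T * integral {T..2 * T} (\<lambda>t. (norm (\<Sum>g\<in>F. c g * cis (- ln (real (\<nu> g)) * t)))\<^sup>2) - (\<Sum>g\<in>F. (c g)\<^sup>2)\<bar>
           \<le> (2 / T) powr \<eta> * (\<Sum>g\<in>F. \<bar>c g\<bar> * real (\<nu> g) powr \<eta>)\<^sup>2"
proof -
  define f where "f = (\<lambda>t. \<Sum>g\<in>F. c g * cis (- ln (real (\<nu> g)) * t))"
  define I where "I = (\<lambda>g h. 1 / T * integral {T..2 * T} (\<lambda>t. cis ((ln (real (\<nu> h)) - ln (real (\<nu> g))) * t)))"
  have sq: "complex_of_real ((norm (f t))\<^sup>2) =
      (\<Sum>g\<in>F. \<Sum>h\<in>F. of_real (c g * c h) * cis ((ln (real (\<nu> h)) - ln (real (\<nu> g))) * t))" for t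
  proof -
    have "complex_of_real ((norm (f t))\<^sup>2) = f t * cnj (f t)"
      by (rule complex_norm_square)
    also have "cnj (f t) = (\<Sum>h\<in>F. c h * cis (ln (real (\<nu> h)) * t))"
      by (simp add: f_def cis_cnj)
    also have "f t * \<dots> = (\<Sum>g\<in>F. \<Sum>h\<in>F. (c g * cis (- ln (real (\<nu> g)) * t)) * (c h * cis (ln (real (\<nu> h)) * t)))"
      by (simp add: f_def sum_product)
    also have "\<dots> = (\<Sum>g\<in>F. \<Sum>h\<in>F. of_real (c g * c h) * cis ((ln (real (\<nu> h)) - ln (real (\<nu> g))) * t))"
    proof (intro sum.cong refl)
      fix g h
      have "cis ((ln (real (\<nu> h)) - ln (real (\<nu> g))) * t) =
            cis (- ln (real (\<nu> g)) * t) * cis (ln (real (\<nu> h)) * t)"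
        by (simp add: cis_mult algebra_simps)
      then show "(c g * cis (- ln (real (\<nu> g)) * t)) * (c h * cis (ln (real (\<nu> h)) * t)) =
          of_real (c g * c h) * cis ((ln (real (\<nu> h)) - ln (real (\<nu> g))) * t)"
        by simp
    qed
    finally show ?thesis .
  qed
  have cont: "continuous_on A f" for A
    unfolding f_def by (intro continuous_intros)
  have "((\<lambda>t. (norm (f t))\<^sup>2) has_integral integral {T..2 * T} (\<lambda>t. (norm (f t))\<^sup>2)) {T..2 * T}"
    by (intro integrable_integral integrable_continuous_interval continuous_intros cont)
  then have 1: "((\<lambda>t. complex_of_real ((norm (f t))\<^sup>2)) has_integral
      of_real (integral {T..2 * T} (\<lambda>t. (norm (f t))\<^sup>2))) {T..2 * T}"
    by (rule has_integral_of_real)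
  have 2: "((\<lambda>t. complex_of_real ((norm (f t))\<^sup>2)) has_integral
      (\<Sum>g\<in>F. \<Sum>h\<in>F. of_real (c g * c h) *
        integral {T..2 * T} (\<lambda>t. cis ((ln (real (\<nu> h)) - ln (real (\<nu> g))) * t)))) {T..2 * T}"
    unfolding sq
    by (intro has_integral_sum has_integral_mult_right assms(1) integrable_integral
          integrable_continuous_interval continuous_intros)
  have "complex_of_real (1 / T * integral {T..2 * T} (\<lambda>t. (norm (f t))\<^sup>2)) =
      complex_of_real (1 / T) * complex_of_real (integral {T..2 * T} (\<lambda>t. (norm (f t))\<^sup>2))" by simp
  also have "\<dots> = 1 / T * (\<Sum>g\<in>F. \<Sum>h\<in>F. of_real (c g * c h) *
        integral {T..2 * T} (\<lambda>t. cis ((ln (real (\<nu> h)) - ln (real (\<nu> g))) * t)))"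
    using has_integral_unique[OF 1 2] by (rule arg_cong)
  also have "\<dots> = (\<Sum>g\<in>F. \<Sum>h\<in>F. 1 / T * (of_real (c g * c h) *
        integral {T..2 * T} (\<lambda>t. cis ((ln (real (\<nu> h)) - ln (real (\<nu> g))) * t))))"
    by (simp only: sum_distrib_left)
  also have "\<dots> = (\<Sum>g\<in>F. \<Sum>h\<in>F. of_real (c g * c h) * I g h)"
    unfolding I_def by (simp only: mult_ac)
  also have "\<dots> = (\<Sum>g\<in>F. of_real ((c g)\<^sup>2) + (\<Sum>h\<in>F - {g}. of_real (c g * c h) * I g h))"
  proof (intro sum.cong refl)
    fix g assume "g \<in> F"
    have "I g g = 1" using assms(4) by (simp add: I_def scaleR_conv_of_real)
    then show "(\<Sum>h\<in>F. of_real (c g * c h) * I g h) =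
        of_real ((c g)\<^sup>2) + (\<Sum>h\<in>F - {g}. of_real (c g * c h) * I g h)"
      using assms(1) \<open>g \<in> F\<close> by (simp add: sum.remove power2_eq_square)
  qed
  finally have eq: "complex_of_real (1 / T * integral {T..2 * T} (\<lambda>t. (norm (f t))\<^sup>2) - (\<Sum>g\<in>F. (c g)\<^sup>2)) =
      (\<Sum>g\<in>F. \<Sum>h\<in>F - {g}. of_real (c g * c h) * I g h)"
    by (simp add: sum.distrib)
  have "\<bar>1 / T * integral {T..2 * T} (\<lambda>t. (norm (f t))\<^sup>2) - (\<Sum>g\<in>F. (c g)\<^sup>2)\<bar> =
      norm (\<Sum>g\<in>F. \<Sum>h\<in>F - {g}. of_real (c g * c h) * I g h)"
    unfolding eq[symmetric] by (simp only: norm_of_real)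
  also have "\<dots> \<le> (\<Sum>g\<in>F. \<Sum>h\<in>F - {g}. \<bar>c g\<bar> * \<bar>c h\<bar> * ((2 / T) powr \<eta> * (real (\<nu> h) powr \<eta> * real (\<nu> g) powr \<eta>)))"
  proof (intro order_trans[OF norm_sum] sum_mono)
    fix g h assume gh: "g \<in> F" "h \<in> F - {g}"
    then have "\<nu> h \<noteq> \<nu> g" using assms(2) by (auto dest: inj_onD)
    then have "norm (I g h) \<le> (2 / T) powr \<eta> * (real (\<nu> h) powr \<eta> * real (\<nu> g) powr \<eta>)"
      unfolding I_def using assms gh by (intro norm_mean_cis_le) auto
    then show "norm (of_real (c g * c h) * I g h) \<le> \<bar>c g\<bar> * \<bar>c h\<bar> * ((2 / T) powr \<eta> * (real (\<nu> h) powr \<eta> * real (\<nu> g) powr \<eta>))"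
      by (simp add: norm_mult abs_mult mult_left_mono)
  qed
  \<comment> \<open>Restoring the nonnegative diagonal terms completes the double sum to a
    square.\<close>
  also have "\<dots> \<le> (\<Sum>g\<in>F. \<Sum>h\<in>F. \<bar>c g\<bar> * \<bar>c h\<bar> * ((2 / T) powr \<eta> * (real (\<nu> h) powr \<eta> * real (\<nu> g) powr \<eta>)))"
    using assms(1) by (intro sum_mono sum_mono2) auto
  also have "\<dots> = (\<Sum>g\<in>F. \<Sum>h\<in>F. (2 / T) powr \<eta> * ((\<bar>c g\<bar> * real (\<nu> g) powr \<eta>) * (\<bar>c h\<bar> * real (\<nu> h) powr \<eta>)))"
    by (intro sum.cong refl) (simp only: mult_ac)
  also have "\<dots> = (2 / T) powr \<eta> * (\<Sum>g\<in>F. \<bar>c g\<bar> * real (\<nu> g) powr \<eta>)\<^sup>2"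
    unfolding power2_eq_square sum_product by (simp only: sum_distrib_left)
  finally show ?thesis by (simp add: f_def)
qed

text \<open>Absolute convergence is uniform in t, so finite sections approximate both the integral
  and the diagonal, while one off-diagonal bound holds for all sections.\<close>

lemma mean_square_infinite:
  fixes c :: "'a \<Rightarrow> real" and \<nu> :: "'a \<Rightarrow> nat" and f :: "real \<Rightarrow> complex"
  assumes "inj_on \<nu> G" "\<And>g. g \<in> G \<Longrightarrow> \<nu> g > 0" "T > 0" "0 < \<eta>" "\<eta> \<le> 1"
    and summ: "(\<lambda>g. \<bar>c g\<bar> * real (\<nu> g) powr \<eta>) summable_on G"
    and f: "\<And>t. ((\<lambda>g. c g * cis (- ln (real (\<nu> g)) * t)) has_sum f t) G"
    and cont: "continuous_on {T..2 * T} f"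
  shows "\<bar>1 / T * integral {T..2 * T} (\<lambda>t. (norm (f t))\<^sup>2) - (\<Sum>\<^sub>\<infinity>g\<in>G. (c g)\<^sup>2)\<bar>
           \<le> (2 / T) powr \<eta> * (\<Sum>\<^sub>\<infinity>g\<in>G. \<bar>c g\<bar> * real (\<nu> g) powr \<eta>)\<^sup>2"
proof -
  define S where "S = (\<Sum>\<^sub>\<infinity>g\<in>G. \<bar>c g\<bar>)"
  let ?S = "\<Sum>\<^sub>\<infinity>g\<in>G. \<bar>c g\<bar> * real (\<nu> g) powr \<eta>"
  let ?R = "(2 / T) powr \<eta> * ?S\<^sup>2"
  let ?e = "\<lambda>g t. complex_of_real (c g) * cis (- ln (real (\<nu> g)) * t)"
  have c_le: "\<bar>c g\<bar> \<le> \<bar>c g\<bar> * real (\<nu> g) powr \<eta>" if "g \<in> G" for g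
    using mult_left_mono[of 1 "real (\<nu> g) powr \<eta>" "\<bar>c g\<bar>"] assms(2)[OF that] assms(4)
    by (simp add: ge_one_powr_ge_zero)
  have csum: "(\<lambda>g. \<bar>c g\<bar>) summable_on G"
    using c_le by (intro summable_on_comparison_test[OF summ]) auto
  have S0: "S \<ge> 0" unfolding S_def by (intro infsum_nonneg) auto
  have c_S: "\<bar>c g\<bar> \<le> S" if "g \<in> G" for g
  proof -
    have "\<bar>c g\<bar> = (\<Sum>\<^sub>\<infinity>g\<in>{g}. \<bar>c g\<bar>)" by simp
    also have "\<dots> \<le> S"
      unfolding S_def using that csum by (intro infsum_mono2) auto
    finally show ?thesis .
  qed
  have c2_le: "(c g)\<^sup>2 \<le> S * \<bar>c g\<bar>" if "g \<in> G" for g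
    using mult_right_mono[OF c_S[OF that], of "\<bar>c g\<bar>"] by (simp add: power2_eq_square flip: abs_mult)
  have c2sum: "(\<lambda>g. (c g)\<^sup>2) summable_on G"
    using c2_le by (intro summable_on_comparison_test[OF summable_on_cmult_right[OF csum, of S]]) auto
  have tail: "norm (f t - (\<Sum>g\<in>F. ?e g t)) \<le> (\<Sum>\<^sub>\<infinity>g\<in>G - F. \<bar>c g\<bar>)" if "finite F" "F \<subseteq> G" for F t
  proof -
    have "((\<lambda>g. ?e g t) has_sum (f t - (\<Sum>g\<in>F. ?e g t))) (G - F)"
      using that by (intro has_sum_Diff f) auto
    then have "f t - (\<Sum>g\<in>F. ?e g t) = (\<Sum>\<^sub>\<infinity>g\<in>G - F. ?e g t)" by (simp add: infsumI)
    also have "norm \<dots> \<le> (\<Sum>\<^sub>\<infinity>g\<in>G - F. norm (?e g t))"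
      using summable_on_subset[OF csum, of "G - F"] by (intro norm_infsum_bound) (simp add: norm_mult)
    finally show ?thesis by (simp add: norm_mult)
  qed
  have f_le: "norm (f t) \<le> S" for t
    using tail[of "{}" t] by (simp add: S_def)
  have fF_le: "norm (\<Sum>g\<in>F. ?e g t) \<le> S" if "finite F" "F \<subseteq> G" for F t
  proof -
    have "norm (\<Sum>g\<in>F. ?e g t) \<le> (\<Sum>g\<in>F. \<bar>c g\<bar>)"
      by (rule order_trans[OF norm_sum]) (simp add: norm_mult)
    also have "\<dots> = (\<Sum>\<^sub>\<infinity>g\<in>F. \<bar>c g\<bar>)" using that by simp
    also have "\<dots> \<le> S" unfolding S_def using that csum by (intro infsum_mono2) auto
    finally show ?thesis .
  qed
  have "\<bar>1 / T * integral {T..2 * T} (\<lambda>t. (norm (f t))\<^sup>2) - (\<Sum>\<^sub>\<infinity>g\<in>G. (c g)\<^sup>2)\<bar> \<le> ?R + \<epsilon>"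
    if "\<epsilon> > 0" for \<epsilon>
  proof -
    \<comment> \<open>The integral will cost 2 S tau and the diagonal S tau; the added 1 keeps the
      denominator positive when S = 0.\<close>
    define \<tau> where "\<tau> = \<epsilon> / (3 * S + 1)"
    have \<tau>: "\<tau> > 0" and S\<tau>: "3 * S * \<tau> \<le> \<epsilon>"
      using that S0 by (auto simp: \<tau>_def field_simps)
    obtain F where F: "finite F" "F \<subseteq> G" "dist (\<Sum>g\<in>F. \<bar>c g\<bar>) S \<le> \<tau>"
      using infsum_finite_approximation[OF csum \<tau>] unfolding S_def by blast
    have Ftail: "(\<Sum>\<^sub>\<infinity>g\<in>G - F. \<bar>c g\<bar>) \<le> \<tau>"
    proof -
      have "(\<Sum>\<^sub>\<infinity>g\<in>G - F. \<bar>c g\<bar>) = S - (\<Sum>g\<in>F. \<bar>c g\<bar>)"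
        unfolding S_def using F csum by (subst infsum_Diff) auto
      then show ?thesis using F(3) by (simp add: dist_real_def)
    qed
    define fF where "fF = (\<lambda>t. \<Sum>g\<in>F. ?e g t)"
    have contF: "continuous_on {T..2 * T} fF" unfolding fF_def by (intro continuous_intros)
    have diff: "\<bar>(norm (f t))\<^sup>2 - (norm (fF t))\<^sup>2\<bar> \<le> 2 * S * \<tau>" for t
    proof -
      have "\<bar>(norm (f t))\<^sup>2 - (norm (fF t))\<^sup>2\<bar> = \<bar>norm (f t) + norm (fF t)\<bar> * \<bar>norm (f t) - norm (fF t)\<bar>"
        by (simp add: power2_eq_square square_diff_square_factored abs_mult)
      also have "\<dots> \<le> (2 * S) * \<tau>"
      proof (rule mult_mono)
        show "\<bar>norm (f t) + norm (fF t)\<bar> \<le> 2 * S"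
          using f_le[of t] fF_le[OF F(1,2), of t] by (simp add: fF_def)
        show "\<bar>norm (f t) - norm (fF t)\<bar> \<le> \<tau>"
          using tail[OF F(1,2), of t] Ftail norm_triangle_ineq3[of "f t" "fF t"] by (simp add: fF_def)
      qed (use S0 in auto)
      finally show ?thesis .
    qed
    have int: "(\<lambda>t. (norm (f t))\<^sup>2) integrable_on {T..2 * T}" "(\<lambda>t. (norm (fF t))\<^sup>2) integrable_on {T..2 * T}"
      by (intro integrable_continuous_interval continuous_intros cont contF)+
    have "norm (integral {T..2 * T} (\<lambda>t. (norm (f t))\<^sup>2 - (norm (fF t))\<^sup>2)) \<le> 2 * S * \<tau> * (2 * T - T)"
      using assms(3) diff by (intro integral_bound continuous_intros cont contF) auto
    then have "\<bar>integral {T..2 * T} (\<lambda>t. (norm (f t))\<^sup>2) - integral {T..2 * T} (\<lambda>t. (norm (fF t))\<^sup>2)\<bar> \<le> 2 * S * \<tau> * T"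
      by (simp add: integral_diff[OF int])
    then have "\<bar>integral {T..2 * T} (\<lambda>t. (norm (f t))\<^sup>2) - integral {T..2 * T} (\<lambda>t. (norm (fF t))\<^sup>2)\<bar> / T \<le> 2 * S * \<tau>"
      using assms(3) by (simp add: divide_le_eq)
    then have 1: "\<bar>1 / T * integral {T..2 * T} (\<lambda>t. (norm (f t))\<^sup>2) - 1 / T * integral {T..2 * T} (\<lambda>t. (norm (fF t))\<^sup>2)\<bar> \<le> 2 * S * \<tau>"
      using assms(3) by (simp add: diff_divide_distrib[symmetric])
    have "\<bar>1 / T * integral {T..2 * T} (\<lambda>t. (norm (fF t))\<^sup>2) - (\<Sum>g\<in>F. (c g)\<^sup>2)\<bar>
           \<le> (2 / T) powr \<eta> * (\<Sum>g\<in>F. \<bar>c g\<bar> * real (\<nu> g) powr \<eta>)\<^sup>2"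
      unfolding fF_def using assms F by (intro mean_square_finite) (auto intro: inj_on_subset)
    also have "\<dots> \<le> ?R"
    proof (intro mult_left_mono power_mono)
      have "(\<Sum>g\<in>F. \<bar>c g\<bar> * real (\<nu> g) powr \<eta>) = (\<Sum>\<^sub>\<infinity>g\<in>F. \<bar>c g\<bar> * real (\<nu> g) powr \<eta>)"
        using F by simp
      also have "\<dots> \<le> ?S" using F summ by (intro infsum_mono2) auto
      finally show "(\<Sum>g\<in>F. \<bar>c g\<bar> * real (\<nu> g) powr \<eta>) \<le> ?S" .
    qed (auto intro!: sum_nonneg)
    finally have 2: "\<bar>1 / T * integral {T..2 * T} (\<lambda>t. (norm (fF t))\<^sup>2) - (\<Sum>g\<in>F. (c g)\<^sup>2)\<bar> \<le> ?R" .
    have "(\<Sum>\<^sub>\<infinity>g\<in>G. (c g)\<^sup>2) - (\<Sum>g\<in>F. (c g)\<^sup>2) = (\<Sum>\<^sub>\<infinity>g\<in>G - F. (c g)\<^sup>2)"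
      using F c2sum by (subst infsum_Diff) auto
    moreover have "\<dots> \<le> (\<Sum>\<^sub>\<infinity>g\<in>G - F. S * \<bar>c g\<bar>)"
    proof (rule infsum_mono)
      show "(\<lambda>g. (c g)\<^sup>2) summable_on G - F" by (rule summable_on_subset[OF c2sum]) auto
      show "(\<lambda>g. S * \<bar>c g\<bar>) summable_on G - F"
        by (rule summable_on_subset[OF summable_on_cmult_right[OF csum, of S]]) auto
    qed (use c2_le in auto)
    moreover have "\<dots> = S * (\<Sum>\<^sub>\<infinity>g\<in>G - F. \<bar>c g\<bar>)"
      by (rule infsum_cmult_right')
    moreover have "\<dots> \<le> S * \<tau>" using Ftail S0 by (intro mult_left_mono)
    moreover have "(\<Sum>\<^sub>\<infinity>g\<in>G - F. (c g)\<^sup>2) \<ge> 0" by (intro infsum_nonneg) auto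
    ultimately have 3: "\<bar>(\<Sum>\<^sub>\<infinity>g\<in>G. (c g)\<^sup>2) - (\<Sum>g\<in>F. (c g)\<^sup>2)\<bar> \<le> S * \<tau>"
      by linarith
    show ?thesis using 1 2 3 S\<tau> by linarith
  qed
  then show ?thesis by (rule field_le_epsilon)
qed

section \<open>Powers of P_X as finite Euler products\<close>

lemma P_X_power_eq:
  assumes "X \<ge> 1"
  defines "P \<equiv> {p::nat. prime p \<and> real p \<le> X}"
  shows "norm (P_X X s) powr (2 * k) =
    (norm (\<Prod>p\<in>P. exp (of_real k * (\<Sum>j=1..prime_exponent X p. (of_nat p powr (- s)) ^ j / of_nat j))))\<^sup>2"
proof -
  define Q where "Q = (\<Sum>n | 2 \<le> n \<and> real n \<le> X. mangoldt n * of_nat n powr (- s) / of_real (ln (real n)))"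
  have "Q = (\<Sum>n | 2 \<le> n \<and> real n \<le> X. mangoldt n * (of_nat n powr (- s) / of_real (ln (real n))))"
    by (simp add: Q_def)
  also have "\<dots> = (\<Sum>p\<in>P. \<Sum>j=1..prime_exponent X p. of_real (ln (real p)) *
      (of_nat (p ^ j) powr (- s) / of_real (ln (real (p ^ j)))))"
    unfolding P_def by (rule sum_mangoldt_eq_sum_primes[OF assms(1)])
  \<comment> \<open>Lambda(p^j) / log (p^j) = 1 / j.\<close>
  also have "\<dots> = (\<Sum>p\<in>P. \<Sum>j=1..prime_exponent X p. (of_nat p powr (- s)) ^ j / of_nat j)"
  proof (intro sum.cong refl)
    fix p j assume p: "p \<in> P" and j: "j \<in> {1..prime_exponent X p}"
    have p1: "p > 1" using p prime_gt_1_nat by (auto simp: P_def)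
    then have "ln (real p) > 0" by simp
    have "of_nat (p ^ j) powr (- s) = (of_nat p powr (- s)) ^ j"
    proof -
      have "(complex_of_nat p ^ m) powr (- s) = (of_nat p powr (- s)) ^ m" for m
        by (induction m) (auto simp: powr_times_real simp flip: of_nat_power)
      then show ?thesis by simp
    qed
    moreover have "ln (real (p ^ j)) = real j * ln (real p)"
      using p1 by (simp add: ln_realpow)
    ultimately show "of_real (ln (real p)) * (of_nat (p ^ j) powr (- s) / of_real (ln (real (p ^ j)))) =
        (of_nat p powr (- s)) ^ j / of_nat j"
      using \<open>ln (real p) > 0\<close> j by (simp add: field_simps)
  qed
  finally have Q: "Q = \<dots>" .
  have "norm (P_X X s) = exp (Re Q)"
    by (simp add: P_X_def Q_def)
  then have "norm (P_X X s) powr (2 * k) = exp (2 * (k * Re Q))"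
    by (simp only: exp_powr_real mult_ac)
  \<comment> \<open>Scaling the exponent gives the k-th power for every real k without a choice of
    branch.\<close>
  also have "\<dots> = (norm (exp (of_real k * Q)))\<^sup>2"
  proof -
    have "Re (of_real k * Q) = k * Re Q" by simp
    then show ?thesis by (simp only: exp_double norm_exp_eq_Re)
  qed
  also have "of_real k * Q = (\<Sum>p\<in>P. of_real k * (\<Sum>j=1..prime_exponent X p. (of_nat p powr (- s)) ^ j / of_nat j))"
    unfolding Q by (rule sum_distrib_left)
  also have "exp \<dots> = (\<Prod>p\<in>P. exp (of_real k * (\<Sum>j=1..prime_exponent X p. (of_nat p powr (- s)) ^ j / of_nat j)))"
    by (rule exp_sum) (simp add: P_def)
  finally show ?thesis .
qed

lemma prime_powr_minus_Complex:
  assumes "p > 0"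
  shows "complex_of_nat p powr (- Complex \<sigma> t) = of_real (real p powr (- \<sigma>)) * cis (- ln (real p) * t)"
proof -
  have "complex_of_nat p powr (- Complex \<sigma> t) = exp (- Complex \<sigma> t * of_real (ln (real p)))"
    using assms by (simp add: powr_def Ln_of_nat)
  also have "- Complex \<sigma> t * of_real (ln (real p)) = of_real (- \<sigma> * ln (real p)) + \<i> * of_real (- ln (real p) * t)"
    by (simp add: complex_eq_iff)
  also have "exp \<dots> = of_real (exp (- \<sigma> * ln (real p))) * cis (- ln (real p) * t)"
    by (simp only: exp_add exp_of_real cis_conv_exp)
  finally show ?thesis using assms by (simp add: powr_def)
qed

lemma cis_vector_value:
  assumes "\<And>p. p \<in> P \<Longrightarrow> prime p"
  shows "cis (- ln (real (vector_value P g)) * t) = (\<Prod>p\<in>P. cis (- ln (real p) * t) ^ g p)"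
proof (cases "finite P")
  case True
  then show ?thesis using assms
  proof (induction P rule: finite_induct)
    case (insert p P)
    have p: "p > 0" using insert.prems[of p] prime_gt_0_nat by auto
    have v: "vector_value P g > 0" using insert.prems by (intro vector_value_pos) auto
    have "vector_value (insert p P) g = p ^ g p * vector_value P g"
      using insert.hyps by (simp add: vector_value_def)
    then have "ln (real (vector_value (insert p P) g)) = real (g p) * ln (real p) + ln (real (vector_value P g))"
      using p v by (simp add: ln_mult ln_realpow)
    then have "cis (- ln (real (vector_value (insert p P) g)) * t) =
        cis (real (g p) * (- ln (real p) * t)) * cis (- ln (real (vector_value P g)) * t)"
      by (simp add: cis_mult algebra_simps)
    also have "cis (real (g p) * (- ln (real p) * t)) = cis (- ln (real p) * t) ^ g p"
      by (rule Complex.DeMoivre[symmetric])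
    also have "cis (- ln (real (vector_value P g)) * t) = (\<Prod>p\<in>P. cis (- ln (real p) * t) ^ g p)"
      using insert by auto
    finally show ?case using insert.hyps by simp
  qed (simp add: vector_value_def)
qed (simp add: vector_value_def)

lemma norm_summable_imp_summable_on_nat:
  fixes f :: "nat \<Rightarrow> 'a::banach"
  assumes "summable (\<lambda>n. norm (f n))"
  shows "(\<lambda>n. norm (f n)) summable_on UNIV"
  using norm_summable_imp_summable_on[of "\<lambda>n. norm (f n)"] assms by simp

lemma infsum_eq_suminf_nat:
  fixes f :: "nat \<Rightarrow> 'a::banach"
  assumes "summable (\<lambda>n. norm (f n))"
  shows "infsum f UNIV = suminf f"
  using norm_summable_imp_has_sum[OF assms summable_sums[OF summable_norm_cancel[OF assms]]] by (rule infsumI)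

text \<open>Distinct exponent vectors have distinct values, so the expanded product is a Dirichlet
  series to which the mean square estimate applies. The diagonal and the absolute sum factor again
  over P; the weight n^eta merely moves sigma to sigma - eta.\<close>

lemma mean_square_euler_product:
  fixes P :: "nat set" and J :: "nat \<Rightarrow> nat" and k \<sigma> T \<eta> :: real
  assumes P: "finite P" "\<And>p. p \<in> P \<Longrightarrow> prime p" and T: "T > 0" and \<eta>: "0 < \<eta>" "\<eta> \<le> 1" "\<eta> < \<sigma>"
  defines "f \<equiv> \<lambda>t. \<Prod>p\<in>P. exp (of_real k * (\<Sum>j=1..J p. (of_nat p powr (- Complex \<sigma> t)) ^ j / of_nat j))"
  shows "\<bar>1 / T * integral {T..2 * T} (\<lambda>t. (norm (f t))\<^sup>2) -
           (\<Prod>p\<in>P. exp_factor k (J p) (real p powr (- (2 * \<sigma>))))\<bar>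
         \<le> (2 / T) powr \<eta> * (\<Prod>p\<in>P. (1 - real p powr (- (\<sigma> - \<eta>))) powr (- \<bar>k\<bar>))\<^sup>2"
proof -
  let ?G = "exponent_vectors P" and ?\<nu> = "vector_value P"
  define b where "b = (\<lambda>g. \<Prod>p\<in>P. exp_coeff k (J p) (g p))"
  define c where "c = (\<lambda>g. b g * real (?\<nu> g) powr (- \<sigma>))"
  have pos: "real p > 0" if "p \<in> P" for p using P(2)[OF that] prime_gt_0_nat by auto
  have x1: "real p powr (- s) < 1" "0 < real p powr (- s)" if "p \<in> P" "s > 0" for p s
    using prime_powr_less_1[OF P(2)[OF that(1)] that(2)] pos[OF that(1)] by auto
  have fact: "(\<lambda>m. norm (of_real (exp_coeff k (J p) m) * z ^ m)) summable_on UNIV" if "norm z < 1" for p and z :: complex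
    using exp_coeff_norm_summable[OF that] by (rule norm_summable_imp_summable_on_nat)
  have real_summable: "summable (\<lambda>m. norm (exp_coeff k (J p) m * x ^ m))" if "0 \<le> x" "x < 1" for p x
    using exp_coeff_norm_summable[of "of_real x" k "J p"] that by (simp add: norm_mult norm_power abs_mult power_abs)
  have has_sum: "((\<lambda>g. c g * cis (- ln (real (?\<nu> g)) * t)) has_sum f t) ?G" for t
  proof -
    define z where "z = (\<lambda>p. complex_of_nat p powr (- Complex \<sigma> t))"
    have z_eq: "z p = of_real (real p powr (- \<sigma>)) * cis (- ln (real p) * t)" if "p \<in> P" for p
      using pos[OF that] by (simp add: z_def prime_powr_minus_Complex)
    have z: "norm (z p) < 1" if "p \<in> P" for p
      using x1[OF that, of \<sigma>] \<eta> unfolding z_eq[OF that] by (simp add: norm_mult)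
    let ?t = "\<lambda>p m. of_real (exp_coeff k (J p) m) * z p ^ m"
    have 1: "(\<lambda>g. \<Prod>p\<in>P. ?t p (g p)) summable_on ?G"
      by (rule abs_summable_summable) (intro abs_summable_on_exponent_vectors P fact z)
    have 2: "(\<Sum>\<^sub>\<infinity>g\<in>?G. \<Prod>p\<in>P. ?t p (g p)) = f t"
    proof -
      have "(\<Sum>\<^sub>\<infinity>g\<in>?G. \<Prod>p\<in>P. ?t p (g p)) = (\<Prod>p\<in>P. \<Sum>\<^sub>\<infinity>m. ?t p m)"
        by (intro infsum_exponent_vectors P fact z)
      also have "\<dots> = f t"
        unfolding f_def
      proof (intro prod.cong refl)
        fix p assume p: "p \<in> P"
        have "(\<Sum>\<^sub>\<infinity>m. ?t p m) = exp (of_real k * (\<Sum>j=1..J p. z p ^ j / of_nat j))"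
          unfolding infsum_eq_suminf_nat[OF exp_coeff_norm_summable[OF z[OF p]]]
          by (rule exp_coeff_sum[OF z[OF p]])
        then show "(\<Sum>\<^sub>\<infinity>m. ?t p m) =
            exp (of_real k * (\<Sum>j=1..J p. (of_nat p powr (- Complex \<sigma> t)) ^ j / of_nat j))"
          by (simp only: z_def)
      qed
      finally show ?thesis .
    qed
    have 3: "(\<Prod>p\<in>P. ?t p (g p)) = c g * cis (- ln (real (?\<nu> g)) * t)" for g
    proof -
      have "(\<Prod>p\<in>P. ?t p (g p)) = (\<Prod>p\<in>P. of_real (exp_coeff k (J p) (g p)) *
          (of_real ((real p powr (- \<sigma>)) ^ g p) * cis (- ln (real p) * t) ^ g p))"
        by (intro prod.cong refl) (simp add: z_eq power_mult_distrib)
      also have "\<dots> = of_real (b g) * (of_real (real (?\<nu> g) powr (- \<sigma>)) * cis (- ln (real (?\<nu> g)) * t))"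
      proof -
        have v: "cis (- ln (real (?\<nu> g)) * t) = (\<Prod>p\<in>P. cis (- ln (real p) * t) ^ g p)"
          by (rule cis_vector_value) (rule P)
        show ?thesis
          unfolding v b_def vector_value_powr by (simp only: prod.distrib of_real_prod of_real_power)
      qed
      finally show ?thesis by (simp add: c_def)
    qed
    show ?thesis using has_sum_infsum[OF 1, unfolded 2] unfolding 3 .
  qed
  have sq: "(\<Sum>\<^sub>\<infinity>g\<in>?G. (c g)\<^sup>2) = (\<Prod>p\<in>P. exp_factor k (J p) (real p powr (- (2 * \<sigma>))))"
  proof -
    let ?t = "\<lambda>p m. (exp_coeff k (J p) m)\<^sup>2 * (real p powr (- (2 * \<sigma>))) ^ m"
    have s: "summable (\<lambda>m. norm (?t p m))" if "p \<in> P" for p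
      using exp_factor_summable[of "real p powr (- (2 * \<sigma>))" k "J p"] x1[OF that, of "2 * \<sigma>"] \<eta> by (simp add: abs_mult)
    have "(c g)\<^sup>2 = (\<Prod>p\<in>P. ?t p (g p))" for g
    proof -
      have "(real (?\<nu> g) powr (- \<sigma>))\<^sup>2 = real (?\<nu> g) powr (- (2 * \<sigma>))"
        by (simp add: power2_eq_square flip: powr_add)
      then show ?thesis
        unfolding c_def b_def power_mult_distrib by (simp add: vector_value_powr prod.distrib prod_power_distrib)
    qed
    then have "(\<Sum>\<^sub>\<infinity>g\<in>?G. (c g)\<^sup>2) = (\<Sum>\<^sub>\<infinity>g\<in>?G. \<Prod>p\<in>P. ?t p (g p))" by simp
    also have "\<dots> = (\<Prod>p\<in>P. \<Sum>\<^sub>\<infinity>m. ?t p m)"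
      by (intro infsum_exponent_vectors P norm_summable_imp_summable_on_nat s)
    also have "\<dots> = (\<Prod>p\<in>P. exp_factor k (J p) (real p powr (- (2 * \<sigma>))))"
      unfolding exp_factor_def by (intro prod.cong refl infsum_eq_suminf_nat s)
    finally show ?thesis .
  qed
  let ?u = "\<lambda>p m. exp_coeff k (J p) m * (real p powr (- (\<sigma> - \<eta>))) ^ m"
  have us: "summable (\<lambda>m. norm (?u p m))" if "p \<in> P" for p
    using x1[OF that, of "\<sigma> - \<eta>"] \<eta> by (intro real_summable) auto
  have abs_eq: "\<bar>c g\<bar> * real (?\<nu> g) powr \<eta> = (\<Prod>p\<in>P. \<bar>?u p (g p)\<bar>)" for g
  proof -
    have "real (?\<nu> g) powr (- \<sigma>) * real (?\<nu> g) powr \<eta> = real (?\<nu> g) powr (- (\<sigma> - \<eta>))"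
      by (simp flip: powr_add)
    then have "\<bar>c g\<bar> * real (?\<nu> g) powr \<eta> = \<bar>b g\<bar> * real (?\<nu> g) powr (- (\<sigma> - \<eta>))"
      by (simp add: c_def abs_mult)
    also have "\<dots> = (\<Prod>p\<in>P. \<bar>exp_coeff k (J p) (g p)\<bar> * (real p powr (- (\<sigma> - \<eta>))) ^ g p)"
      by (simp add: b_def vector_value_powr prod.distrib abs_prod)
    finally show ?thesis by (simp add: abs_mult)
  qed
  have summ: "(\<lambda>g. \<bar>c g\<bar> * real (?\<nu> g) powr \<eta>) summable_on ?G"
    using abs_summable_on_exponent_vectors[OF P(1), of ?u] norm_summable_imp_summable_on_nat[OF us]
    unfolding abs_eq by (simp add: abs_prod)
  have "(\<Sum>\<^sub>\<infinity>g\<in>?G. \<bar>c g\<bar> * real (?\<nu> g) powr \<eta>) = (\<Prod>p\<in>P. \<Sum>\<^sub>\<infinity>m. \<bar>?u p m\<bar>)"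
    unfolding abs_eq using norm_summable_imp_summable_on_nat[OF us]
    by (intro infsum_exponent_vectors P) simp
  also have "\<dots> \<le> (\<Prod>p\<in>P. (1 - real p powr (- (\<sigma> - \<eta>))) powr (- \<bar>k\<bar>))"
  proof (intro prod_mono conjI infsum_nonneg)
    fix p assume p: "p \<in> P"
    define x where "x = real p powr (- (\<sigma> - \<eta>))"
    have x: "0 < x" "x < 1" using x1[OF p, of "\<sigma> - \<eta>"] \<eta> by (auto simp: x_def)
    have bs: "(\<lambda>m. binom_coeff \<bar>k\<bar> m * x ^ m) sums (1 - x) powr (- \<bar>k\<bar>)"
      using x by (intro binom_coeff_sums) auto
    have "(\<Sum>\<^sub>\<infinity>m. \<bar>?u p m\<bar>) = (\<Sum>m. \<bar>?u p m\<bar>)"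
      using us[OF p] by (intro infsum_eq_suminf_nat) simp
    also have "\<dots> \<le> (\<Sum>m. binom_coeff \<bar>k\<bar> m * x ^ m)"
    proof (rule suminf_le)
      show "\<bar>?u p m\<bar> \<le> binom_coeff \<bar>k\<bar> m * x ^ m" for m
        using mult_right_mono[OF abs_exp_coeff_le[of k "J p" m], of "x ^ m"] x by (simp add: abs_mult x_def)
      show "summable (\<lambda>m. \<bar>?u p m\<bar>)" using us[OF p] by simp
      show "summable (\<lambda>m. binom_coeff \<bar>k\<bar> m * x ^ m)" using bs by (simp add: sums_iff)
    qed
    also have "\<dots> = (1 - x) powr (- \<bar>k\<bar>)" using bs by (simp add: sums_iff)
    finally show "(\<Sum>\<^sub>\<infinity>m. \<bar>?u p m\<bar>) \<le> (1 - real p powr (- (\<sigma> - \<eta>))) powr (- \<bar>k\<bar>)" by (simp add: x_def)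
  qed auto
  finally have S: "(\<Sum>\<^sub>\<infinity>g\<in>?G. \<bar>c g\<bar> * real (?\<nu> g) powr \<eta>) \<le> (\<Prod>p\<in>P. (1 - real p powr (- (\<sigma> - \<eta>))) powr (- \<bar>k\<bar>))" .
  have cont: "continuous_on {T..2 * T} f"
  proof -
    have "continuous_on {T..2 * T} (\<lambda>t. complex_of_nat p powr (- Complex \<sigma> t))" if "p \<in> P" for p
    proof -
      have "(\<lambda>t. complex_of_nat p powr (- Complex \<sigma> t)) = (\<lambda>t. of_real (real p powr (- \<sigma>)) * cis (- ln (real p) * t))"
        using pos[OF that] by (simp add: prime_powr_minus_Complex)
      then show ?thesis using pos[OF that] by (auto intro!: continuous_intros)
    qed
    then show ?thesis unfolding f_def
      by (intro continuous_on_prod continuous_on_exp continuous_on_mult continuous_on_const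
            continuous_on_sum continuous_on_divide continuous_on_power) auto
  qed
  have "\<bar>1 / T * integral {T..2 * T} (\<lambda>t. (norm (f t))\<^sup>2) - (\<Sum>\<^sub>\<infinity>g\<in>?G. (c g)\<^sup>2)\<bar>
           \<le> (2 / T) powr \<eta> * (\<Sum>\<^sub>\<infinity>g\<in>?G. \<bar>c g\<bar> * real (?\<nu> g) powr \<eta>)\<^sup>2"
    using P T \<eta> summ has_sum cont vector_value_pos[OF P(2)]
    by (intro mean_square_infinite inj_on_vector_value) auto
  also have "\<dots> \<le> (2 / T) powr \<eta> * (\<Prod>p\<in>P. (1 - real p powr (- (\<sigma> - \<eta>))) powr (- \<bar>k\<bar>))\<^sup>2"
    using S by (intro mult_left_mono power_mono infsum_nonneg) auto
  finally show ?thesis unfolding sq .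
qed

section \<open>Asymptotics of the moments\<close>

text \<open>Integral comparison: by the mean value theorem each new term is at most the increment of
  the right-hand side.\<close>

lemma sum_powr_le:
  fixes a :: real
  assumes "0 < a" "a < 1" "N \<ge> 1"
  shows "(\<Sum>n=1..N. real n powr (- a)) \<le> real N powr (1 - a) / (1 - a)"
  using \<open>N \<ge> 1\<close>
proof (induction N rule: dec_induct)
  case base
  then show ?case using assms by (simp add: field_simps)
next
  case (step n)
  let ?f = "\<lambda>x::real. x powr (1 - a)"
  have "\<exists>x. real n < x \<and> x < real (Suc n) \<and>
      ?f (real (Suc n)) - ?f (real n) = (real (Suc n) - real n) * ((1 - a) * x powr (1 - a - 1))"
    using step by (intro MVT2 has_real_derivative_powr) auto
  then obtain x where x: "real n < x" "x < real (Suc n)"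
    "?f (real (Suc n)) - ?f (real n) = (real (Suc n) - real n) * ((1 - a) * x powr (1 - a - 1))"
    by blast
  have eqs: "real (Suc n) - real n = 1" "1 - a - 1 = - a" by simp_all
  have "real (Suc n) powr (- a) \<le> x powr (- a)"
    using x(1,2) assms step by (intro powr_mono2') auto
  then have "(1 - a) * real (Suc n) powr (- a) \<le> ?f (real (Suc n)) - ?f (real n)"
    using x(3) assms unfolding eqs by simp
  then have "real (Suc n) powr (- a) \<le> (?f (real (Suc n)) - ?f (real n)) / (1 - a)"
    using assms by (simp add: field_simps)
  then show ?case using step.IH by (simp add: diff_divide_distrib)
qed

text \<open>The primes are replaced by all integers up to X. This is crude, but only the power of X
  in the exponent matters.\<close>

lemma euler_product_growth:
  assumes "1/4 \<le> a" "a < 1" "a \<le> s" "X \<ge> 1"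
  shows "(\<Prod>p | prime p \<and> real p \<le> X. (1 - real p powr (- s)) powr (- \<bar>k\<bar>))
           \<le> exp (8 * \<bar>k\<bar> / (1 - a) * X powr (1 - a))"
proof -
  define P where "P = {p::nat. prime p \<and> real p \<le> X}"
  define N where "N = nat \<lfloor>X\<rfloor>"
  have N: "N \<ge> 1" "real N \<le> X" using assms by (auto simp: N_def le_nat_iff)
  have "(\<Prod>p\<in>P. (1 - real p powr (- s)) powr (- \<bar>k\<bar>)) \<le> (\<Prod>p\<in>P. exp (8 * \<bar>k\<bar> * real p powr (- a)))"
  proof (intro prod_mono conjI)
    fix p assume p: "p \<in> P"
    then have p2: "real p \<ge> 2" using prime_ge_2_nat[of p] by (auto simp: P_def)
    define x where "x = real p powr (- s)"
    have xa: "x \<le> real p powr (- a)" unfolding x_def using p2 assms by (intro powr_mono) auto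
    have x0: "0 < x" using p2 by (simp add: x_def)
    have "real p powr (- a) \<le> real p powr (-1/4)" using p2 assms by (intro powr_mono) auto
    also have "\<dots> \<le> 2 powr (-1/4)" using p2 by (intro powr_mono2') auto
    \<comment> \<open>The bound a >= 1/4 keeps x away from 1, since (7/8)^4 > 1/2; the remaining gap
      1/8 is the origin of the factor 8.\<close>
    also have "(2::real) powr (-1/4) \<le> 7/8"
    proof -
      have "(1/2 :: real) powr (1/4) \<le> ((7/8) ^ 4) powr (1/4)"
        by (intro powr_mono2) (auto simp: power_divide)
      also have "((7/8 :: real) ^ 4) powr (1/4) = 7/8"
        by (subst powr_realpow[symmetric]) (auto simp: powr_powr simp del: powr_numeral)
      finally show ?thesis by (simp add: powr_minus_divide powr_divide)
    qed
    finally have x1: "x \<le> 7/8" using xa by linarith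
    have "- ln (1 - x) = ln (1 / (1 - x))" using x1 by (simp add: ln_div)
    also have "\<dots> \<le> 1 / (1 - x) - 1" using x1 by (intro ln_le_minus_one) auto
    also have "\<dots> = x / (1 - x)" using x1 by (simp add: field_simps)
    also have "\<dots> \<le> x / (1 / 8)" using x0 x1 by (intro divide_left_mono) auto
    also have "\<dots> \<le> 8 * real p powr (- a)" using xa by simp
    finally have "\<bar>k\<bar> * - ln (1 - x) \<le> \<bar>k\<bar> * (8 * real p powr (- a))"
      by (intro mult_left_mono) auto
    then show "(1 - real p powr (- s)) powr (- \<bar>k\<bar>) \<le> exp (8 * \<bar>k\<bar> * real p powr (- a))"
      using x1 unfolding x_def[symmetric] by (simp add: powr_def algebra_simps)
  qed auto
  also have "\<dots> = exp (8 * \<bar>k\<bar> * (\<Sum>p\<in>P. real p powr (- a)))"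
    by (subst exp_sum[symmetric]) (auto simp: P_def sum_distrib_left)
  also have "\<dots> \<le> exp (8 * \<bar>k\<bar> / (1 - a) * X powr (1 - a))"
  proof -
    have "(\<Sum>p\<in>P. real p powr (- a)) \<le> (\<Sum>n=1..N. real n powr (- a))"
      using prime_ge_1_nat by (intro sum_mono2) (auto simp: P_def N_def le_nat_floor)
    also have "\<dots> \<le> real N powr (1 - a) / (1 - a)" using assms N by (intro sum_powr_le) auto
    also have "\<dots> \<le> X powr (1 - a) / (1 - a)" using assms N by (intro divide_right_mono powr_mono2) auto
    finally have "8 * \<bar>k\<bar> * (\<Sum>p\<in>P. real p powr (- a)) \<le> 8 * \<bar>k\<bar> * (X powr (1 - a) / (1 - a))"
      by (intro mult_left_mono) auto
    then show ?thesis by simp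
  qed
  finally show ?thesis by (simp add: P_def)
qed

text \<open>With L = log T the logarithm of the left-hand side is -eta L + K L^rho + O(log L), and
  rho < 1 lets the first term prevail.\<close>

lemma error_term_eventually_small:
  fixes \<eta> \<rho> K A \<kappa> :: real
  assumes "\<eta> > 0" "\<rho> < 1" "A > 0"
  shows "\<forall>\<^sub>F T in at_top. (2 / T) powr \<eta> * exp (K * ln T powr \<rho>) * (A * ln T powr \<kappa>) \<le> 1"
proof -
  have 1: "((\<lambda>L::real. ln L / L) \<longlongrightarrow> 0) at_top" by real_asymp
  have 2: "((\<lambda>L::real. L powr (\<rho> - 1)) \<longlongrightarrow> 0) at_top"
    using assms by (intro tendsto_neg_powr) (auto simp: filterlim_ident)
  have 3: "((\<lambda>L::real. 1 / L) \<longlongrightarrow> 0) at_top" by real_asymp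
  have "((\<lambda>L. (\<eta> * ln 2 + ln A) * (1 / L) - \<eta> + K * L powr (\<rho> - 1) + \<kappa> * (ln L / L)) \<longlongrightarrow>
      (\<eta> * ln 2 + ln A) * 0 - \<eta> + K * 0 + \<kappa> * 0) at_top"
    by (intro tendsto_intros 1 2 3)
  then have "\<forall>\<^sub>F L in at_top. (\<eta> * ln 2 + ln A) * (1 / L) - \<eta> + K * L powr (\<rho> - 1) + \<kappa> * (ln L / L) < 0"
    by (rule order_tendstoD) (use assms in simp)
  then have "\<forall>\<^sub>F T in at_top. (\<eta> * ln 2 + ln A) * (1 / ln T) - \<eta> + K * ln T powr (\<rho> - 1) + \<kappa> * (ln (ln T) / ln T) < 0"
    using ln_at_top unfolding filterlim_iff by blast
  then show ?thesis
    using eventually_gt_at_top[of "1::real"]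
  proof eventually_elim
    case (elim T)
    define L where "L = ln T"
    have L: "L > 0" using elim by (simp add: L_def)
    have "L powr (\<rho> - 1) * L = L powr \<rho>" using L by (simp add: powr_diff)
    moreover have "((\<eta> * ln 2 + ln A) * (1 / L) - \<eta> + K * L powr (\<rho> - 1) + \<kappa> * (ln L / L)) * L \<le> 0"
      using elim(1) L unfolding L_def by (intro mult_nonpos_nonneg) auto
    ultimately have le: "\<eta> * ln 2 + ln A - \<eta> * L + K * L powr \<rho> + \<kappa> * ln L \<le> 0"
      using L by (simp add: algebra_simps)
    have "(2 / T) powr \<eta> * exp (K * ln T powr \<rho>) * (A * ln T powr \<kappa>) =
        exp (\<eta> * (ln 2 - L)) * exp (K * L powr \<rho>) * (exp (ln A) * exp (\<kappa> * ln L))"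
      using elim L assms by (simp add: powr_def ln_div L_def)
    also have "\<dots> = exp (\<eta> * ln 2 + ln A - \<eta> * L + K * L powr \<rho> + \<kappa> * ln L)"
      unfolding exp_add[symmetric] by (simp add: algebra_simps)
    also have "\<dots> \<le> 1" using le by simp
    finally show ?case .
  qed
qed

lemma abs_exp_minus_one_le: "\<bar>exp x - 1\<bar> \<le> \<bar>x\<bar> * exp \<bar>x\<bar>" for x :: real
proof (cases "x \<ge> 0")
  case True
  have "(1 - x) * exp x \<le> exp (- x) * exp x"
    using exp_ge_add_one_self[of "- x"] by (intro mult_right_mono) auto
  then have "(1 - x) * exp x \<le> 1" by (simp flip: exp_add)
  then show ?thesis using True by (simp add: algebra_simps)
next
  case False
  have "1 - exp x \<le> - x" using exp_ge_add_one_self[of x] by linarith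
  also have "\<dots> \<le> - x * exp (- x)" using False by (simp add: mult_le_cancel_left1)
  finally show ?thesis using False by simp
qed

text \<open>D >= 1 turns the absolute error of I into a relative one, and l >= 1 keeps
  \<open>\<theta>\<close> bounded by C, so that e^theta - 1 is at most e^C times |theta|.\<close>

lemma relative_error_combine:
  fixes M \<theta> I D C l :: real
  assumes "l \<ge> 1" "C \<ge> 0" "\<bar>\<theta>\<bar> \<le> C / l" "D = M * exp \<theta>" "D \<ge> 1" "\<bar>I - D\<bar> \<le> 1 / l"
  shows "\<exists>E. \<bar>E\<bar> \<le> (exp C * (C + 1)) / l \<and> I = M * (1 + E)"
proof -
  define E where "E = exp \<theta> * (1 + (I - D) / D) - 1"
  have "C / l \<le> C / 1" using assms by (intro divide_left_mono) auto
  then have \<theta>C: "exp \<bar>\<theta>\<bar> \<le> exp C" using assms by simp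
  have \<theta>C': "exp \<theta> \<le> exp C" using \<theta>C by (smt (verit) exp_le_cancel_iff)
  have RD: "\<bar>(I - D) / D\<bar> \<le> 1 / l"
  proof -
    have "\<bar>(I - D) / D\<bar> = \<bar>I - D\<bar> / D" using assms by simp
    also have "\<dots> \<le> (1 / l) / 1" using assms by (intro frac_le) auto
    finally show ?thesis by simp
  qed
  have "E = (exp \<theta> - 1) + exp \<theta> * ((I - D) / D)" by (simp add: E_def algebra_simps)
  also have "\<bar>\<dots>\<bar> \<le> \<bar>\<theta>\<bar> * exp \<bar>\<theta>\<bar> + exp \<theta> * \<bar>(I - D) / D\<bar>"
    using abs_exp_minus_one_le[of \<theta>] by (intro order_trans[OF abs_triangle_ineq] add_mono) (auto simp: abs_mult)
  also have "\<dots> \<le> C / l * exp C + exp C * (1 / l)"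
    using assms \<theta>C \<theta>C' RD by (intro add_mono mult_mono) auto
  also have "\<dots> = (exp C * (C + 1)) / l" by (simp add: algebra_simps add_divide_distrib)
  finally have "\<bar>E\<bar> \<le> (exp C * (C + 1)) / l" .
  moreover have "I = M * (1 + E)"
  proof -
    have "M * (1 + E) = D * (1 + (I - D) / D)" by (simp add: E_def assms(4))
    also have "\<dots> = I" using assms(5) by (simp add: field_simps)
    finally show ?thesis by simp
  qed
  ultimately show ?thesis by blast
qed

theorem theorem2:
  fixes k :: real
  shows "\<exists>C>0. \<forall>c \<epsilon> A :: real. 1/2 \<le> c \<and> c < 1 \<and> \<epsilon> > 0 \<and> A > 0 \<longrightarrow>
    (\<exists>X\<^sub>0 T\<^sub>0. \<forall>X\<ge>X\<^sub>0. \<forall>T\<ge>T\<^sub>0. X \<le> A * (ln T) powr (1 / (1 - c + \<epsilon>)) \<longrightarrow>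
      (\<forall>\<sigma>\<in>{c..1}. \<exists>E. \<bar>E\<bar> \<le> C / ln X \<and>
        1 / T * integral {T..2 * T} (\<lambda>t. norm (P_X X (Complex \<sigma> t)) powr (2 * k)) =
          a_const k \<sigma> * F_X X k \<sigma> * (1 + E)))"
proof -
  obtain C where C: "C > 0"
    "\<And>\<sigma> X. \<sigma> \<ge> 1/2 \<Longrightarrow> X \<ge> 2 \<Longrightarrow>
       \<exists>\<theta>. \<bar>\<theta>\<bar> \<le> C / ln X \<and>
         (\<Prod>p | prime p \<and> real p \<le> X. exp_factor k (prime_exponent X p) (real p powr (- (2 * \<sigma>)))) =
         a_const k \<sigma> * F_X X k \<sigma> * exp \<theta>"
    using exp_factor_product_asymp[of k] by blast
  show ?thesis
  proof (rule exI[of _ "exp C * (C + 1)"], intro conjI allI impI)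
    show "exp C * (C + 1) > 0" using C(1) by simp
    fix c \<epsilon> A :: real
    assume "1/2 \<le> c \<and> c < 1 \<and> \<epsilon> > 0 \<and> A > 0"
    then have c: "1/2 \<le> c" "c < 1" and \<epsilon>: "\<epsilon> > 0" and A: "A > 0" by auto
    \<comment> \<open>Staying below epsilon forces the exponent rho below 1; staying below 1/4 keeps
      a = c - eta at least 1/4 and eta below sigma.\<close>
    define \<eta> where "\<eta> = min (\<epsilon> / 2) (1/4)"
    have \<eta>: "0 < \<eta>" "\<eta> \<le> 1/4" "\<eta> < \<epsilon>" using \<epsilon> by (auto simp: \<eta>_def)
    define a where "a = c - \<eta>"
    have a: "1/4 \<le> a" "a < 1" using c \<eta> by (auto simp: a_def)
    define \<kappa> where "\<kappa> = 1 / (1 - c + \<epsilon>)"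
    define \<rho> where "\<rho> = \<kappa> * (1 - a)"
    \<comment> \<open>rho = (1 - c + eta) / (1 - c + epsilon): this is where the epsilon in the
      range of X is spent.\<close>
    have \<rho>: "\<rho> < 1" using c \<eta> \<epsilon> a by (auto simp: \<rho>_def \<kappa>_def a_def field_simps)
    define K where "K = 2 * (8 * \<bar>k\<bar> / (1 - a) * A powr (1 - a))"
    obtain T1 where T1: "\<And>T. T \<ge> T1 \<Longrightarrow> (2 / T) powr \<eta> * exp (K * ln T powr \<rho>) * (A * ln T powr \<kappa>) \<le> 1"
      using error_term_eventually_small[OF \<eta>(1) \<rho> A, of K \<kappa>] unfolding eventually_at_top_linorder by blast
    show "\<exists>X\<^sub>0 T\<^sub>0. \<forall>X\<ge>X\<^sub>0. \<forall>T\<ge>T\<^sub>0. X \<le> A * (ln T) powr (1 / (1 - c + \<epsilon>)) \<longrightarrow>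
      (\<forall>\<sigma>\<in>{c..1}. \<exists>E. \<bar>E\<bar> \<le> exp C * (C + 1) / ln X \<and>
        1 / T * integral {T..2 * T} (\<lambda>t. norm (P_X X (Complex \<sigma> t)) powr (2 * k)) =
          a_const k \<sigma> * F_X X k \<sigma> * (1 + E))"
    \<comment> \<open>X >= e gives log X >= 1, and T >= 2 makes log T positive. \<open>T1\<close>
      depends on k, c, epsilon and A but neither on X nor on sigma, which is the uniformity
      claimed.\<close>
    proof (rule exI[of _ "exp 1"], rule exI[of _ "max T1 2"], intro allI impI ballI)
      fix X T \<sigma> :: real
      assume X: "X \<ge> exp 1" and T: "T \<ge> max T1 2" and XT: "X \<le> A * (ln T) powr (1 / (1 - c + \<epsilon>))" and \<sigma>: "\<sigma> \<in> {c..1}"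
      have X2: "X \<ge> 2" using X exp_ge_add_one_self[of 1] by linarith
      have lnX: "ln X \<ge> 1" using X X2 by (simp add: ln_ge_iff)
      have T0: "T > 0" "T \<ge> T1" using T by auto
      have L0: "ln T > 0" using T by (intro ln_gt_zero) auto
      have \<sigma>2: "\<sigma> \<ge> 1/2" "\<eta> < \<sigma>" "a \<le> \<sigma> - \<eta>" using \<sigma> c \<eta> by (auto simp: a_def)
      define P where "P = {p::nat. prime p \<and> real p \<le> X}"
      have P: "finite P" "\<And>p. p \<in> P \<Longrightarrow> prime p" by (auto simp: P_def)
      define f where "f = (\<lambda>t. \<Prod>p\<in>P. exp (of_real k * (\<Sum>j=1..prime_exponent X p. (of_nat p powr (- Complex \<sigma> t)) ^ j / of_nat j)))"
      define D where "D = (\<Prod>p\<in>P. exp_factor k (prime_exponent X p) (real p powr (- (2 * \<sigma>))))"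
      define S where "S = (\<Prod>p\<in>P. (1 - real p powr (- (\<sigma> - \<eta>))) powr (- \<bar>k\<bar>))"
      have ms: "\<bar>1 / T * integral {T..2 * T} (\<lambda>t. (norm (f t))\<^sup>2) - D\<bar> \<le> (2 / T) powr \<eta> * S\<^sup>2"
        unfolding f_def D_def S_def using P T0 \<eta> \<sigma>2 by (intro mean_square_euler_product) auto
      have S0: "S \<ge> 0" unfolding S_def by (intro prod_nonneg) auto
      have "S \<le> exp (8 * \<bar>k\<bar> / (1 - a) * X powr (1 - a))"
        unfolding S_def P_def using a \<sigma>2 X2 by (intro euler_product_growth) auto
      also have "\<dots> \<le> exp (8 * \<bar>k\<bar> / (1 - a) * (A powr (1 - a) * ln T powr \<rho>))"
      proof -
        have "X powr (1 - a) \<le> (A * ln T powr \<kappa>) powr (1 - a)"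
          using XT X2 a unfolding \<kappa>_def by (intro powr_mono2) auto
        also have "\<dots> = A powr (1 - a) * ln T powr \<rho>"
          using A by (simp add: powr_mult powr_powr \<rho>_def)
        finally show ?thesis using a by (intro exp_mono mult_left_mono) auto
      qed
      finally have "S\<^sup>2 \<le> (exp (8 * \<bar>k\<bar> / (1 - a) * (A powr (1 - a) * ln T powr \<rho>)))\<^sup>2"
        using S0 by (intro power_mono) auto
      also have "\<dots> = exp (K * ln T powr \<rho>)"
        unfolding K_def exp_double[symmetric] by (simp add: mult_ac)
      finally have "(2 / T) powr \<eta> * S\<^sup>2 \<le> (2 / T) powr \<eta> * exp (K * ln T powr \<rho>)"
        by (intro mult_left_mono) auto
      also have "\<dots> \<le> 1 / ln X"
      proof -
        \<comment> \<open>log X is itself at most a power of log T, so a bound in T alone brings the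
          off-diagonal part below 1 / log X.\<close>
        have "ln X \<le> A * ln T powr \<kappa>" using XT X2 ln_le_minus_one[of X] by (simp add: \<kappa>_def)
        then have "(2 / T) powr \<eta> * exp (K * ln T powr \<rho>) * ln X \<le> (2 / T) powr \<eta> * exp (K * ln T powr \<rho>) * (A * ln T powr \<kappa>)"
          by (intro mult_left_mono) auto
        also have "\<dots> \<le> 1" by (rule T1[OF T0(2)])
        finally show ?thesis using lnX by (simp add: field_simps)
      qed
      finally have err: "\<bar>1 / T * integral {T..2 * T} (\<lambda>t. (norm (f t))\<^sup>2) - D\<bar> \<le> 1 / ln X"
        using ms by linarith
      \<comment> \<open>Every local factor is a series of nonnegative terms beginning with 1, which
        bounds the diagonal from below independently of a(k, sigma) and F_X.\<close>
      have D1: "D \<ge> 1"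
        unfolding D_def
      proof (rule prod_ge_1)
        fix p assume "p \<in> P"
        then show "1 \<le> exp_factor k (prime_exponent X p) (real p powr (- (2 * \<sigma>)))"
          using prime_powr_less_1[OF P(2), of p "2 * \<sigma>"] \<sigma>2 by (intro exp_factor_ge_1) auto
      qed
      obtain \<theta> where \<theta>: "\<bar>\<theta>\<bar> \<le> C / ln X" "D = a_const k \<sigma> * F_X X k \<sigma> * exp \<theta>"
        using C(2)[OF \<sigma>2(1) X2] unfolding D_def P_def by blast
      have "norm (P_X X (Complex \<sigma> t)) powr (2 * k) = (norm (f t))\<^sup>2" for t
        unfolding f_def P_def using X2 by (intro P_X_power_eq) auto
      then show "\<exists>E. \<bar>E\<bar> \<le> exp C * (C + 1) / ln X \<and>
        1 / T * integral {T..2 * T} (\<lambda>t. norm (P_X X (Complex \<sigma> t)) powr (2 * k)) =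
          a_const k \<sigma> * F_X X k \<sigma> * (1 + E)"
        using relative_error_combine[OF lnX _ \<theta>(1) \<theta>(2) D1 err] C(1) by simp
    qed
  qed
qed

end
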